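(* Let $(R,\mathfrak{m},k)$ be a $d$-dimensional reduced $F$-finite Noetherian local ring of prime characteristic $p>0$, and let $M$ be a finitely generated $R$-module. Then there exists a positive constant $C$ such that for all $e,e'\in\mathbb{N}$ and any ideal $I$ of $R$ with $\mathfrak{m}^{[p^e]}\subseteq I$ we have $$\left|\ell_R(R/I\otimes_R M)-\frac{1}{p^{e'd}}\,\ell_R\big(R/I^{[p^{e'}]}\otimes_R M\big)\right|\le C\,p^{e(d-1)}.$$
   Context: Rings are commutative with unit. $\mathbb{N}$ denotes the positive integers. For an ideal $I$ of a ring of characteristic $p$ and $e\in\mathbb{N}$, $I^{[p^e]}$ is the ideal generated by $\{x^{p^e}: x\in I\}$. $\ell_R(\cdot)$ denotes length of an $R$-module. $R$ is $F$-finite if $R$ is finitely generated as a module over itself via the Frobenius endomorphism $r\mapsto r^p$. The constant $C$ depends on $R$ and $M$ but not on $e,e',I$. *)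

theory Defs
  imports "HOL-Algebra.Algebra" "HOL-Computational_Algebra.Primes" "HOL-Library.Extended_Real"
begin

section \<open>Rings\<close>

locale local_ring = cring R + maximalideal \<mm> R for R (structure) and \<mm> +
  assumes maximal_unique: "maximalideal J R \<Longrightarrow> J = \<mm>"

definition reduced :: "('a, 'b) ring_scheme \<Rightarrow> bool" where
  "reduced R \<longleftrightarrow> (\<forall>x\<in>carrier R. \<forall>n::nat. x [^]\<^bsub>R\<^esub> n = \<zero>\<^bsub>R\<^esub> \<longrightarrow> x = \<zero>\<^bsub>R\<^esub>)"

text \<open>
  The nonnegative generator of the kernel of the ring homomorphism from the integers to \<open>R\<close>;
  compare the class-based \<^const>\<open>semiring_char\<close>.
\<close>
definition ring_char :: "('a, 'b) ring_scheme \<Rightarrow> nat" where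
  "ring_char R = Gcd {n::nat. [n] \<cdot>\<^bsub>R\<^esub> \<one>\<^bsub>R\<^esub> = \<zero>\<^bsub>R\<^esub>}"

definition krull_dim :: "('a, 'b) ring_scheme \<Rightarrow> enat" where
  "krull_dim R = Sup {enat n | n. \<exists>P :: nat \<Rightarrow> 'a set.
     (\<forall>i\<le>n. primeideal (P i) R) \<and> (\<forall>i<n. P i \<subset> P (Suc i))}"

text \<open>\<open>frob_power R q I\<close> is the ideal $I^{[q]}$; it is used for $q$ a power of the characteristic.\<close>
definition frob_power :: "('a, 'b) ring_scheme \<Rightarrow> nat \<Rightarrow> 'a set \<Rightarrow> 'a set" where
  "frob_power R q I = Idl\<^bsub>R\<^esub> {x [^]\<^bsub>R\<^esub> q | x. x \<in> I}"


section \<open>Modules\<close>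

text \<open>
  A \<^type>\<open>module\<close> record also has the fields \<^const>\<open>monoid.mult\<close> and \<^const>\<open>monoid.one\<close>, which the locale
  \<^locale>\<open>module\<close> does not constrain; the constructions below leave them \<^const>\<open>undefined\<close>
  when there is no natural ring structure.
\<close>

text \<open>The ring \<open>S\<close> viewed as a module along a ring homomorphism \<open>h\<close> into \<open>S\<close>.\<close>
definition module_via :: "('a \<Rightarrow> 's) \<Rightarrow> ('s, 'b) ring_scheme \<Rightarrow> ('a, 's) module" where
  "module_via h S =
    \<lparr>carrier = carrier S, monoid.mult = monoid.mult S, monoid.one = monoid.one S,
     ring.zero = ring.zero S, ring.add = ring.add S,
     smult = (\<lambda>r x. h r \<otimes>\<^bsub>S\<^esub> x)\<rparr>"

definition quot_ring_module :: "('a, 'b) ring_scheme \<Rightarrow> 'a set \<Rightarrow> ('a, 'a set) module" where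
  "quot_ring_module R I = module_via (\<lambda>r. I +>\<^bsub>R\<^esub> r) (R Quot I)"

definition gen_submodule ::
    "('a, 'b) ring_scheme \<Rightarrow> ('a, 'm, 'c) module_scheme \<Rightarrow> 'm set \<Rightarrow> 'm set" where
  "gen_submodule R M A = \<Inter>{H. submodule H R M \<and> A \<subseteq> H}"

definition fin_gen_module :: "('a, 'b) ring_scheme \<Rightarrow> ('a, 'm, 'c) module_scheme \<Rightarrow> bool" where
  "fin_gen_module R M \<longleftrightarrow> (\<exists>A. finite A \<and> A \<subseteq> carrier M \<and> gen_submodule R M A = carrier M)"

definition F_finite :: "('a, 'b) ring_scheme \<Rightarrow> bool" where
  "F_finite R \<longleftrightarrow> fin_gen_module R (module_via (\<lambda>r. r [^]\<^bsub>R\<^esub> ring_char R) R)"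

definition module_length :: "('a, 'b) ring_scheme \<Rightarrow> ('a, 'm, 'c) module_scheme \<Rightarrow> enat" where
  "module_length R M = Sup {enat n | n. \<exists>N :: nat \<Rightarrow> 'm set.
     (\<forall>i\<le>n. submodule (N i) R M) \<and> (\<forall>i<n. N i \<subset> N (Suc i))}"

definition quot_module ::
    "('a, 'm, 'c) module_scheme \<Rightarrow> 'm set \<Rightarrow> ('a, 'm set) module" where
  "quot_module M N =
    \<lparr>carrier = a_rcosets\<^bsub>M\<^esub> N, monoid.mult = undefined, monoid.one = undefined,
     ring.zero = N, ring.add = set_add M,
     smult = (\<lambda>r A. \<Union>x\<in>A. N +>\<^bsub>M\<^esub> (r \<odot>\<^bsub>M\<^esub> x))\<rparr>"


section \<open>Tensor products\<close>

text \<open>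
  The free module on \<open>S\<close> consists of the finitely supported functions from \<open>S\<close> to \<open>R\<close>,
  extended by zero outside \<open>S\<close>.
\<close>
definition free_module :: "('a, 'b) ring_scheme \<Rightarrow> 'i set \<Rightarrow> ('a, 'i \<Rightarrow> 'a) module" where
  "free_module R S =
    \<lparr>carrier = {f. range f \<subseteq> carrier R \<and> finite {i. f i \<noteq> \<zero>\<^bsub>R\<^esub>} \<and> {i. f i \<noteq> \<zero>\<^bsub>R\<^esub>} \<subseteq> S},
     monoid.mult = undefined, monoid.one = undefined,
     ring.zero = (\<lambda>i. \<zero>\<^bsub>R\<^esub>), ring.add = (\<lambda>f g i. f i \<oplus>\<^bsub>R\<^esub> g i),
     smult = (\<lambda>r f i. r \<otimes>\<^bsub>R\<^esub> f i)\<rparr>"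

definition free_basis :: "('a, 'b) ring_scheme \<Rightarrow> 'i \<Rightarrow> 'i \<Rightarrow> 'a" where
  "free_basis R i = (\<lambda>j. if j = i then \<one>\<^bsub>R\<^esub> else \<zero>\<^bsub>R\<^esub>)"

definition tensor_relations ::
    "('a, 'b) ring_scheme \<Rightarrow> ('a, 'm, 'c) module_scheme \<Rightarrow> ('a, 'n, 'd) module_scheme
      \<Rightarrow> ('m \<times> 'n \<Rightarrow> 'a) set" where
  "tensor_relations R M N =
    (let F = free_module R (carrier M \<times> carrier N); \<delta> = (\<lambda>x y. free_basis R (x, y)) in
      {\<delta> (x \<oplus>\<^bsub>M\<^esub> x') y \<ominus>\<^bsub>F\<^esub> (\<delta> x y \<oplus>\<^bsub>F\<^esub> \<delta> x' y) | x x' y.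
         x \<in> carrier M \<and> x' \<in> carrier M \<and> y \<in> carrier N} \<union>
      {\<delta> x (y \<oplus>\<^bsub>N\<^esub> y') \<ominus>\<^bsub>F\<^esub> (\<delta> x y \<oplus>\<^bsub>F\<^esub> \<delta> x y') | x y y'.
         x \<in> carrier M \<and> y \<in> carrier N \<and> y' \<in> carrier N} \<union>
      {\<delta> (r \<odot>\<^bsub>M\<^esub> x) y \<ominus>\<^bsub>F\<^esub> (r \<odot>\<^bsub>F\<^esub> \<delta> x y) | r x y.
         r \<in> carrier R \<and> x \<in> carrier M \<and> y \<in> carrier N} \<union>
      {\<delta> x (r \<odot>\<^bsub>N\<^esub> y) \<ominus>\<^bsub>F\<^esub> (r \<odot>\<^bsub>F\<^esub> \<delta> x y) | r x y.
         r \<in> carrier R \<and> x \<in> carrier M \<and> y \<in> carrier N})"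

definition tensor_product ::
    "('a, 'b) ring_scheme \<Rightarrow> ('a, 'm, 'c) module_scheme \<Rightarrow> ('a, 'n, 'd) module_scheme
      \<Rightarrow> ('a, ('m \<times> 'n \<Rightarrow> 'a) set) module" where
  "tensor_product R M N =
    (let F = free_module R (carrier M \<times> carrier N)
     in quot_module F (gen_submodule R F (tensor_relations R M N)))"

end

theory Submission
  imports Defs
begin

text \<open>
  If two finitely generated modules over a domain $R/P$ have the same rank, each maps to the other with a
  cokernel killed by some $s \notin P$. The colength of $(P + (s)) + I$ with $\mm^{[p^e]} \subseteq I$ is at most a
  constant times $p^{e(d-1)}$, since every prime containing $P + (s)$ is strictly larger than $P$. Applied to
  $F_*(R/P)$ and a free module, this compares $\ell(R/(P + I^{[p]}))$ with $\ell(R/(P + I))$, the factor being the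
  quotient of the ranks of $F_*(R/P)$ over $R/P$ and of $F_*(R/\mm)$ over $R/\mm$. This quotient is $p^{\dim R/P}$:
  along a chain of primes without gaps the rank changes by a factor of $p$ at each step, as is seen from lengths
  over the localization at the larger prime. Primes with $\dim R/P < d$ contribute only to the error. As $R$ is
  reduced, $0$ is a finite intersection of primes, and the lengths for $M$ are up to an error of the same order
  the sums of those for the $M/PM$. Hence $\ell(M/I^{[p]}M)$ is $p^d\,\ell(M/IM)$ up to an error of order
  $p^{e(d-1)}$, and iterating this produces a geometric series of errors.
\<close>

no_notation Sum_Type.Plus (infixr \<open><+>\<close> 65)

section \<open>Length of localized modules\<close>

text \<open>The residue field k need not be perfect, so the rank of F_*(R/P) is p^(dim R/P) only
  after division by the degree of k over k^p, the rank at \<mm>. This is why both ranks are carried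
  along, and why lengths over localizations are needed: the step between neighbouring primes P and Q
  takes place over R_Q, where R/(P + (x^t)) has finite length. Every error term is of one kind: a
  module with a bounded number of generators, killed by P + (s) + I. All bounds have the form length
  * p^e \<le> C * p^(e d), which covers d = 0 without a negative exponent. For s in \<aa> outside P,
  the kernel and the cokernel of the map from M/(\<aa> \<inter> P)M to the direct sum of M/\<aa>M
  and M/PM are killed by P + (s). So the passage to intersections costs only such an error, one
  prime at a time. The iteration converges because I^[p^j] contains \<mm>^[p^(e+j)] when I contains
  \<mm>^[p^e]: the error at stage j is of order p^((e+j)(d-1)), and division by p^((j+1)d) leaves
  p^(e(d-1)) times p^(-j-d).\<close>

locale prime_module = module R M + primeideal Q R for R (structure) and M (structure) and Q

text \<open>
  Localization at \<open>Q\<close> without localized modules: \<open>local_le R M Q A B\<close> says $A_Q \subseteq B_Q$, and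
  \<open>local_length R M Q A B\<close> is the length of $(B/A)_Q$. For the maximal ideal of a local ring these are
  inclusion and the usual length.
\<close>

definition local_le ::
    "('a, 'b) ring_scheme \<Rightarrow> ('a, 'm, 'c) module_scheme \<Rightarrow> 'a set \<Rightarrow> 'm set \<Rightarrow> 'm set \<Rightarrow> bool" where
  "local_le R M Q A B \<longleftrightarrow> (\<forall>x\<in>A. \<exists>s\<in>carrier R - Q. s \<odot>\<^bsub>M\<^esub> x \<in> B)"

text \<open>Every submodule of a localization comes from a submodule of \<open>M\<close>, so chains
  in \<open>M\<close> suffice; a step counts only if its inclusion stays proper after localization.
  The start is any submodule above \<open>A\<close> and the last member is an index, so that both
  ends can be moved.\<close>

inductive local_chain ::
    "('a, 'b) ring_scheme \<Rightarrow> ('a, 'm, 'c) module_scheme \<Rightarrow> 'a set \<Rightarrow> 'm set \<Rightarrow> 'm set \<Rightarrow> nat \<Rightarrow> bool"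
  for R :: "('a, 'b) ring_scheme" and M :: "('a, 'm, 'c) module_scheme" and Q A
where
  base: "submodule N R M \<Longrightarrow> A \<subseteq> N \<Longrightarrow> local_chain R M Q A N 0"
| step: "local_chain R M Q A N n \<Longrightarrow> submodule N' R M \<Longrightarrow> N \<subseteq> N' \<Longrightarrow> \<not> local_le R M Q N' N
    \<Longrightarrow> local_chain R M Q A N' (Suc n)"

definition local_length ::
    "('a, 'b) ring_scheme \<Rightarrow> ('a, 'm, 'c) module_scheme \<Rightarrow> 'a set \<Rightarrow> 'm set \<Rightarrow> 'm set \<Rightarrow> enat" where
  "local_length R M Q A B = Sup {enat n | n. local_chain R M Q A B n}"

definition linear_map ::
    "('a, 'b) ring_scheme \<Rightarrow> ('a, 'm, 'c) module_scheme \<Rightarrow> ('a, 'n, 'd) module_scheme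
      \<Rightarrow> ('m \<Rightarrow> 'n) \<Rightarrow> bool" where
  "linear_map R L N f \<longleftrightarrow> (\<forall>x\<in>carrier L. f x \<in> carrier N)
    \<and> (\<forall>x\<in>carrier L. \<forall>y\<in>carrier L. f (x \<oplus>\<^bsub>L\<^esub> y) = f x \<oplus>\<^bsub>N\<^esub> f y)
    \<and> (\<forall>r\<in>carrier R. \<forall>x\<in>carrier L. f (r \<odot>\<^bsub>L\<^esub> x) = r \<odot>\<^bsub>N\<^esub> f x)"

section \<open>Submodules: sums, intersections and generation\<close>

context module
begin

lemma submodule_mem_carrier: "submodule H R M \<Longrightarrow> x \<in> H \<Longrightarrow> x \<in> carrier M"
  using submoduleE(1) by blast

lemma submodule_zero: "submodule H R M \<Longrightarrow> \<zero>\<^bsub>M\<^esub> \<in> H"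
  using submodule.axioms(1) subgroup.one_closed by fastforce

lemma submodule_minus: "submodule H R M \<Longrightarrow> x \<in> H \<Longrightarrow> y \<in> H \<Longrightarrow> x \<ominus>\<^bsub>M\<^esub> y \<in> H"
  by (simp add: a_minus_def submoduleE(3,5))

lemma submodule_cancel_right:
  assumes "submodule H R M" "x \<oplus>\<^bsub>M\<^esub> y \<in> H" "y \<in> H" "x \<in> carrier M"
  shows "x \<in> H"
proof -
  have "y \<in> carrier M" using assms submodule_mem_carrier by blast
  then have "x = (x \<oplus>\<^bsub>M\<^esub> y) \<ominus>\<^bsub>M\<^esub> y"
    using assms(4) by (simp add: a_minus_def M.a_assoc M.r_neg)
  then show ?thesis using submodule_minus[OF assms(1-3)] by simp
qed

lemma submodule_cancel_left:
  assumes "submodule H R M" "x \<oplus>\<^bsub>M\<^esub> y \<in> H" "x \<in> H" "y \<in> carrier M"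
  shows "y \<in> H"
  using submodule_cancel_right[OF assms(1) _ assms(3,4)] assms(2) M.a_comm[OF submodule_mem_carrier[OF assms(1,3)] assms(4)]
  by simp

lemma submodule_Int:
  assumes "submodule A R M" "submodule B R M" shows "submodule (A \<inter> B) R M"
  by (rule submoduleI)
    (auto simp: assms submodule_zero intro: submoduleE(3-5) assms dest: submodule_mem_carrier[OF assms(1)])

lemma submodule_Inter:
  assumes "\<And>H. H \<in> \<H> \<Longrightarrow> submodule H R M" "\<H> \<noteq> {}" shows "submodule (\<Inter>\<H>) R M"
proof (rule submoduleI)
  show "\<Inter>\<H> \<subseteq> carrier M" using assms submodule_mem_carrier by blast
qed (use assms in \<open>auto simp: submodule_zero intro: submoduleE(3-5)\<close>)

lemma gen_submodule_submodule: "S \<subseteq> carrier M \<Longrightarrow> submodule (gen_submodule R M S) R M"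
  unfolding gen_submodule_def by (rule submodule_Inter) (use carrier_is_submodule in auto)

lemma gen_submodule_superset: "S \<subseteq> gen_submodule R M S"
  unfolding gen_submodule_def by blast

lemma gen_submodule_minimal: "submodule H R M \<Longrightarrow> S \<subseteq> H \<Longrightarrow> gen_submodule R M S \<subseteq> H"
  unfolding gen_submodule_def by blast

lemma set_addI: "a \<in> A \<Longrightarrow> b \<in> B \<Longrightarrow> a \<oplus>\<^bsub>M\<^esub> b \<in> A <+>\<^bsub>M\<^esub> B"
  by (auto simp: set_add_def')

lemma set_addE:
  assumes "x \<in> A <+>\<^bsub>M\<^esub> B" obtains a b where "a \<in> A" "b \<in> B" "x = a \<oplus>\<^bsub>M\<^esub> b"
  using assms by (auto simp: set_add_def')

lemma submodule_set_add:
  assumes "submodule A R M" "submodule B R M" shows "submodule (A <+>\<^bsub>M\<^esub> B) R M"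
proof (rule submoduleI)
  note c = submodule_mem_carrier[OF assms(1)] submodule_mem_carrier[OF assms(2)]
  show "A <+>\<^bsub>M\<^esub> B \<subseteq> carrier M" using c by (auto simp: set_add_def')
  show "\<zero>\<^bsub>M\<^esub> \<in> A <+>\<^bsub>M\<^esub> B"
    using set_addI[OF submodule_zero[OF assms(1)] submodule_zero[OF assms(2)]] by simp
  show "\<ominus>\<^bsub>M\<^esub> x \<in> A <+>\<^bsub>M\<^esub> B" if "x \<in> A <+>\<^bsub>M\<^esub> B" for x
  proof -
    obtain a b where ab: "a \<in> A" "b \<in> B" "x = a \<oplus>\<^bsub>M\<^esub> b" using \<open>x \<in> _\<close> by (rule set_addE)
    then have "\<ominus>\<^bsub>M\<^esub> x = \<ominus>\<^bsub>M\<^esub> a \<oplus>\<^bsub>M\<^esub> \<ominus>\<^bsub>M\<^esub> b" using c by (simp add: M.minus_add)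
    then show ?thesis
      using set_addI[OF submoduleE(3)[OF assms(1) ab(1)] submoduleE(3)[OF assms(2) ab(2)]] by simp
  qed
  show "x \<oplus>\<^bsub>M\<^esub> y \<in> A <+>\<^bsub>M\<^esub> B" if xy: "x \<in> A <+>\<^bsub>M\<^esub> B" "y \<in> A <+>\<^bsub>M\<^esub> B" for x y
  proof -
    obtain a b where ab: "a \<in> A" "b \<in> B" "x = a \<oplus>\<^bsub>M\<^esub> b" using xy(1) by (rule set_addE)
    obtain a' b' where ab': "a' \<in> A" "b' \<in> B" "y = a' \<oplus>\<^bsub>M\<^esub> b'" using xy(2) by (rule set_addE)
    have "x \<oplus>\<^bsub>M\<^esub> y = (a \<oplus>\<^bsub>M\<^esub> a') \<oplus>\<^bsub>M\<^esub> (b \<oplus>\<^bsub>M\<^esub> b')" using ab ab' c by (simp add: M.a_ac)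
    then show ?thesis
      using set_addI[OF submoduleE(5)[OF assms(1) ab(1) ab'(1)] submoduleE(5)[OF assms(2) ab(2) ab'(2)]]
      by simp
  qed
  show "r \<odot>\<^bsub>M\<^esub> x \<in> A <+>\<^bsub>M\<^esub> B" if r: "r \<in> carrier R" "x \<in> A <+>\<^bsub>M\<^esub> B" for r x
  proof -
    obtain a b where ab: "a \<in> A" "b \<in> B" "x = a \<oplus>\<^bsub>M\<^esub> b" using r(2) by (rule set_addE)
    then have "r \<odot>\<^bsub>M\<^esub> x = r \<odot>\<^bsub>M\<^esub> a \<oplus>\<^bsub>M\<^esub> r \<odot>\<^bsub>M\<^esub> b" using c r by (simp add: smult_r_distr)
    then show ?thesis
      using set_addI[OF submoduleE(4)[OF assms(1) r(1) ab(1)] submoduleE(4)[OF assms(2) r(1) ab(2)]]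
      by simp
  qed
qed

lemma set_add_mono: "A \<subseteq> A' \<Longrightarrow> B \<subseteq> B' \<Longrightarrow> A <+>\<^bsub>M\<^esub> B \<subseteq> A' <+>\<^bsub>M\<^esub> B'"
  by (auto simp: set_add_def')

lemma set_add_upper1:
  assumes "submodule A R M" "submodule B R M" shows "A \<subseteq> A <+>\<^bsub>M\<^esub> B"
proof
  fix x assume x: "x \<in> A"
  then have "x = x \<oplus>\<^bsub>M\<^esub> \<zero>\<^bsub>M\<^esub>" using submodule_mem_carrier[OF assms(1)] by simp
  then show "x \<in> A <+>\<^bsub>M\<^esub> B" using x submodule_zero[OF assms(2)] by (force simp: set_add_def')
qed

lemma set_add_upper2:
  assumes "submodule A R M" "submodule B R M" shows "B \<subseteq> A <+>\<^bsub>M\<^esub> B"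
proof
  fix x assume x: "x \<in> B"
  then have "x = \<zero>\<^bsub>M\<^esub> \<oplus>\<^bsub>M\<^esub> x" using submodule_mem_carrier[OF assms(2)] by simp
  then show "x \<in> A <+>\<^bsub>M\<^esub> B" using x submodule_zero[OF assms(1)] by (force simp: set_add_def')
qed

lemma set_add_least:
  assumes "submodule C R M" "A \<subseteq> C" "B \<subseteq> C" shows "A <+>\<^bsub>M\<^esub> B \<subseteq> C"
  using assms submoduleE(5)[OF assms(1)] by (auto simp: set_add_def')

end

section \<open>Chains and additivity of the local length\<close>

lemma local_chain_submodule: "local_chain R M Q A B n \<Longrightarrow> submodule B R M"
  by (induction rule: local_chain.induct) auto

lemma local_chain_subset: "local_chain R M Q A B n \<Longrightarrow> A \<subseteq> B"
  by (induction rule: local_chain.induct) auto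

context prime_module
begin

lemma complement_mult: "s \<in> carrier R - Q \<Longrightarrow> t \<in> carrier R - Q \<Longrightarrow> s \<otimes> t \<in> carrier R - Q"
  using I_prime by blast

lemma complement_one: "\<one> \<in> carrier R - Q"
  using I_notcarr one_imp_carrier by blast

lemma local_le_subset: "A \<subseteq> B \<Longrightarrow> B \<subseteq> carrier M \<Longrightarrow> local_le R M Q A B"
  unfolding local_le_def using complement_one smult_one by (intro ballI bexI[of _ "\<one>"]) (simp_all add: subset_iff)

lemma local_le_mono: "local_le R M Q A B \<Longrightarrow> A' \<subseteq> A \<Longrightarrow> B \<subseteq> B' \<Longrightarrow> local_le R M Q A' B'"
  unfolding local_le_def by blast

lemma local_chain_mono:
  "local_chain R M Q A B n \<Longrightarrow> submodule C R M \<Longrightarrow> B \<subseteq> C \<Longrightarrow> local_chain R M Q A C n"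
proof (induction arbitrary: C rule: local_chain.induct)
  case (step N n N')
  then have "\<not> local_le R M Q C N" using local_le_mono by blast
  then show ?case using step by (intro local_chain.step[of R M Q A N]) auto
qed (auto intro: local_chain.base)

lemma local_chain_less: "local_chain R M Q A B n \<Longrightarrow> m \<le> n \<Longrightarrow> local_chain R M Q A B m"
proof (induction arbitrary: m rule: local_chain.induct)
  case (step N n N')
  show ?case
  proof (cases "m = Suc n")
    case False
    then have "local_chain R M Q A N m" using step by simp
    then show ?thesis using step local_chain_mono by blast
  qed (use step local_chain.step in blast)
qed (auto intro: local_chain.base)

lemma local_chain_antimono:
  "local_chain R M Q A B n \<Longrightarrow> A' \<subseteq> A \<Longrightarrow> local_chain R M Q A' B n"
proof (induction rule: local_chain.induct)
  case (base N) then show ?case by (intro local_chain.base) auto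
next
  case (step N n N') then show ?case by (intro local_chain.step[of R M Q A' N]) auto
qed

lemma local_chain_append:
  "local_chain R M Q B C m \<Longrightarrow> local_chain R M Q A B n \<Longrightarrow> local_chain R M Q A C (m + n)"
proof (induction rule: local_chain.induct)
  case (base N) then show ?case using local_chain_mono by simp
next
  case (step N n N') then show ?case by (auto intro: local_chain.step)
qed

text \<open>Chains can be shortened, hence a lower bound on the supremum is witnessed by a single
  chain of exactly that length. All comparisons of lengths, infinite ones included, become transfers
  of chains.\<close>

lemma local_length_ge_iff:
  assumes "submodule B R M" "A \<subseteq> B"
  shows "enat n \<le> local_length R M Q A B \<longleftrightarrow> local_chain R M Q A B n"
proof
  assume "local_chain R M Q A B n"
  then show "enat n \<le> local_length R M Q A B" unfolding local_length_def by (auto intro: Sup_upper)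
next
  assume a: "enat n \<le> local_length R M Q A B"
  show "local_chain R M Q A B n"
  proof (rule ccontr)
    assume c: "\<not> local_chain R M Q A B n"
    then have "n > 0" using local_chain.base[OF assms] by (cases n) auto
    have "m \<le> n - 1" if "local_chain R M Q A B m" for m
      using local_chain_less[OF that, of n] c by (cases "n \<le> m") auto
    then have "local_length R M Q A B \<le> enat (n - 1)"
      unfolding local_length_def by (intro Sup_least) auto
    then have "enat n \<le> enat (n - 1)" using a order_trans by blast
    then show False using \<open>n > 0\<close> by simp
  qed
qed

end

text \<open>Testing against finite values only avoids treating infinity separately in each
  comparison of lengths.\<close>

lemma enat_leI:
  assumes "\<And>n. enat n \<le> x \<Longrightarrow> enat n \<le> y" shows "x \<le> y"
proof (cases x)
  case (enat k)
  then show ?thesis using assms[of k] by simp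
next
  case infinity
  then have "enat (Suc (the_enat y)) \<le> y" using assms by simp
  then have "y = \<infinity>" by (cases y) auto
  then show ?thesis by simp
qed

context prime_module
begin

lemma local_length_mono:
  assumes "submodule B R M" "submodule B' R M" "A \<subseteq> A'" "A' \<subseteq> B'" "B' \<subseteq> B"
  shows "local_length R M Q A' B' \<le> local_length R M Q A B"
proof (rule enat_leI)
  fix n assume "enat n \<le> local_length R M Q A' B'"
  then have "local_chain R M Q A B n"
    using assms local_length_ge_iff local_chain_mono local_chain_antimono by metis
  moreover have "A \<subseteq> B" using assms by blast
  ultimately show "enat n \<le> local_length R M Q A B" using local_length_ge_iff[OF assms(1)] by simp
qed

lemma local_length_eq_0:
  assumes "submodule A R M" "submodule B R M" "A \<subseteq> B" "local_le R M Q B A"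
  shows "local_length R M Q A B = 0"
proof -
  have "\<not> local_chain R M Q A B (Suc 0)"
  proof
    assume "local_chain R M Q A B (Suc 0)"
    then obtain N where N: "local_chain R M Q A N 0" "\<not> local_le R M Q B N"
      by (cases rule: local_chain.cases) auto
    show False using N(2) local_le_mono[OF assms(4) subset_refl local_chain_subset[OF N(1)]] by simp
  qed
  then have "\<not> enat (Suc 0) \<le> local_length R M Q A B" using local_length_ge_iff[OF assms(2,3)] by blast
  then show ?thesis by (cases "local_length R M Q A B") (auto simp: zero_enat_def)
qed

lemma local_length_ge_1:
  assumes "submodule A R M" "submodule B R M" "A \<subseteq> B" "\<not> local_le R M Q B A"
  shows "1 \<le> local_length R M Q A B"
  using local_chain.step[OF local_chain.base[OF assms(1)] assms(2,3,4), of A]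
    local_length_ge_iff[OF assms(2,3), of "Suc 0"] by (simp add: one_enat_def)

text \<open>The modular law after localization. One multiplier \<open>s\<close> moves x into N + B,
  a second one \<open>t\<close> moves the B-component into N, and their product lies outside
  \<open>Q\<close> because \<open>Q\<close> is prime.\<close>

lemma local_le_Int_set_add:
  assumes "submodule N R M" "submodule N' R M" "submodule B R M" "N \<subseteq> N'"
    and "local_le R M Q (N' \<inter> B) (N \<inter> B)" "local_le R M Q (N' <+>\<^bsub>M\<^esub> B) (N <+>\<^bsub>M\<^esub> B)"
  shows "local_le R M Q N' N"
  unfolding local_le_def
proof
  fix x assume x: "x \<in> N'"
  have xc: "x \<in> carrier M" using x assms submodule_mem_carrier by blast
  have "x \<in> N' <+>\<^bsub>M\<^esub> B" using x set_add_upper1[OF assms(2,3)] by blast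
  then obtain s where s: "s \<in> carrier R - Q" "s \<odot>\<^bsub>M\<^esub> x \<in> N <+>\<^bsub>M\<^esub> B"
    using assms(6) unfolding local_le_def by blast
  then obtain n b where nb: "n \<in> N" "b \<in> B" "s \<odot>\<^bsub>M\<^esub> x = n \<oplus>\<^bsub>M\<^esub> b" by (blast elim: set_addE)
  have nbc: "n \<in> carrier M" "b \<in> carrier M" using nb assms submodule_mem_carrier by blast+
  have "s \<odot>\<^bsub>M\<^esub> x \<in> N'" using submoduleE(4)[OF assms(2)] s x by blast
  then have "b \<in> N'" using submodule_cancel_left[OF assms(2), of n b] nb nbc assms(4) by auto
  then obtain t where t: "t \<in> carrier R - Q" "t \<odot>\<^bsub>M\<^esub> b \<in> N"
    using assms(5) nb unfolding local_le_def by blast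
  have "(t \<otimes> s) \<odot>\<^bsub>M\<^esub> x = t \<odot>\<^bsub>M\<^esub> n \<oplus>\<^bsub>M\<^esub> t \<odot>\<^bsub>M\<^esub> b"
    using s t xc nb nbc by (simp add: smult_assoc1 smult_r_distr)
  also have "\<dots> \<in> N" using submoduleE(4,5)[OF assms(1)] t nb by blast
  finally show "\<exists>s\<in>carrier R - Q. s \<odot>\<^bsub>M\<^esub> x \<in> N" using complement_mult[OF t(1) s(1)] by blast
qed

text \<open>By the modular law each strict step remains strict after intersecting with
  \<open>B\<close> or after adding \<open>B\<close>, so it is counted in at least one of the two new
  chains.\<close>

lemma local_chain_split:
  "local_chain R M Q A N n \<Longrightarrow> submodule B R M \<Longrightarrow> A \<subseteq> B \<Longrightarrow>
    \<exists>n1 n2. n \<le> n1 + n2 \<and> local_chain R M Q A (N \<inter> B) n1 \<and> local_chain R M Q B (N <+>\<^bsub>M\<^esub> B) n2"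
proof (induction rule: local_chain.induct)
  case (base N)
  then have "local_chain R M Q A (N \<inter> B) 0" "local_chain R M Q B (N <+>\<^bsub>M\<^esub> B) 0"
    using local_chain.base[OF submodule_Int, of N B A] local_chain.base[OF submodule_set_add, of N B B]
      set_add_upper2[of N B] by blast+
  then show ?case by blast
next
  case (step N n N')
  then obtain n1 n2 where n: "n \<le> n1 + n2" "local_chain R M Q A (N \<inter> B) n1"
    "local_chain R M Q B (N <+>\<^bsub>M\<^esub> B) n2" by blast
  have N: "submodule N R M" using step local_chain_submodule by blast
  have s: "submodule (N' \<inter> B) R M" "submodule (N' <+>\<^bsub>M\<^esub> B) R M"
    using step submodule_Int submodule_set_add by blast+
  have i: "N \<inter> B \<subseteq> N' \<inter> B" "N <+>\<^bsub>M\<^esub> B \<subseteq> N' <+>\<^bsub>M\<^esub> B" using step set_add_mono by auto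
  have m: "local_chain R M Q A (N' \<inter> B) n1" "local_chain R M Q B (N' <+>\<^bsub>M\<^esub> B) n2"
    using local_chain_mono n s i by blast+
  consider "\<not> local_le R M Q (N' \<inter> B) (N \<inter> B)" | "\<not> local_le R M Q (N' <+>\<^bsub>M\<^esub> B) (N <+>\<^bsub>M\<^esub> B)"
    using local_le_Int_set_add[OF N step.hyps(2) step.prems(1) step.hyps(3)] step.hyps(4) by blast
  then show ?case
  proof cases
    case 1
    then have "local_chain R M Q A (N' \<inter> B) (Suc n1)" using n s i local_chain.step by blast
    then show ?thesis using m n(1) by (metis Suc_le_mono add_Suc)
  next
    case 2
    then have "local_chain R M Q B (N' <+>\<^bsub>M\<^esub> B) (Suc n2)" using n s i local_chain.step by blast
    then show ?thesis using m n(1) by (metis Suc_le_mono add_Suc_right)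
  qed
qed

lemma local_length_additive:
  assumes "submodule B R M" "submodule C R M" "A \<subseteq> B" "B \<subseteq> C"
  shows "local_length R M Q A C = local_length R M Q A B + local_length R M Q B C"
proof (rule order_antisym; rule enat_leI)
  fix n assume "enat n \<le> local_length R M Q A C"
  then have "local_chain R M Q A C n" using local_length_ge_iff[OF assms(2)] assms by auto
  from local_chain_split[OF this assms(1,3)] obtain n1 n2 where n: "n \<le> n1 + n2"
    "local_chain R M Q A (C \<inter> B) n1" "local_chain R M Q B (C <+>\<^bsub>M\<^esub> B) n2" by blast
  have "C \<inter> B = B" using assms by blast
  moreover have "C <+>\<^bsub>M\<^esub> B \<subseteq> C" using set_add_least[OF assms(2)] assms by blast
  ultimately have "enat n1 \<le> local_length R M Q A B" "enat n2 \<le> local_length R M Q B C"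
    using n assms local_length_ge_iff local_chain_mono by auto
  then have "enat n1 + enat n2 \<le> local_length R M Q A B + local_length R M Q B C" by (rule add_mono)
  then show "enat n \<le> local_length R M Q A B + local_length R M Q B C"
    using n(1) by (metis enat_ord_simps(1) order_trans plus_enat_simps(1))
next
  fix n assume n: "enat n \<le> local_length R M Q A B + local_length R M Q B C"
  \<comment> \<open>If a summand is infinite, it alone supplies all n steps and the other
    contributes 0.\<close>
  have "\<exists>n1 n2. n \<le> n1 + n2 \<and> enat n1 \<le> local_length R M Q A B \<and> enat n2 \<le> local_length R M Q B C"
  proof (cases "local_length R M Q A B")
    case (enat a)
    show ?thesis
    proof (cases "local_length R M Q B C")
      case (enat b)
      then show ?thesis using n \<open>local_length R M Q A B = enat a\<close>
        by (intro exI[of _ a] exI[of _ b]) auto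
    qed (intro exI[of _ 0] exI[of _ n], simp flip: zero_enat_def)
  qed (intro exI[of _ n] exI[of _ 0], simp flip: zero_enat_def)
  then obtain n1 n2 where "n \<le> n1 + n2" "enat n1 \<le> local_length R M Q A B"
    "enat n2 \<le> local_length R M Q B C" by blast
  then have "n \<le> n1 + n2" "local_chain R M Q A B n1" "local_chain R M Q B C n2"
    using local_length_ge_iff assms by blast+
  then have "local_chain R M Q A C n"
    using local_chain_less[OF local_chain_append] by (metis add.commute)
  then show "enat n \<le> local_length R M Q A C" using local_length_ge_iff[OF assms(2)] assms by auto
qed

end

section \<open>Linear maps and their effect on length\<close>

lemma linear_mapD:
  assumes "linear_map R L N f"
  shows "x \<in> carrier L \<Longrightarrow> f x \<in> carrier N"
    and "x \<in> carrier L \<Longrightarrow> y \<in> carrier L \<Longrightarrow> f (x \<oplus>\<^bsub>L\<^esub> y) = f x \<oplus>\<^bsub>N\<^esub> f y"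
    and "r \<in> carrier R \<Longrightarrow> x \<in> carrier L \<Longrightarrow> f (r \<odot>\<^bsub>L\<^esub> x) = r \<odot>\<^bsub>N\<^esub> f x"
  using assms unfolding linear_map_def by blast+

locale linear_map_pair = L: module R L + N: module R N
  for R (structure) and L (structure) and N (structure) and f +
  assumes linear: "linear_map R L N f"
begin

lemmas map_closed = linear_mapD(1)[OF linear]
  and map_add = linear_mapD(2)[OF linear]
  and map_smult = linear_mapD(3)[OF linear]

lemma map_zero: "f \<zero>\<^bsub>L\<^esub> = \<zero>\<^bsub>N\<^esub>"
  using map_smult[of \<zero> "\<zero>\<^bsub>L\<^esub>"] map_closed by simp

lemma map_minus: "x \<in> carrier L \<Longrightarrow> f (\<ominus>\<^bsub>L\<^esub> x) = \<ominus>\<^bsub>N\<^esub> f x"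
  using map_smult[of "\<ominus> \<one>" x] map_closed
  by (simp add: L.smult_l_minus N.smult_l_minus)

lemma submodule_vimage:
  assumes "submodule B R L" "submodule C R N" shows "submodule {x \<in> B. f x \<in> C} R L"
proof (rule L.submoduleI)
  note c = L.submodule_mem_carrier[OF assms(1)]
  show "{x \<in> B. f x \<in> C} \<subseteq> carrier L" using c by blast
  show "\<zero>\<^bsub>L\<^esub> \<in> {x \<in> B. f x \<in> C}"
    using L.submodule_zero[OF assms(1)] N.submodule_zero[OF assms(2)] map_zero by simp
  show "\<ominus>\<^bsub>L\<^esub> x \<in> {x \<in> B. f x \<in> C}" if "x \<in> {x \<in> B. f x \<in> C}" for x
    using that L.submoduleE(3)[OF assms(1)] N.submoduleE(3)[OF assms(2)] map_minus c by simp
  show "x \<oplus>\<^bsub>L\<^esub> y \<in> {x \<in> B. f x \<in> C}" if "x \<in> {x \<in> B. f x \<in> C}" "y \<in> {x \<in> B. f x \<in> C}" for x y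
    using that L.submoduleE(5)[OF assms(1)] N.submoduleE(5)[OF assms(2)] map_add c by simp
  show "r \<odot>\<^bsub>L\<^esub> x \<in> {x \<in> B. f x \<in> C}" if "r \<in> carrier R" "x \<in> {x \<in> B. f x \<in> C}" for r x
    using that L.submoduleE(4)[OF assms(1)] N.submoduleE(4)[OF assms(2)] map_smult c by simp
qed

lemma submodule_image:
  assumes "submodule B R L" shows "submodule (f ` B) R N"
proof (rule N.submoduleI)
  note c = L.submodule_mem_carrier[OF assms(1)]
  show "f ` B \<subseteq> carrier N" using c map_closed by blast
  show "\<zero>\<^bsub>N\<^esub> \<in> f ` B"
    using imageI[OF L.submodule_zero[OF assms(1)], of f] map_zero by simp
  show "\<ominus>\<^bsub>N\<^esub> y \<in> f ` B" if y: "y \<in> f ` B" for y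
  proof -
    obtain x where x: "x \<in> B" "y = f x" using y by blast
    then show ?thesis using imageI[OF L.submoduleE(3)[OF assms x(1)], of f] map_minus[OF c[OF x(1)]] by simp
  qed
  show "y \<oplus>\<^bsub>N\<^esub> z \<in> f ` B" if yz: "y \<in> f ` B" "z \<in> f ` B" for y z
  proof -
    obtain x w where x: "x \<in> B" "y = f x" "w \<in> B" "z = f w" using yz by blast
    then show ?thesis
      using imageI[OF L.submoduleE(5)[OF assms x(1,3)], of f] map_add[OF c[OF x(1)] c[OF x(3)]] by simp
  qed
  show "r \<odot>\<^bsub>N\<^esub> y \<in> f ` B" if r: "r \<in> carrier R" and y: "y \<in> f ` B" for r y
  proof -
    obtain x where x: "x \<in> B" "y = f x" using y by blast
    then show ?thesis using imageI[OF L.submoduleE(4)[OF assms r x(1)], of f] map_smult[OF r c[OF x(1)]] by simp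
  qed
qed

context
  fixes Q assumes Q: "primeideal Q R"
begin

interpretation LQ: prime_module R L Q
  using L.module_axioms Q by (simp add: prime_module_def)

interpretation NQ: prime_module R N Q
  using N.module_axioms Q by (simp add: prime_module_def)

text \<open>Chains pull back: K goes to the part of B that f sends into K. Strictness survives since
  every element of B' has, up to a multiplier, the form f(b) + a with a in A', and A' lies in all
  members of the chain.\<close>

lemma local_length_le_of_surj:
  assumes "submodule B R L" "submodule A' R N" "submodule B' R N" "A \<subseteq> B" "A' \<subseteq> B'"
    and "f ` A \<subseteq> A'" and surj: "local_le R N Q B' (f ` B <+>\<^bsub>N\<^esub> A')"
  shows "local_length R N Q A' B' \<le> local_length R L Q A B"
proof -
  note c = L.submodule_mem_carrier[OF assms(1)]
  have *: "K \<subseteq> B' \<Longrightarrow> local_chain R L Q A {x \<in> B. f x \<in> K} n" if "local_chain R N Q A' K n" for K n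
    using that
  proof (induction rule: local_chain.induct)
    case (base K)
    then show ?case using assms by (intro local_chain.base submodule_vimage) auto
  next
    case (step K n K')
    have "\<not> local_le R L Q {x \<in> B. f x \<in> K'} {x \<in> B. f x \<in> K}"
    proof
      assume le: "local_le R L Q {x \<in> B. f x \<in> K'} {x \<in> B. f x \<in> K}"
      have sN: "submodule K R N" "A' \<subseteq> K" using step local_chain_submodule local_chain_subset by blast+
      have "local_le R N Q K' K" unfolding local_le_def
      proof
        fix y assume y: "y \<in> K'"
        then have yc: "y \<in> carrier N" using N.submodule_mem_carrier[OF step.hyps(2)] by blast
        obtain s where s: "s \<in> carrier R - Q" "s \<odot>\<^bsub>N\<^esub> y \<in> f ` B <+>\<^bsub>N\<^esub> A'"
          using surj y step.prems unfolding local_le_def by blast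
        then obtain b a where ba: "b \<in> B" "a \<in> A'" "s \<odot>\<^bsub>N\<^esub> y = f b \<oplus>\<^bsub>N\<^esub> a"
          by (blast elim: N.set_addE)
        have "s \<odot>\<^bsub>N\<^esub> y \<in> K'" using N.submoduleE(4)[OF step.hyps(2)] y s by blast
        moreover have aN: "a \<in> K'" using ba sN step.hyps(3) by blast
        ultimately have "f b \<in> K'"
          using N.submodule_cancel_right[OF step.hyps(2), of "f b" a] ba c map_closed by simp
        then obtain t where t: "t \<in> carrier R - Q" "t \<odot>\<^bsub>L\<^esub> b \<in> {x \<in> B. f x \<in> K}"
          using le ba unfolding local_le_def by blast
        then have "t \<odot>\<^bsub>N\<^esub> f b \<in> K" using map_smult c ba by auto
        moreover have "t \<odot>\<^bsub>N\<^esub> a \<in> K" using N.submoduleE(4)[OF sN(1)] t ba sN by blast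
        moreover have "(t \<otimes> s) \<odot>\<^bsub>N\<^esub> y = t \<odot>\<^bsub>N\<^esub> f b \<oplus>\<^bsub>N\<^esub> t \<odot>\<^bsub>N\<^esub> a"
          using s t yc ba c map_closed N.submodule_mem_carrier[OF assms(2)]
          by (simp add: N.smult_assoc1 N.smult_r_distr)
        ultimately have "(t \<otimes> s) \<odot>\<^bsub>N\<^esub> y \<in> K" using N.submoduleE(5)[OF sN(1)] by simp
        then show "\<exists>s\<in>carrier R - Q. s \<odot>\<^bsub>N\<^esub> y \<in> K" using LQ.complement_mult[OF t(1) s(1)] by blast
      qed
      then show False using step by blast
    qed
    then show ?case using step assms(1)
      by (intro local_chain.step[of _ _ _ _ "{x \<in> B. f x \<in> K}"] submodule_vimage) auto
  qed
  show ?thesis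
  proof (rule enat_leI)
    fix n assume "enat n \<le> local_length R N Q A' B'"
    then have "local_chain R N Q A' B' n" using NQ.local_length_ge_iff assms by blast
    from *[OF this] have "local_chain R L Q A B n"
      using LQ.local_chain_mono[of A "{x \<in> B. f x \<in> B'}" n B] assms by blast
    then show "enat n \<le> local_length R L Q A B" using LQ.local_length_ge_iff assms by blast
  qed
qed

text \<open>Chains push forward: K goes to f(K) + A'. Strictness survives since the elements of B
  that f sends into A' lie in A up to a multiplier.\<close>

lemma local_length_le_of_inj:
  assumes "submodule B R L" "submodule A' R N" "submodule B' R N" "A \<subseteq> B" "A' \<subseteq> B'"
    and "f ` B \<subseteq> B'" and inj: "local_le R L Q {x \<in> B. f x \<in> A'} A"
  shows "local_length R L Q A B \<le> local_length R N Q A' B'"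
proof -
  note c = L.submodule_mem_carrier[OF assms(1)]
  have *: "K \<subseteq> B \<Longrightarrow> local_chain R N Q A' (f ` K <+>\<^bsub>N\<^esub> A') n" if "local_chain R L Q A K n" for K n
    using that
  proof (induction rule: local_chain.induct)
    case (base K)
    then show ?case using assms
      by (intro local_chain.base N.submodule_set_add submodule_image N.set_add_upper2) auto
  next
    case (step K n K')
    have sN: "submodule K R L" "A \<subseteq> K" using step local_chain_submodule local_chain_subset by blast+
    have "\<not> local_le R N Q (f ` K' <+>\<^bsub>N\<^esub> A') (f ` K <+>\<^bsub>N\<^esub> A')"
    proof
      assume le: "local_le R N Q (f ` K' <+>\<^bsub>N\<^esub> A') (f ` K <+>\<^bsub>N\<^esub> A')"
      have "local_le R L Q K' K" unfolding local_le_def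
      proof
        fix x assume x: "x \<in> K'"
        then have xB: "x \<in> B" "x \<in> carrier L" using step.prems c by blast+
        have "f x \<in> f ` K' <+>\<^bsub>N\<^esub> A'"
          using N.set_add_upper1[OF submodule_image[OF step.hyps(2)] assms(2)] x by blast
        then obtain s where s: "s \<in> carrier R - Q" "s \<odot>\<^bsub>N\<^esub> f x \<in> f ` K <+>\<^bsub>N\<^esub> A'"
          using le unfolding local_le_def by blast
        then obtain n a where na: "n \<in> K" "a \<in> A'" "s \<odot>\<^bsub>N\<^esub> f x = f n \<oplus>\<^bsub>N\<^esub> a"
          by (blast elim: N.set_addE)
        have nc: "n \<in> B" "n \<in> carrier L" "a \<in> carrier N"
          using na step.hyps(3) step.prems c N.submodule_mem_carrier[OF assms(2)] by blast+
        \<comment> \<open>The difference of s x and n is sent into A', so a multiplier t brings it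
          into A, hence into K.\<close>
        have d: "s \<odot>\<^bsub>L\<^esub> x \<ominus>\<^bsub>L\<^esub> n \<in> B"
          using L.submodule_minus[OF assms(1)] L.submoduleE(4)[OF assms(1)] xB s nc by blast
        have "f (s \<odot>\<^bsub>L\<^esub> x \<ominus>\<^bsub>L\<^esub> n) = s \<odot>\<^bsub>N\<^esub> f x \<ominus>\<^bsub>N\<^esub> f n"
          using xB s nc by (simp add: a_minus_def map_add map_minus map_smult)
        also have "\<dots> = a" using na(3) nc map_closed[OF nc(2)]
          by (simp add: a_minus_def N.M.a_comm[of "f n" a] N.M.a_assoc N.M.r_neg)
        finally have "s \<odot>\<^bsub>L\<^esub> x \<ominus>\<^bsub>L\<^esub> n \<in> {x \<in> B. f x \<in> A'}" using na d by simp
        then obtain t where t: "t \<in> carrier R - Q" "t \<odot>\<^bsub>L\<^esub> (s \<odot>\<^bsub>L\<^esub> x \<ominus>\<^bsub>L\<^esub> n) \<in> A"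
          using inj unfolding local_le_def by blast
        have "t \<odot>\<^bsub>L\<^esub> (s \<odot>\<^bsub>L\<^esub> x \<ominus>\<^bsub>L\<^esub> n) \<oplus>\<^bsub>L\<^esub> t \<odot>\<^bsub>L\<^esub> n = t \<odot>\<^bsub>L\<^esub> (s \<odot>\<^bsub>L\<^esub> x \<ominus>\<^bsub>L\<^esub> n \<oplus>\<^bsub>L\<^esub> n)"
          using t s xB nc by (simp add: L.smult_r_distr)
        also have "s \<odot>\<^bsub>L\<^esub> x \<ominus>\<^bsub>L\<^esub> n \<oplus>\<^bsub>L\<^esub> n = s \<odot>\<^bsub>L\<^esub> x"
          using s xB nc by (simp add: a_minus_def L.M.a_assoc L.M.l_neg)
        also have "t \<odot>\<^bsub>L\<^esub> (s \<odot>\<^bsub>L\<^esub> x) = (t \<otimes> s) \<odot>\<^bsub>L\<^esub> x" using s t xB by (simp add: L.smult_assoc1)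
        finally have "(t \<otimes> s) \<odot>\<^bsub>L\<^esub> x \<in> K"
          using L.submoduleE(5)[OF sN(1), of "t \<odot>\<^bsub>L\<^esub> (s \<odot>\<^bsub>L\<^esub> x \<ominus>\<^bsub>L\<^esub> n)" "t \<odot>\<^bsub>L\<^esub> n"]
            L.submoduleE(4)[OF sN(1), of t n] t na sN(2) by auto
        then show "\<exists>s\<in>carrier R - Q. s \<odot>\<^bsub>L\<^esub> x \<in> K" using LQ.complement_mult[OF t(1) s(1)] by blast
      qed
      then show False using step by blast
    qed
    then show ?case using step assms(2) N.set_add_mono[OF image_mono[OF step.hyps(3)], of A' A']
      by (intro local_chain.step[of _ _ _ _ "f ` K <+>\<^bsub>N\<^esub> A'"] N.submodule_set_add submodule_image) auto
  qed
  show ?thesis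
  proof (rule enat_leI)
    fix n assume "enat n \<le> local_length R L Q A B"
    then have "local_chain R L Q A B n" using LQ.local_length_ge_iff assms by blast
    from *[OF this] have "local_chain R N Q A' (f ` B <+>\<^bsub>N\<^esub> A') n" by simp
    then have "local_chain R N Q A' B' n"
      by (rule NQ.local_chain_mono) (use assms N.set_add_least in auto)
    then show "enat n \<le> local_length R N Q A' B'" using NQ.local_length_ge_iff assms by blast
  qed
qed

end
end

section \<open>Rings as modules along a homomorphism\<close>

abbreviation regular_module :: "('a, 'b) ring_scheme \<Rightarrow> ('a, 'a) module" where
  "regular_module R \<equiv> module_via (\<lambda>r. r) R"

lemma module_via_simps [simp]:
  "carrier (module_via h S) = carrier S"
  "\<zero>\<^bsub>module_via h S\<^esub> = \<zero>\<^bsub>S\<^esub>"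
  "x \<oplus>\<^bsub>module_via h S\<^esub> y = x \<oplus>\<^bsub>S\<^esub> y"
  "r \<odot>\<^bsub>module_via h S\<^esub> x = h r \<otimes>\<^bsub>S\<^esub> x"
  by (simp_all add: module_via_def)

lemma a_inv_module_via [simp]: "\<ominus>\<^bsub>module_via h S\<^esub> x = \<ominus>\<^bsub>S\<^esub> x"
  by (simp add: a_inv_def m_inv_def)

lemma subgroup_module_via: "subgroup I (add_monoid (module_via h S)) = subgroup I (add_monoid S)"
  by (simp add: subgroup_def m_inv_def)

lemma set_add_module_via [simp]: "A <+>\<^bsub>module_via h S\<^esub> B = A <+>\<^bsub>S\<^esub> B"
  by (simp add: set_add_def')

lemma module_module_via:
  assumes "cring R" "cring S" "h \<in> ring_hom R S"
  shows "module R (module_via h S)"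
proof -
  interpret R: cring R by fact
  interpret S: cring S by fact
  show ?thesis
  proof (rule moduleI)
    show "abelian_group (module_via h S)"
      by (rule abelian_groupI) (auto simp: S.a_ac intro: S.l_neg)
  qed (use assms in \<open>auto simp: ring_hom_closed ring_hom_add ring_hom_mult ring_hom_one
      S.l_distr S.r_distr S.m_assoc\<close>)
qed

lemma module_regular: "cring R \<Longrightarrow> module R (regular_module R)"
  by (rule module_module_via) (auto simp: ring_hom_def)

context ideal
begin

lemma submodule_via:
  assumes "h \<in> carrier R \<rightarrow> carrier R" shows "submodule I R (module_via h R)"
  unfolding submodule_def submodule_axioms_def subgroup_module_via
  using assms I_l_closed additive_subgroup.a_subgroup[OF additive_subgroup_axioms] by auto

lemma submodule_regular: "submodule I R (regular_module R)"
  by (rule submodule_via) auto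

end

text \<open>Preimages and sums of ideals are formed with the submodule lemmas and then turned back
  into ideals by this.\<close>

lemma (in cring) ideal_of_submodule_regular:
  assumes "submodule I R (regular_module R)" shows "ideal I R"
proof (rule idealI)
  show "ring R" by (rule ring_axioms)
  show "subgroup I (add_monoid R)" using submodule.axioms(1)[OF assms] unfolding subgroup_module_via .
  interpret V: module R "regular_module R" using module_regular cring_axioms by blast
  show l: "x \<otimes> a \<in> I" if "a \<in> I" "x \<in> carrier R" for a x
    using V.submoduleE(4)[OF assms that(2,1)] by simp
  show "a \<otimes> x \<in> I" if "a \<in> I" "x \<in> carrier R" for a x
    using l[OF that] V.submodule_mem_carrier[OF assms that(1)] that m_comm by simp
qed

section \<open>Spans, independence and comparison with free modules\<close>

primrec lin_span ::
    "('a, 'b) ring_scheme \<Rightarrow> ('a, 'm, 'c) module_scheme \<Rightarrow> 'a set \<Rightarrow> 'm set \<Rightarrow> 'm list \<Rightarrow> 'm set" where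
  "lin_span R M J A [] = A"
| "lin_span R M J A (g # gs) = (\<lambda>r. r \<odot>\<^bsub>M\<^esub> g) ` J <+>\<^bsub>M\<^esub> lin_span R M J A gs"

text \<open>Independence over $R/P$ modulo \<open>A\<close>, in triangular form: the coefficient of the head lies in \<open>P\<close>.\<close>

primrec indep ::
    "('a, 'b) ring_scheme \<Rightarrow> ('a, 'm, 'c) module_scheme \<Rightarrow> 'a set \<Rightarrow> 'm set \<Rightarrow> 'm list \<Rightarrow> bool" where
  "indep R M P A [] \<longleftrightarrow> True"
| "indep R M P A (g # gs) \<longleftrightarrow> indep R M P A gs
    \<and> (\<forall>r\<in>carrier R. r \<odot>\<^bsub>M\<^esub> g \<in> lin_span R M (carrier R) A gs \<longrightarrow> r \<in> P)"

definition generates ::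
    "('a, 'b) ring_scheme \<Rightarrow> ('a, 'm, 'c) module_scheme \<Rightarrow> 'm list \<Rightarrow> bool" where
  "generates R M gs \<longleftrightarrow> set gs \<subseteq> carrier M
    \<and> (\<forall>H. submodule H R M \<longrightarrow> set gs \<subseteq> H \<longrightarrow> H = carrier M)"

lemma generatesD:
  assumes "generates R M gs"
  shows "set gs \<subseteq> carrier M" "\<And>H. submodule H R M \<Longrightarrow> set gs \<subseteq> H \<Longrightarrow> H = carrier M"
  using assms by (auto simp: generates_def)

context module
begin

lemma fin_gen_generates:
  assumes "fin_gen_module R M" obtains gs where "generates R M gs"
proof -
  obtain A where A: "finite A" "A \<subseteq> carrier M" "gen_submodule R M A = carrier M"
    using assms unfolding fin_gen_module_def by blast
  obtain gs where gs: "set gs = A" using A(1) finite_list by blast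
  have "H = carrier M" if "submodule H R M" "set gs \<subseteq> H" for H
    using gen_submodule_minimal[OF that(1)] that gs A submoduleE(1)[OF that(1)] by blast
  then show ?thesis using that gs A by (auto simp: generates_def)
qed

lemma linear_map_smult_elem: "m \<in> carrier M \<Longrightarrow> linear_map R (regular_module R) M (\<lambda>r. r \<odot>\<^bsub>M\<^esub> m)"
  by (auto simp: linear_map_def smult_l_distr smult_assoc1)

lemma linear_map_smult: "r \<in> carrier R \<Longrightarrow> linear_map R M M (\<lambda>x. r \<odot>\<^bsub>M\<^esub> x)"
  by (auto simp: linear_map_def smult_r_distr m_comm simp flip: smult_assoc1)

lemma linear_map_id: "linear_map R M M (\<lambda>x. x)"
  by (auto simp: linear_map_def)

lemma regular: "module R (regular_module R)"
  using module_regular R.cring_axioms by blast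

lemma submodule_smult_elem:
  assumes "ideal J R" "m \<in> carrier M" shows "submodule ((\<lambda>r. r \<odot>\<^bsub>M\<^esub> m) ` J) R M"
proof -
  interpret linear_map_pair R "regular_module R" M "\<lambda>r. r \<odot>\<^bsub>M\<^esub> m"
    using linear_map_smult_elem[OF assms(2)] regular module_axioms
    by (simp add: linear_map_pair_def linear_map_pair_axioms_def)
  show ?thesis by (rule submodule_image[OF ideal.submodule_regular[OF assms(1)]])
qed

lemma submodule_lin_span:
  assumes "ideal J R" "submodule A R M"
  shows "set gs \<subseteq> carrier M \<Longrightarrow> submodule (lin_span R M J A gs) R M"
  by (induction gs) (auto intro!: submodule_set_add submodule_smult_elem assms)

lemma lin_span_superset:
  assumes "ideal J R" "submodule A R M"
  shows "set gs \<subseteq> carrier M \<Longrightarrow> A \<subseteq> lin_span R M J A gs"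
proof (induction gs)
  case (Cons g gs)
  then show ?case
    using set_add_upper2[OF submodule_smult_elem[OF assms(1), of g] submodule_lin_span[OF assms, of gs]]
    by auto
qed simp

lemma lin_span_mem:
  assumes "ideal J R" "submodule A R M" "j \<in> J"
  shows "set gs \<subseteq> carrier M \<Longrightarrow> g \<in> set gs \<Longrightarrow> j \<odot>\<^bsub>M\<^esub> g \<in> lin_span R M J A gs"
proof (induction gs)
  case (Cons h gs)
  note s = submodule_smult_elem[OF assms(1), of h] submodule_lin_span[OF assms(1,2), of gs]
  show ?case
  proof (cases "g = h")
    case True
    then show ?thesis using set_add_upper1[OF s] Cons.prems assms(3) by auto
  next
    case False
    then show ?thesis using set_add_upper2[OF s] Cons by auto
  qed
qed simp

lemma lin_span_least:
  assumes "submodule C R M" "A \<subseteq> C"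
  shows "(\<And>g j. g \<in> set gs \<Longrightarrow> j \<in> J \<Longrightarrow> j \<odot>\<^bsub>M\<^esub> g \<in> C) \<Longrightarrow> lin_span R M J A gs \<subseteq> C"
proof (induction gs)
  case (Cons g gs)
  then have "lin_span R M J A gs \<subseteq> C" "(\<lambda>r. r \<odot>\<^bsub>M\<^esub> g) ` J \<subseteq> C" by auto
  then show ?case using set_add_least[OF assms(1)] by simp
qed (use assms in simp)

lemma lin_span_mono:
  assumes "J \<subseteq> J'" "A \<subseteq> A'" shows "lin_span R M J A gs \<subseteq> lin_span R M J' A' gs"
proof (induction gs)
  case (Cons g gs)
  then show ?case using set_add_mono[OF image_mono[OF assms(1)]] by simp
qed (use assms in simp)

lemma lin_span_generates:
  assumes "generates R M gs" "submodule A R M" shows "lin_span R M (carrier R) A gs = carrier M"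
proof -
  note gs = generatesD(1)[OF assms(1)]
  have "\<one> \<odot>\<^bsub>M\<^esub> g \<in> lin_span R M (carrier R) A gs" if "g \<in> set gs" for g
    using lin_span_mem[OF oneideal assms(2) one_closed gs that] .
  then have "set gs \<subseteq> lin_span R M (carrier R) A gs" using gs by (metis smult_one subset_iff)
  then show ?thesis using generatesD(2)[OF assms(1) submodule_lin_span[OF oneideal assms(2) gs]] by blast
qed

text \<open>The elements that j multiplies into the span over \<open>J\<close> form a submodule, and
  it contains \<open>A\<close> and all multiples of the generators.\<close>

lemma smult_lin_span:
  assumes "ideal J R" "submodule A R M" "set gs \<subseteq> carrier M" "j \<in> J"
    and "x \<in> lin_span R M (carrier R) A gs"
  shows "j \<odot>\<^bsub>M\<^esub> x \<in> lin_span R M J A gs"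
proof -
  have jc: "j \<in> carrier R" using assms ideal.Icarr by fastforce
  interpret linear_map_pair R M M "\<lambda>x. j \<odot>\<^bsub>M\<^esub> x"
    using linear_map_smult[OF jc] module_axioms
    by (simp add: linear_map_pair_def linear_map_pair_axioms_def)
  let ?C = "{x \<in> carrier M. j \<odot>\<^bsub>M\<^esub> x \<in> lin_span R M J A gs}"
  have C: "submodule ?C R M"
    by (rule submodule_vimage[OF carrier_is_submodule submodule_lin_span[OF assms(1-3)]])
  have "lin_span R M (carrier R) A gs \<subseteq> ?C"
  proof (rule lin_span_least[OF C])
    show "A \<subseteq> ?C"
      using submoduleE(1,4)[OF assms(2)] jc lin_span_superset[OF assms(1-3)] by blast
    fix g r assume g: "g \<in> set gs" and r: "r \<in> carrier R"
    have gc: "g \<in> carrier M" using g assms by blast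
    have "j \<odot>\<^bsub>M\<^esub> (r \<odot>\<^bsub>M\<^esub> g) = (j \<otimes> r) \<odot>\<^bsub>M\<^esub> g" using r gc jc by (simp add: smult_assoc1)
    moreover have "j \<otimes> r \<in> J" using ideal.I_r_closed[OF assms(1)] assms(4) r by blast
    ultimately show "r \<odot>\<^bsub>M\<^esub> g \<in> ?C" using lin_span_mem[OF assms(1,2) _ assms(3) g] r gc by simp
  qed
  then show ?thesis using assms(5) by blast
qed

text \<open>Each new generator g adds at most the length of R/J: the map from r to r g covers the
  next quotient of the filtration and kills J modulo the previous term.\<close>

lemma length_lin_span_le:
  assumes Q: "primeideal Q R" and J: "ideal J R" and A: "submodule A R M"
  shows "set gs \<subseteq> carrier M \<Longrightarrow> (\<And>g j. g \<in> set gs \<Longrightarrow> j \<in> J \<Longrightarrow> j \<odot>\<^bsub>M\<^esub> g \<in> A) \<Longrightarrow>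
    local_length R M Q A (lin_span R M (carrier R) A gs)
      \<le> of_nat (length gs) * local_length R (regular_module R) Q J (carrier R)"
proof (induction gs)
  interpret prime_module R M Q using module_axioms Q by (simp add: prime_module_def)
  case Nil
  then show ?case
    using local_length_eq_0[OF A A subset_refl local_le_subset[OF subset_refl submoduleE(1)[OF A]]] by simp
next
  interpret prime_module R M Q using module_axioms Q by (simp add: prime_module_def)
  case (Cons g gs)
  let ?B = "lin_span R M (carrier R) A gs" and ?C = "lin_span R M (carrier R) A (g # gs)"
  let ?len = "local_length R (regular_module R) Q J (carrier R)"
  have g: "g \<in> carrier M" "set gs \<subseteq> carrier M" using Cons.prems by auto
  interpret f: linear_map_pair R "regular_module R" M "\<lambda>r. r \<odot>\<^bsub>M\<^esub> g"
    using linear_map_smult_elem[OF g(1)] regular module_axioms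
    by (simp add: linear_map_pair_def linear_map_pair_axioms_def)
  have B: "submodule ?B R M" and C: "submodule ?C R M"
    using submodule_lin_span[OF oneideal A] Cons.prems g by blast+
  have AB: "A \<subseteq> ?B" using lin_span_superset[OF oneideal A g(2)] .
  have BC: "?B \<subseteq> ?C" using set_add_upper2[OF submodule_smult_elem[OF oneideal g(1)] B] by simp
  have "local_length R M Q ?B ?C \<le> ?len"
  proof (rule f.local_length_le_of_surj[OF Q ideal.submodule_regular[OF oneideal] B C _ BC])
    show "J \<subseteq> carrier R" using ideal.Icarr[OF J] by blast
    show "(\<lambda>r. r \<odot>\<^bsub>M\<^esub> g) ` J \<subseteq> ?B" using Cons.prems(2) AB by auto
    show "local_le R M Q ?C ((\<lambda>r. r \<odot>\<^bsub>M\<^esub> g) ` carrier R <+>\<^bsub>M\<^esub> ?B)"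
      using local_le_subset[OF _ submoduleE(1)[OF C]] by simp
  qed
  moreover have "local_length R M Q A ?B \<le> of_nat (length gs) * ?len" using Cons g by simp
  ultimately show ?case
    unfolding local_length_additive[OF B C AB BC]
    using add_mono[of _ "of_nat (length gs) * ?len" _ ?len] by (simp add: distrib_right add.commute)
qed

text \<open>The source of the error terms: a quotient of M that is killed by a large ideal J is
  small. The factor is the number of generators and does not depend on \<open>J\<close> or
  \<open>T\<close>.\<close>

lemma length_quotient_le:
  assumes Q: "primeideal Q R" and J: "ideal J R" and T: "submodule T R M"
    and gs: "generates R M gs" and JT: "\<And>g j. g \<in> set gs \<Longrightarrow> j \<in> J \<Longrightarrow> j \<odot>\<^bsub>M\<^esub> g \<in> T"
  shows "local_length R M Q T (carrier M)
    \<le> of_nat (length gs) * local_length R (regular_module R) Q J (carrier R)"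
  using length_lin_span_le[OF Q J T generatesD(1)[OF gs] JT] lin_span_generates[OF gs T] by simp

text \<open>With each new g the quotient of the span over R by the span over J grows by at least the
  length of R/J. The intermediate submodule J g + B separates a copy of R/J from a copy of the
  previous quotient; independence modulo P together with P \<subseteq> J makes both maps
  injective.\<close>

lemma length_lin_span_ge:
  assumes Q: "primeideal Q R" and J: "ideal J R" and A: "submodule A R M" and PJ: "P \<subseteq> J"
  shows "set gs \<subseteq> carrier M \<Longrightarrow> (\<And>g r. g \<in> set gs \<Longrightarrow> r \<in> P \<Longrightarrow> r \<odot>\<^bsub>M\<^esub> g \<in> A) \<Longrightarrow>
    indep R M P A gs \<Longrightarrow>
    of_nat (length gs) * local_length R (regular_module R) Q J (carrier R)
      \<le> local_length R M Q (lin_span R M J A gs) (lin_span R M (carrier R) A gs)"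
proof (induction gs)
  case (Cons g gs)
  interpret prime_module R M Q using module_axioms Q by (simp add: prime_module_def)
  interpret reg: prime_module R "regular_module R" Q using regular Q by (simp add: prime_module_def)
  let ?f = "\<lambda>r. r \<odot>\<^bsub>M\<^esub> g"
  let ?B = "lin_span R M (carrier R) A gs" and ?C = "lin_span R M (carrier R) A (g # gs)"
  let ?B' = "lin_span R M J A gs" and ?C' = "lin_span R M J A (g # gs)"
  let ?D = "?f ` J <+>\<^bsub>M\<^esub> ?B"
  let ?len = "local_length R (regular_module R) Q J (carrier R)"
  have g: "g \<in> carrier M" "set gs \<subseteq> carrier M" using Cons.prems by auto
  have Jc: "J \<subseteq> carrier R" using ideal.Icarr[OF J] by blast
  interpret f: linear_map_pair R "regular_module R" M ?f
    using linear_map_smult_elem[OF g(1)] regular module_axioms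
    by (simp add: linear_map_pair_def linear_map_pair_axioms_def)
  interpret id: linear_map_pair R M M "\<lambda>x. x"
    using linear_map_id module_axioms by (simp add: linear_map_pair_def linear_map_pair_axioms_def)
  have B: "submodule ?B R M" and C: "submodule ?C R M"
    and B': "submodule ?B' R M" and C': "submodule ?C' R M"
    using submodule_lin_span[OF oneideal A] submodule_lin_span[OF J A] Cons.prems g by blast+
  have sJ: "submodule (?f ` J) R M" and sR: "submodule (?f ` carrier R) R M"
    using submodule_smult_elem[OF J g(1)] submodule_smult_elem[OF oneideal g(1)] by blast+
  have D: "submodule ?D R M" using submodule_set_add[OF sJ B] .
  have B'B: "?B' \<subseteq> ?B" using lin_span_mono[OF Jc subset_refl] .
  have C'D: "?C' \<subseteq> ?D" using set_add_mono[OF subset_refl B'B] by simp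
  have DC: "?D \<subseteq> ?C" using set_add_mono[OF image_mono[OF Jc] subset_refl] by simp
  \<comment> \<open>Above J g + B: if r g lies there, then r - j lies in P for some j in J, so r
    lies in J.\<close>
  have a: "?len \<le> local_length R M Q ?D ?C"
  proof (rule f.local_length_le_of_inj[OF Q ideal.submodule_regular[OF oneideal] D C Jc DC])
    show "?f ` carrier R \<subseteq> ?C" using set_add_upper1[OF sR B] by simp
    have "{r \<in> carrier R. ?f r \<in> ?D} \<subseteq> J"
    proof
      fix r assume "r \<in> {r \<in> carrier R. ?f r \<in> ?D}"
      then have r: "r \<in> carrier R" "?f r \<in> ?D" by auto
      obtain y b where y: "y \<in> ?f ` J" "b \<in> ?B" "?f r = y \<oplus>\<^bsub>M\<^esub> b" using r(2) by (rule set_addE)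
      obtain j where j: "j \<in> J" "y = ?f j" using y(1) by blast
      have jc: "j \<in> carrier R" using j Jc by blast
      have "(r \<ominus> j) \<odot>\<^bsub>M\<^esub> g = ?f r \<ominus>\<^bsub>M\<^esub> ?f j"
        using r jc g by (simp add: a_minus_def smult_l_distr smult_l_minus)
      also have "\<dots> = b" using y j jc g submodule_mem_carrier[OF B y(2)]
        by (simp add: a_minus_def M.a_comm[of "?f j" b] M.a_assoc M.r_neg)
      finally have "r \<ominus> j \<in> P" using Cons.prems(3) r jc y by simp
      then have "r \<ominus> j \<oplus> j \<in> J"
        using PJ j additive_subgroup.a_closed[OF ideal.axioms(1)[OF J]] by blast
      then show "r \<in> J" using r jc by (simp add: a_minus_def R.a_assoc R.l_neg)
    qed
    then show "local_le R (regular_module R) Q {r \<in> carrier R. ?f r \<in> ?D} J"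
      using reg.local_le_subset Jc by simp
  qed
  \<comment> \<open>Below it: if j g + b lies in B, where j is in J and b in B', then j lies in P,
    and so j g lies in A.\<close>
  have b: "local_length R M Q ?B' ?B \<le> local_length R M Q ?C' ?D"
  proof (rule id.local_length_le_of_inj[OF Q B C' D B'B C'D])
    show "(\<lambda>x. x) ` ?B \<subseteq> ?D" using set_add_upper2[OF sJ B] by simp
    have "{x \<in> ?B. x \<in> ?C'} \<subseteq> ?B'"
    proof
      fix x assume "x \<in> {x \<in> ?B. x \<in> ?C'}"
      then have x: "x \<in> ?B" "x \<in> ?f ` J <+>\<^bsub>M\<^esub> ?B'" by auto
      obtain y b where y: "y \<in> ?f ` J" "b \<in> ?B'" "x = y \<oplus>\<^bsub>M\<^esub> b" using x(2) by (rule set_addE)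
      obtain j where j: "j \<in> J" "y = ?f j" using y(1) by blast
      have jc: "j \<in> carrier R" using j Jc by blast
      have "?f j \<in> ?B"
        using submodule_cancel_right[OF B, of "?f j" b] x y j jc g B'B by auto
      then have "j \<in> P" using Cons.prems(3) jc by simp
      then have "?f j \<in> ?B'" using Cons.prems(2)[of g j] lin_span_superset[OF J A g(2)] by auto
      then show "x \<in> ?B'" using y j submoduleE(5)[OF B'] by simp
    qed
    then show "local_le R M Q {x \<in> ?B. x \<in> ?C'} ?B'"
      using local_le_subset[OF _ submoduleE(1)[OF B']] by blast
  qed
  have c: "of_nat (length gs) * ?len \<le> local_length R M Q ?B' ?B" using Cons g by simp
  show ?case
    unfolding local_length_additive[OF D C C'D DC] using add_mono[OF order_trans[OF c b] a]
    by (simp add: distrib_right add.commute)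
qed simp

text \<open>Greedy choice. An element h of the list either has a multiple t h with t outside P in
  the span so far, and then t is absorbed into s, or it is adjoined as independent. As P is prime,
  the product of these multipliers stays outside P and serves for all elements.\<close>

lemma exists_maximal_indep:
  assumes P: "primeideal P R" and K: "submodule K R M"
  shows "set hs \<subseteq> carrier M \<Longrightarrow> \<exists>gs s. set gs \<subseteq> carrier M \<and> length gs \<le> length hs \<and> indep R M P K gs
    \<and> s \<in> carrier R - P \<and> (\<forall>g\<in>set hs. s \<odot>\<^bsub>M\<^esub> g \<in> lin_span R M (carrier R) K gs)"
proof (induction hs)
  interpret prime_module R M P using module_axioms P by (simp add: prime_module_def)
  case Nil
  show ?case using complement_one by (intro exI[of _ "[]"] exI[of _ \<one>]) auto
next
  interpret prime_module R M P using module_axioms P by (simp add: prime_module_def)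
  case (Cons h hs)
  then obtain gs s where gs: "set gs \<subseteq> carrier M" "length gs \<le> length hs" "indep R M P K gs"
    and s: "s \<in> carrier R - P" "\<And>g. g \<in> set hs \<Longrightarrow> s \<odot>\<^bsub>M\<^esub> g \<in> lin_span R M (carrier R) K gs"
    by auto
  have hc: "h \<in> carrier M" "set hs \<subseteq> carrier M" using Cons.prems by auto
  have B: "submodule (lin_span R M (carrier R) K gs) R M" using submodule_lin_span[OF oneideal K gs(1)] .
  show ?case
  proof (cases "\<exists>t\<in>carrier R - P. t \<odot>\<^bsub>M\<^esub> h \<in> lin_span R M (carrier R) K gs")
    case True
    then obtain t where t: "t \<in> carrier R - P" "t \<odot>\<^bsub>M\<^esub> h \<in> lin_span R M (carrier R) K gs" by blast
    have "(s \<otimes> t) \<odot>\<^bsub>M\<^esub> g \<in> lin_span R M (carrier R) K gs" if "g \<in> set (h # hs)" for g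
    proof (cases "g = h")
      case True
      then show ?thesis using t s hc submoduleE(4)[OF B] by (simp add: smult_assoc1)
    next
      case False
      then have g: "g \<in> set hs" "g \<in> carrier M" using that hc by auto
      have "(s \<otimes> t) \<odot>\<^bsub>M\<^esub> g = t \<odot>\<^bsub>M\<^esub> (s \<odot>\<^bsub>M\<^esub> g)"
        using s t g by (simp add: m_comm[of s t] smult_assoc1)
      then show ?thesis using submoduleE(4)[OF B] t s(2)[OF g(1)] by simp
    qed
    then show ?thesis using gs complement_mult[OF s(1) t(1)]
      by (intro exI[of _ gs] exI[of _ "s \<otimes> t"]) auto
  next
    case False
    let ?C = "lin_span R M (carrier R) K (h # gs)"
    have gs': "set (h # gs) \<subseteq> carrier M" using gs hc by auto
    have BC: "lin_span R M (carrier R) K gs \<subseteq> ?C"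
      using set_add_upper2[OF submodule_smult_elem[OF oneideal hc(1)] B] by simp
    have "s \<odot>\<^bsub>M\<^esub> g \<in> ?C" if "g \<in> set (h # hs)" for g
    proof (cases "g = h")
      case True
      then show ?thesis using lin_span_mem[OF oneideal K _ gs', of s h] s by simp
    qed (use that s(2) BC in auto)
    moreover have "indep R M P K (h # gs)" using gs False by auto
    ultimately show ?thesis using gs gs' s(1) by (intro exI[of _ "h # gs"] exI[of _ s]) auto
  qed
qed

end

text \<open>The submodule K + I M, so that M modulo it is (M/K)/I(M/K).\<close>

definition ideal_span ::
    "('a, 'b) ring_scheme \<Rightarrow> ('a, 'm, 'c) module_scheme \<Rightarrow> 'm set \<Rightarrow> 'a set \<Rightarrow> 'm set" where
  "ideal_span R M K I = gen_submodule R M (K \<union> {i \<odot>\<^bsub>M\<^esub> x | i x. i \<in> I \<and> x \<in> carrier M})"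

context module
begin

lemma submodule_ideal_span: "K \<subseteq> carrier M \<Longrightarrow> I \<subseteq> carrier R \<Longrightarrow> submodule (ideal_span R M K I) R M"
  unfolding ideal_span_def by (rule gen_submodule_submodule) auto

lemma ideal_span_superset: "K \<subseteq> ideal_span R M K I"
  unfolding ideal_span_def using gen_submodule_superset by blast

lemma ideal_span_mem: "i \<in> I \<Longrightarrow> x \<in> carrier M \<Longrightarrow> i \<odot>\<^bsub>M\<^esub> x \<in> ideal_span R M K I"
  unfolding ideal_span_def
  using gen_submodule_superset[of "K \<union> {i \<odot>\<^bsub>M\<^esub> x | i x. i \<in> I \<and> x \<in> carrier M}"] by blast

lemma ideal_span_least:
  assumes "submodule H R M" "K \<subseteq> H" "\<And>i x. i \<in> I \<Longrightarrow> x \<in> carrier M \<Longrightarrow> i \<odot>\<^bsub>M\<^esub> x \<in> H"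
  shows "ideal_span R M K I \<subseteq> H"
  unfolding ideal_span_def by (rule gen_submodule_minimal[OF assms(1)]) (use assms in blast)

lemma ideal_span_mono:
  assumes "K' \<subseteq> carrier M" "I' \<subseteq> carrier R" "K \<subseteq> K'" "I \<subseteq> I'"
  shows "ideal_span R M K I \<subseteq> ideal_span R M K' I'"
  using submodule_ideal_span[OF assms(1,2)] ideal_span_superset[of K' I'] ideal_span_mem[of _ I' _ K'] assms
  by (intro ideal_span_least) blast+

lemma ideal_span_absorb:
  assumes "submodule K R M" "\<And>i x. i \<in> I \<Longrightarrow> x \<in> carrier M \<Longrightarrow> i \<odot>\<^bsub>M\<^esub> x \<in> K"
  shows "ideal_span R M K I = K"
  using ideal_span_least[OF assms(1) subset_refl assms(2)] ideal_span_superset[of K I] by blast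

end

context cring
begin

lemma ideal_add_mem:
  assumes "ideal I R" "ideal J R"
  shows "ideal (I <+> J) R" "I \<subseteq> I <+> J" "J \<subseteq> I <+> J"
proof -
  show "ideal (I <+> J) R" using add_ideals assms by blast
  interpret V: module R "regular_module R" using module_regular cring_axioms by blast
  show "I \<subseteq> I <+> J" "J \<subseteq> I <+> J"
    using V.set_add_upper1[OF ideal.submodule_regular ideal.submodule_regular, OF assms]
      V.set_add_upper2[OF ideal.submodule_regular ideal.submodule_regular, OF assms] by auto
qed

lemma ideal_add_least:
  assumes "ideal K R" "I \<subseteq> K" "J \<subseteq> K" shows "I <+> J \<subseteq> K"
  using assms additive_subgroup.a_closed[OF ideal.axioms(1)[OF assms(1)]] by (auto simp: set_add_def')

lemma ideal_addE:
  assumes "x \<in> I <+> J" obtains i j where "i \<in> I" "j \<in> J" "x = i \<oplus> j"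
  using assms by (auto simp: set_add_def')

text \<open>The residue field at Q: the first strict step above Q adds some y outside Q, and
  multiplication by y itself takes all of R into that member of the chain, so no further step is
  possible.\<close>

lemma local_length_prime:
  assumes Q: "primeideal Q R"
  shows "local_length R (regular_module R) Q Q (carrier R) = 1"
proof -
  interpret V: prime_module R "regular_module R" Q
    using module_regular cring_axioms Q by (simp add: prime_module_def)
  have sQ: "submodule Q R (regular_module R)"
    using ideal.submodule_regular[OF primeideal.axioms(1)[OF Q]] .
  have sR: "submodule (carrier R) R (regular_module R)"
    using ideal.submodule_regular[OF oneideal] .
  have QR: "Q \<subseteq> carrier R" using V.a_subset .
  have "\<not> local_le R (regular_module R) Q (carrier R) Q"
    unfolding local_le_def by (metis DiffE module_via_simps(4) one_closed r_one)
  then have ge: "1 \<le> local_length R (regular_module R) Q Q (carrier R)"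
    using V.local_length_ge_1[OF sQ sR QR] by simp
  have "\<not> local_chain R (regular_module R) Q Q (carrier R) (Suc (Suc 0))"
  proof
    assume "local_chain R (regular_module R) Q Q (carrier R) (Suc (Suc 0))"
    then obtain N where N: "local_chain R (regular_module R) Q Q N (Suc 0)"
      "\<not> local_le R (regular_module R) Q (carrier R) N"
      by (cases rule: local_chain.cases) auto
    from N(1) obtain N' where N': "local_chain R (regular_module R) Q Q N' 0"
      "\<not> local_le R (regular_module R) Q N N'"
      by (cases rule: local_chain.cases) auto
    have QN': "Q \<subseteq> N'" using local_chain_subset[OF N'(1)] .
    have sN: "submodule N R (regular_module R)" using local_chain_submodule[OF N(1)] .
    have Nc: "N \<subseteq> carrier R" using V.submodule_mem_carrier[OF sN] by auto
    obtain y where y: "y \<in> N" "\<And>s. s \<in> carrier R - Q \<Longrightarrow> s \<otimes> y \<notin> N'"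
      using N'(2) unfolding local_le_def by auto
    have "y \<notin> Q" using y(2)[OF V.complement_one] y(1) Nc QN' by auto
    then have yS: "y \<in> carrier R - Q" using y Nc by blast
    have "y \<otimes> x \<in> N" if "x \<in> carrier R" for x
      using V.submoduleE(4)[OF sN that y(1)] that yS m_comm by simp
    then have "local_le R (regular_module R) Q (carrier R) N"
      unfolding local_le_def using yS by auto
    then show False using N(2) by blast
  qed
  then have "\<not> enat (Suc (Suc 0)) \<le> local_length R (regular_module R) Q Q (carrier R)"
    using V.local_length_ge_iff[OF sR QR] by blast
  then show ?thesis using ge
    by (cases "local_length R (regular_module R) Q Q (carrier R)") (auto simp: one_enat_def)
qed

end

text \<open>
  A maximal family in \<open>M\<close> that is independent modulo \<open>K\<close> makes $M/K$ agree with a free module over $R/P$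
  up to a module killed by some \<open>s \<notin> P\<close>, and both inequalities hold with \<open>s\<close> independent of \<open>I\<close> and \<open>Q\<close>.
  Taking \<open>Q = P\<close> and \<open>I = 0\<close> identifies \<open>n\<close> as the rank.
\<close>

lemma (in module) length_compare_free:
  assumes P: "primeideal P R" and K: "submodule K R M"
    and PK: "\<And>r x. r \<in> P \<Longrightarrow> x \<in> carrier M \<Longrightarrow> r \<odot>\<^bsub>M\<^esub> x \<in> K"
    and gs: "generates R M gs"
  obtains n s where "n \<le> length gs" "s \<in> carrier R - P"
    "of_nat n = local_length R M P K (carrier M)"
    "\<And>Q I. primeideal Q R \<Longrightarrow> ideal I R \<Longrightarrow>
      local_length R M Q (ideal_span R M K I) (carrier M)
        \<le> of_nat n * local_length R (regular_module R) Q (P <+> I) (carrier R)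
          + of_nat (length gs) * local_length R (regular_module R) Q ((P <+> PIdl s) <+> I) (carrier R)"
    "\<And>Q I. primeideal Q R \<Longrightarrow> ideal I R \<Longrightarrow>
      of_nat n * local_length R (regular_module R) Q (P <+> I) (carrier R)
        \<le> local_length R M Q (ideal_span R M K I) (carrier M)
          + of_nat (length gs) * local_length R (regular_module R) Q ((P <+> PIdl s) <+> I) (carrier R)"
proof -
  obtain es s where es: "set es \<subseteq> carrier M" "length es \<le> length gs" "indep R M P K es"
    and s: "s \<in> carrier R - P" "\<And>g. g \<in> set gs \<Longrightarrow> s \<odot>\<^bsub>M\<^esub> g \<in> lin_span R M (carrier R) K es"
    using exists_maximal_indep[OF P K generatesD(1)[OF gs]] by blast
  note gsc = generatesD(1)[OF gs]
  have Pi: "ideal P R" using primeideal.axioms(1)[OF P] .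
  have sc: "s \<in> carrier R" using s by blast
  have Kc: "K \<subseteq> carrier M" using submoduleE(1)[OF K] .
  let ?W = "P <+> PIdl s"
  have W: "ideal ?W R" and Ws: "s \<in> ?W"
    using ideal_add_mem[OF Pi cgenideal_ideal[OF sc]] cgenideal_self[OF sc] by auto
  \<comment> \<open>Modulo K the ideal P + (s) acts through s, so it moves x into H as soon as s
    does.\<close>
  have Wg: "w \<odot>\<^bsub>M\<^esub> x \<in> H"
    if H: "submodule H R M" "K \<subseteq> H" "s \<odot>\<^bsub>M\<^esub> x \<in> H" and x: "x \<in> carrier M" and w: "w \<in> ?W" for H x w
  proof -
    obtain a b where ab: "a \<in> P" "b \<in> PIdl s" "w = a \<oplus> b" using w by (rule ideal_addE)
    obtain r where r: "r \<in> carrier R" "b = r \<otimes> s" using ab(2) unfolding cgenideal_def by blast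
    have ac: "a \<in> carrier R" using ideal.Icarr[OF Pi ab(1)] .
    have "w \<odot>\<^bsub>M\<^esub> x = a \<odot>\<^bsub>M\<^esub> x \<oplus>\<^bsub>M\<^esub> r \<odot>\<^bsub>M\<^esub> (s \<odot>\<^bsub>M\<^esub> x)"
      using ab r ac sc x by (simp add: smult_l_distr smult_assoc1)
    then show ?thesis
      using submoduleE(5)[OF H(1) subsetD[OF H(2) PK[OF ab(1) x]] submoduleE(4)[OF H(1) r(1) H(3)]] by simp
  qed
  have addg: "w \<odot>\<^bsub>M\<^esub> x \<in> H"
    if H: "submodule H R M" and w: "w \<in> A <+> B" and x: "x \<in> carrier M"
      and A: "A \<subseteq> carrier R" "\<And>a. a \<in> A \<Longrightarrow> a \<odot>\<^bsub>M\<^esub> x \<in> H"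
      and B: "B \<subseteq> carrier R" "\<And>a. a \<in> B \<Longrightarrow> a \<odot>\<^bsub>M\<^esub> x \<in> H" for H A B x w
  proof -
    obtain a b where ab: "a \<in> A" "b \<in> B" "w = a \<oplus> b" using w by (rule ideal_addE)
    have abc: "a \<in> carrier R" "b \<in> carrier R" using ab A B by blast+
    have "w \<odot>\<^bsub>M\<^esub> x = a \<odot>\<^bsub>M\<^esub> x \<oplus>\<^bsub>M\<^esub> b \<odot>\<^bsub>M\<^esub> x" using ab abc x by (simp add: smult_l_distr)
    then show ?thesis using submoduleE(5)[OF H A(2)[OF ab(1)] B(2)[OF ab(2)]] by simp
  qed
  \<comment> \<open>The span N of the family \<open>es\<close> over T contributes at most
    \<open>length es\<close> copies of R/(P + I); the remaining quotient M/N is killed by P + (s) +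
    I.\<close>
  have upper: "local_length R M Q (ideal_span R M K I) (carrier M)
        \<le> of_nat (length es) * local_length R (regular_module R) Q (P <+> I) (carrier R)
          + of_nat (length gs) * local_length R (regular_module R) Q (?W <+> I) (carrier R)"
    if Q: "primeideal Q R" and I: "ideal I R" for Q I
  proof -
    interpret prime_module R M Q using module_axioms Q by (simp add: prime_module_def)
    have Ic: "I \<subseteq> carrier R" using ideal.Icarr[OF I] by blast
    let ?T = "ideal_span R M K I"
    let ?N = "lin_span R M (carrier R) ?T es"
    have T: "submodule ?T R M" using submodule_ideal_span[OF Kc Ic] .
    have N: "submodule ?N R M" using submodule_lin_span[OF oneideal T es(1)] .
    have TN: "?T \<subseteq> ?N" using lin_span_superset[OF oneideal T es(1)] .
    have KT: "K \<subseteq> ?T" using ideal_span_superset .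
    have "local_length R M Q ?T ?N
      \<le> of_nat (length es) * local_length R (regular_module R) Q (P <+> I) (carrier R)"
    proof (rule length_lin_span_le[OF Q ideal_add_mem(1)[OF Pi I] T es(1)])
      fix g j assume g: "g \<in> set es" and j: "j \<in> P <+> I"
      then show "j \<odot>\<^bsub>M\<^esub> g \<in> ?T"
        by (intro addg[OF T j])
          (use es KT PK ideal_span_mem[of _ I _ K] ideal.Icarr[OF Pi] Ic in blast)+
    qed
    moreover have "local_length R M Q ?N (carrier M)
      \<le> of_nat (length gs) * local_length R (regular_module R) Q (?W <+> I) (carrier R)"
    proof (rule length_quotient_le[OF Q ideal_add_mem(1)[OF W I] N gs])
      fix g j assume g: "g \<in> set gs" and j: "j \<in> ?W <+> I"
      have gc: "g \<in> carrier M" using g gsc by blast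
      have KN: "K \<subseteq> ?N" using KT TN by blast
      have "s \<odot>\<^bsub>M\<^esub> g \<in> ?N" using s(2)[OF g] lin_span_mono[OF subset_refl KT] by blast
      then show "j \<odot>\<^bsub>M\<^esub> g \<in> ?N"
        using Wg[OF N KN _ gc] TN ideal_span_mem[of _ I _ K] gc ideal.Icarr[OF W] Ic
        by (intro addg[OF N j gc]) blast+
    qed
    ultimately show ?thesis
      unfolding local_length_additive[OF N carrier_is_submodule TN submoduleE(1)[OF N]]
      by (rule add_mono)
  qed
  \<comment> \<open>Multiplication by s sends M into N and T into T1. So (sM + T1)/T1 is at most as
    long as M/T, and N/(sM + T1) is an error term. Independence of \<open>es\<close> bounds the
    length of N/T1 from below.\<close>
  have lower: "of_nat (length es) * local_length R (regular_module R) Q (P <+> I) (carrier R)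
        \<le> local_length R M Q (ideal_span R M K I) (carrier M)
          + of_nat (length gs) * local_length R (regular_module R) Q (?W <+> I) (carrier R)"
    if Q: "primeideal Q R" and I: "ideal I R" for Q I
  proof -
    interpret prime_module R M Q using module_axioms Q by (simp add: prime_module_def)
    have Ic: "I \<subseteq> carrier R" using ideal.Icarr[OF I] by blast
    let ?T = "ideal_span R M K I" and ?J = "P <+> I"
    let ?T1 = "lin_span R M ?J K es" and ?N = "lin_span R M (carrier R) K es"
    let ?S = "(\<lambda>x. s \<odot>\<^bsub>M\<^esub> x) ` carrier M"
    let ?D = "?S <+>\<^bsub>M\<^esub> ?T1"
    interpret f: linear_map_pair R M M "\<lambda>x. s \<odot>\<^bsub>M\<^esub> x"
      using linear_map_smult[OF sc] module_axioms
      by (simp add: linear_map_pair_def linear_map_pair_axioms_def)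
    have J: "ideal ?J R" and PJ: "P \<subseteq> ?J" and IJ: "I \<subseteq> ?J" using ideal_add_mem[OF Pi I] by auto
    have Jc: "?J \<subseteq> carrier R" using ideal.Icarr[OF J] by blast
    have T: "submodule ?T R M" using submodule_ideal_span[OF Kc Ic] .
    have T1: "submodule ?T1 R M" using submodule_lin_span[OF J K es(1)] .
    have N: "submodule ?N R M" using submodule_lin_span[OF oneideal K es(1)] .
    have S: "submodule ?S R M" using f.submodule_image[OF carrier_is_submodule] .
    have D: "submodule ?D R M" using submodule_set_add[OF S T1] .
    have KT1: "K \<subseteq> ?T1" using lin_span_superset[OF J K es(1)] .
    have T1N: "?T1 \<subseteq> ?N" using lin_span_mono[OF Jc subset_refl] .
    have sN: "s \<odot>\<^bsub>M\<^esub> x \<in> ?N" if "x \<in> carrier M" for x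
    proof -
      have "{x \<in> carrier M. s \<odot>\<^bsub>M\<^esub> x \<in> ?N} = carrier M"
        by (rule generatesD(2)[OF gs f.submodule_vimage[OF carrier_is_submodule N]]) (use s gsc in auto)
      then show ?thesis using that by blast
    qed
    have DN: "?D \<subseteq> ?N" using set_add_least[OF N _ T1N] sN by blast
    have T1D: "?T1 \<subseteq> ?D" using set_add_upper2[OF S T1] .
    \<comment> \<open>For i in I, s (i x) = i (s x) with s x in N, and I N lies in T1.\<close>
    have sT: "?T \<subseteq> {x \<in> carrier M. s \<odot>\<^bsub>M\<^esub> x \<in> ?T1}"
    proof (rule ideal_span_least[OF f.submodule_vimage[OF carrier_is_submodule T1]])
      show "K \<subseteq> {x \<in> carrier M. s \<odot>\<^bsub>M\<^esub> x \<in> ?T1}"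
        using Kc KT1 submoduleE(4)[OF K sc] by blast
      fix i x assume i: "i \<in> I" and x: "x \<in> carrier M"
      have ic: "i \<in> carrier R" using i Ic by blast
      have "s \<odot>\<^bsub>M\<^esub> (i \<odot>\<^bsub>M\<^esub> x) = i \<odot>\<^bsub>M\<^esub> (s \<odot>\<^bsub>M\<^esub> x)"
        using ic sc x by (simp add: m_comm flip: smult_assoc1)
      then show "i \<odot>\<^bsub>M\<^esub> x \<in> {x \<in> carrier M. s \<odot>\<^bsub>M\<^esub> x \<in> ?T1}"
        using smult_lin_span[OF J K es(1) subsetD[OF IJ i] sN[OF x]] ic x by simp
    qed
    have "local_length R M Q ?T1 ?D \<le> local_length R M Q ?T (carrier M)"
    proof (rule f.local_length_le_of_surj[OF Q carrier_is_submodule T1 D submoduleE(1)[OF T] T1D])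
      show "(\<lambda>x. s \<odot>\<^bsub>M\<^esub> x) ` ?T \<subseteq> ?T1" using sT by blast
      show "local_le R M Q ?D ?D" by (rule local_le_subset[OF subset_refl submoduleE(1)[OF D]])
    qed
    moreover have "local_length R M Q ?D ?N
      \<le> of_nat (length gs) * local_length R (regular_module R) Q (?W <+> I) (carrier R)"
    proof -
      \<comment> \<open>N is enlarged to the span over D, to which the bound for spans
        applies.\<close>
      let ?N' = "lin_span R M (carrier R) ?D es"
      have N': "submodule ?N' R M" using submodule_lin_span[OF oneideal D es(1)] .
      have NN': "?N \<subseteq> ?N'" using lin_span_mono[OF subset_refl] KT1 T1D by (meson order_trans)
      have "local_length R M Q ?D ?N \<le> local_length R M Q ?D ?N'"
        by (rule local_length_mono[OF N' N subset_refl DN NN'])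
      also have "\<dots> \<le> of_nat (length es) * local_length R (regular_module R) Q (?W <+> I) (carrier R)"
      proof (rule length_lin_span_le[OF Q ideal_add_mem(1)[OF W I] D es(1)])
        fix g j assume g: "g \<in> set es" and j: "j \<in> ?W <+> I"
        have gc: "g \<in> carrier M" using g es by blast
        have "s \<odot>\<^bsub>M\<^esub> g \<in> ?D" using set_add_upper1[OF S T1] gc by blast
        moreover have "K \<subseteq> ?D" using KT1 T1D by blast
        ultimately have "w \<odot>\<^bsub>M\<^esub> g \<in> ?D" if "w \<in> ?W" for w using Wg[OF D _ _ gc that] by blast
        moreover have "i \<odot>\<^bsub>M\<^esub> g \<in> ?D" if "i \<in> I" for i
          using lin_span_mem[OF J K subsetD[OF IJ that] es(1) g] T1D by blast
        ultimately show "j \<odot>\<^bsub>M\<^esub> g \<in> ?D"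
          using ideal.Icarr[OF W] Ic by (intro addg[OF D j gc]) blast+
      qed
      also have "\<dots> \<le> of_nat (length gs) * local_length R (regular_module R) Q (?W <+> I) (carrier R)"
        using es(2) by (intro mult_right_mono) (auto simp: of_nat_eq_enat)
      finally show ?thesis .
    qed
    ultimately have "local_length R M Q ?T1 ?N \<le> local_length R M Q ?T (carrier M)
      + of_nat (length gs) * local_length R (regular_module R) Q (?W <+> I) (carrier R)"
      unfolding local_length_additive[OF D N T1D DN] by (rule add_mono)
    moreover have "of_nat (length es) * local_length R (regular_module R) Q ?J (carrier R)
      \<le> local_length R M Q ?T1 ?N"
      using length_lin_span_ge[OF Q J K PJ es(1) _ es(3)] PK es(1) by blast
    ultimately show ?thesis using order_trans by blast
  qed
  \<comment> \<open>Over P itself s becomes a unit, so the error terms vanish, and for I = 0 the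
    factor R/P has length 1.\<close>
  have "of_nat (length es) = local_length R M P K (carrier M)"
  proof -
    interpret V: prime_module R "regular_module R" P using regular P by (simp add: prime_module_def)
    have P0: "P <+> {\<zero>} = P" using ideal.Icarr[OF Pi] by (auto simp: set_add_def')
    have W0: "?W <+> {\<zero>} = ?W" using ideal.Icarr[OF W] by (force simp: set_add_def')
    have K0: "ideal_span R M K {\<zero>} = K"
      using submodule_zero[OF K] by (intro ideal_span_absorb[OF K]) auto
    have Wc: "?W \<subseteq> carrier R" using ideal.Icarr[OF W] by blast
    have "s \<otimes> x \<in> ?W" if "x \<in> carrier R" for x using ideal.I_r_closed[OF W Ws that] .
    then have "local_le R (regular_module R) P (carrier R) ?W"
      unfolding local_le_def using s(1) by auto
    then have "local_length R (regular_module R) P ?W (carrier R) = 0"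
      using V.local_length_eq_0[OF ideal.submodule_regular[OF W] ideal.submodule_regular[OF oneideal] Wc]
      by simp
    then show ?thesis
      using upper[OF P zeroideal] lower[OF P zeroideal] R.local_length_prime[OF P]
      by (simp add: P0 W0 K0)
  qed
  then show ?thesis using that es(2) s(1) upper lower by blast
qed

section \<open>The Frobenius module\<close>

lemma (in cring) binomial:
  assumes x: "x \<in> carrier R" and y: "y \<in> carrier R"
  shows "(x \<oplus> y) [^] (n::nat) = (\<Oplus>k\<in>{..n}. add_pow R (n choose k) (x [^] k \<otimes> y [^] (n - k)))"
proof (induction n)
  case 0
  then show ?case by simp
next
  case (Suc n)
  define T where "T k = add_pow R (n choose k) (x [^] k \<otimes> y [^] (n - k))" for k
  define U where "U k = add_pow R (n choose k) (x [^] k \<otimes> y [^] (Suc n - k))" for k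
  define V where "V k = add_pow R (n choose k) (x [^] Suc k \<otimes> y [^] (n - k))" for k
  have c: "T k \<in> carrier R" "U k \<in> carrier R" "V k \<in> carrier R" for k
    using x y by (simp_all add: T_def U_def V_def)
  have "T k \<otimes> x = V k" if "k \<le> n" for k
  proof -
    have "T k \<otimes> x = add_pow R (n choose k) ((x [^] k \<otimes> y [^] (n - k)) \<otimes> x)"
      unfolding T_def using x y by (intro add_pow_ldistr) auto
    also have "(x [^] k \<otimes> y [^] (n - k)) \<otimes> x = x [^] Suc k \<otimes> y [^] (n - k)"
      using x y by (simp add: m_ac)
    finally show ?thesis unfolding V_def .
  qed
  then have Tx: "(\<Oplus>k\<in>{..n}. T k) \<otimes> x = (\<Oplus>k\<in>{..n}. V k)"
    using c x by (simp add: finsum_ldistr cong: finsum_cong)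
  have "T k \<otimes> y = U k" if "k \<le> n" for k
  proof -
    have "T k \<otimes> y = add_pow R (n choose k) ((x [^] k \<otimes> y [^] (n - k)) \<otimes> y)"
      unfolding T_def using x y by (intro add_pow_ldistr) auto
    also have "(x [^] k \<otimes> y [^] (n - k)) \<otimes> y = x [^] k \<otimes> y [^] (Suc n - k)"
      using x y that by (simp add: m_assoc Suc_diff_le)
    finally show ?thesis unfolding U_def .
  qed
  then have "(\<Oplus>k\<in>{..n}. T k) \<otimes> y = (\<Oplus>k\<in>{..n}. U k)"
    using c y by (simp add: finsum_ldistr cong: finsum_cong)
  also have "\<dots> = (\<Oplus>k\<in>{..Suc n}. U k)"
    using c x y finsum_Suc[of U n] by (simp add: U_def binomial_eq_0)
  also have "\<dots> = (\<Oplus>k\<in>{..n}. U (Suc k)) \<oplus> U 0" using c by (intro finsum_Suc2) auto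
  finally have Ty: "(\<Oplus>k\<in>{..n}. T k) \<otimes> y = (\<Oplus>k\<in>{..n}. U (Suc k)) \<oplus> U 0" .
  let ?W = "\<lambda>k. add_pow R (Suc n choose k) (x [^] k \<otimes> y [^] (Suc n - k))"
  have W0: "?W 0 = U 0" by (simp add: U_def)
  have W: "?W (Suc k) = V k \<oplus> U (Suc k)" for k
    using x y by (simp add: U_def V_def add.nat_pow_mult del: nat_pow_Suc)
  have "(\<Oplus>k\<in>{..Suc n}. ?W k) = (\<Oplus>k\<in>{..n}. ?W (Suc k)) \<oplus> ?W 0"
    using x y by (intro finsum_Suc2) auto
  also have "\<dots> = (\<Oplus>k\<in>{..n}. V k \<oplus> U (Suc k)) \<oplus> U 0"
    unfolding W W0 ..
  also have "\<dots> = (\<Oplus>k\<in>{..n}. V k) \<oplus> ((\<Oplus>k\<in>{..n}. U (Suc k)) \<oplus> U 0)"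
    using c by (simp add: finsum_addf a_assoc)
  also have "\<dots> = (x \<oplus> y) [^] Suc n"
    using Suc x y c by (simp add: r_distr Tx[symmetric] Ty[symmetric] flip: T_def)
  finally show ?case ..
qed

locale prime_char_ring = cring +
  fixes p :: nat
  assumes prime: "Factorial_Ring.prime p" and char: "add_pow R p \<one> = \<zero>"
begin

abbreviation frobenius_module where
  "frobenius_module \<equiv> module_via (\<lambda>r. r [^] p) R"

lemma add_pow_multiple_char: "p dvd n \<Longrightarrow> x \<in> carrier R \<Longrightarrow> add_pow R n x = \<zero>"
proof -
  assume "p dvd n" and x: "x \<in> carrier R"
  then obtain k where n: "n = p * k" by blast
  have "add_pow R p (\<one> \<otimes> x) = (add_pow R p \<one>) \<otimes> x" using x by (simp add: add_pow_ldistr del: l_one)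
  then have "add_pow R p x = \<zero>" using x char by simp
  then show "add_pow R n x = \<zero>" unfolding n using x by (simp flip: add.nat_pow_pow)
qed

lemma frobenius_add:
  assumes x: "x \<in> carrier R" and y: "y \<in> carrier R"
  shows "(x \<oplus> y) [^] p = x [^] p \<oplus> y [^] p"
proof -
  let ?W = "\<lambda>k. add_pow R (p choose k) (x [^] k \<otimes> y [^] (p - k))"
  have "2 \<le> p" using prime prime_ge_2_nat by blast
  then obtain m where m: "p = Suc (Suc m)" by (metis add_2_eq_Suc le_Suc_ex)
  have c: "?W k \<in> carrier R" for k using x y by simp
  have "?W (Suc k) = \<zero>" if "k \<le> m" for k
  proof (rule add_pow_multiple_char)
    show "p dvd (p choose Suc k)" using prime that m by (intro dvd_choose_prime) auto
  qed (use x y in simp)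
  then have z: "(\<Oplus>k\<in>{..m}. ?W (Suc k)) = \<zero>" by (simp add: finsum_zero cong: finsum_cong)
  have "(x \<oplus> y) [^] p = (\<Oplus>k\<in>{..Suc (Suc m)}. ?W k)"
    using binomial[OF x y, of p] m by simp
  also have "\<dots> = ?W (Suc (Suc m)) \<oplus> (\<Oplus>k\<in>{..Suc m}. ?W k)"
    by (rule finsum_Suc) (use c in auto)
  also have "(\<Oplus>k\<in>{..Suc m}. ?W k) = (\<Oplus>k\<in>{..m}. ?W (Suc k)) \<oplus> ?W 0"
    by (rule finsum_Suc2) (use c in auto)
  also have "?W (Suc (Suc m)) \<oplus> ((\<Oplus>k\<in>{..m}. ?W (Suc k)) \<oplus> ?W 0) = x [^] p \<oplus> y [^] p"
    unfolding z using x y by (simp flip: m)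
  finally show ?thesis .
qed

lemma frobenius_hom: "(\<lambda>r. r [^] p) \<in> ring_hom R R"
  by (rule ring_hom_memI) (auto simp: frobenius_add nat_pow_distrib)

lemma frobenius_power_add:
  "x \<in> carrier R \<Longrightarrow> y \<in> carrier R \<Longrightarrow> (x \<oplus> y) [^] (p ^ e) = x [^] (p ^ e) \<oplus> y [^] (p ^ e)"
proof (induction e)
  case (Suc e)
  have "z [^] (p ^ Suc e) = (z [^] (p ^ e)) [^] p" if "z \<in> carrier R" for z
    using that by (simp add: nat_pow_pow mult.commute)
  then show ?case using Suc frobenius_add by simp
qed simp

lemma frobenius_pow_hom: "(\<lambda>r. r [^] (p ^ e)) \<in> ring_hom R R"
  by (rule ring_hom_memI) (auto simp: frobenius_power_add nat_pow_distrib)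

lemma module_frobenius: "module R frobenius_module"
  using module_module_via[OF cring_axioms cring_axioms frobenius_hom] .

lemma submodule_frobenius: "ideal I R \<Longrightarrow> submodule I R frobenius_module"
  by (rule ideal.submodule_via) auto

lemma pos: "0 < p" using prime prime_gt_0_nat by blast

end

context ring
begin

lemma ideal_frob_power: "I \<subseteq> carrier R \<Longrightarrow> ideal (frob_power R q I) R"
  unfolding frob_power_def by (rule genideal_ideal) auto

lemma frob_power_mem: "I \<subseteq> carrier R \<Longrightarrow> x \<in> I \<Longrightarrow> x [^] q \<in> frob_power R q I"
  unfolding frob_power_def using genideal_self[of "{x [^] q | x. x \<in> I}"] by blast

lemma frob_power_least: "ideal J R \<Longrightarrow> (\<And>x. x \<in> I \<Longrightarrow> x [^] q \<in> J) \<Longrightarrow> frob_power R q I \<subseteq> J"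
  unfolding frob_power_def by (rule genideal_minimal) auto

lemma frob_power_mono: "J \<subseteq> carrier R \<Longrightarrow> I \<subseteq> J \<Longrightarrow> frob_power R q I \<subseteq> frob_power R q J"
  by (intro frob_power_least ideal_frob_power frob_power_mem) auto

lemma frob_power_1: "ideal I R \<Longrightarrow> frob_power R 1 I = I"
  using frob_power_least[of I I 1] frob_power_mem[of I _ 1] ideal.Icarr[of I R]
  by (auto simp: subset_iff)

end

context prime_char_ring
begin

lemma ideal_frobenius_vimage:
  assumes J: "ideal J R" shows "ideal {y \<in> carrier R. y [^] (p ^ e) \<in> J} R"
proof -
  interpret V: module R "module_via (\<lambda>r. r [^] (p ^ e)) R"
    using module_module_via[OF cring_axioms cring_axioms frobenius_pow_hom] .
  have l: "linear_map R (regular_module R) (module_via (\<lambda>r. r [^] (p ^ e)) R) (\<lambda>r. r [^] (p ^ e))"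
    by (auto simp: linear_map_def frobenius_power_add nat_pow_distrib)
  interpret linear_map_pair R "regular_module R" "module_via (\<lambda>r. r [^] (p ^ e)) R" "\<lambda>r. r [^] (p ^ e)"
    using l module_regular[OF cring_axioms] V.module_axioms
    by (simp add: linear_map_pair_def linear_map_pair_axioms_def)
  have "submodule J R (module_via (\<lambda>r. r [^] (p ^ e)) R)"
    by (rule ideal.submodule_via[OF J]) auto
  then have "submodule {y \<in> carrier R. y [^] (p ^ e) \<in> J} R (regular_module R)"
    using submodule_vimage[OF ideal.submodule_regular[OF oneideal]] by blast
  then show ?thesis by (rule ideal_of_submodule_regular)
qed

text \<open>Elements of a Frobenius power are combinations, not single powers. Since Frobenius is
  additive, the elements whose \<open>p ^ j\<close>-th power lies in a given ideal form an ideal, so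
  it suffices to look at generators.\<close>

lemma frob_power_frob_power:
  assumes "I \<subseteq> carrier R"
  shows "frob_power R (p ^ j) (frob_power R (p ^ i) I) = frob_power R (p ^ (i + j)) I"
proof
  have I: "ideal (frob_power R (p ^ i) I) R" using ideal_frob_power[OF assms] .
  have Ic: "frob_power R (p ^ i) I \<subseteq> carrier R" using ideal.Icarr[OF I] by blast
  have pp: "(x [^] (p ^ i)) [^] (p ^ j) = x [^] (p ^ (i + j))" if "x \<in> I" for x
    using that assms by (auto simp: nat_pow_pow power_add)
  show "frob_power R (p ^ (i + j)) I \<subseteq> frob_power R (p ^ j) (frob_power R (p ^ i) I)"
    using frob_power_mem[OF Ic frob_power_mem[OF assms], of _ "p ^ j"] pp
    by (intro frob_power_least ideal_frob_power Ic) auto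
  have "frob_power R (p ^ i) I \<subseteq> {y \<in> carrier R. y [^] (p ^ j) \<in> frob_power R (p ^ (i + j)) I}"
    using frob_power_mem[OF assms] pp assms
    by (intro frob_power_least ideal_frobenius_vimage ideal_frob_power) auto
  then show "frob_power R (p ^ j) (frob_power R (p ^ i) I) \<subseteq> frob_power R (p ^ (i + j)) I"
    by (intro frob_power_least ideal_frob_power assms) auto
qed

text \<open>This identifies F_*(R/P)/I F_*(R/P) with F_*(R/(P + I^[p])), the link between Frobenius
  powers of ideals and the module F_* R.\<close>

lemma ideal_span_frobenius:
  assumes P: "ideal P R" and I: "ideal I R"
  shows "ideal_span R frobenius_module P I = P <+> frob_power R p I"
proof -
  interpret V: module R frobenius_module by (rule module_frobenius)
  have Pc: "P \<subseteq> carrier R" and Ic: "I \<subseteq> carrier R" using ideal.Icarr[OF P] ideal.Icarr[OF I] by auto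
  note fI = ideal_frob_power[OF Ic, of p]
  let ?T = "ideal_span R frobenius_module P I"
  have T: "submodule ?T R frobenius_module" using V.submodule_ideal_span[of P I] Pc Ic by simp
  note s = ideal_add_mem[OF P fI]
  have "?T \<subseteq> P <+> frob_power R p I"
  proof (rule V.ideal_span_least[OF submodule_frobenius[OF s(1)] s(2)])
    fix i x assume "i \<in> I" "x \<in> carrier frobenius_module"
    then show "i \<odot>\<^bsub>frobenius_module\<^esub> x \<in> P <+> frob_power R p I"
      using ideal.I_r_closed[OF fI frob_power_mem[OF Ic]] s(3) by auto
  qed
  moreover have "frob_power R p I \<subseteq> ?T"
  proof -
    \<comment> \<open>As a submodule of F_* R, T is only known to absorb p-th powers. The elements
      all of whose multiples lie in T form an honest ideal, which can be compared with
      I^[p].\<close>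
    let ?J = "{y \<in> carrier R. \<forall>r\<in>carrier R. r \<otimes> y \<in> ?T}"
    interpret reg: module R "regular_module R" using module_regular cring_axioms by blast
    have "submodule ?J R (regular_module R)"
    proof (rule reg.submoduleI)
      show "\<ominus>\<^bsub>regular_module R\<^esub> a \<in> ?J" if "a \<in> ?J" for a
        using that V.submoduleE(3)[OF T] by (auto simp: r_minus)
      show "a \<oplus>\<^bsub>regular_module R\<^esub> b \<in> ?J" if "a \<in> ?J" "b \<in> ?J" for a b
        using that V.submoduleE(5)[OF T] by (auto simp: r_distr)
      show "a \<odot>\<^bsub>regular_module R\<^esub> x \<in> ?J" if "a \<in> carrier R" "x \<in> ?J" for a x
        using that by (auto simp flip: m_assoc)
    qed (use V.submodule_zero[OF T] in auto)
    then have "ideal ?J R" by (rule ideal_of_submodule_regular)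
    moreover have "x [^] p \<in> ?J" if "x \<in> I" for x
    proof -
      have xc: "x \<in> carrier R" using that Ic by blast
      then have "r \<otimes> x [^] p \<in> ?T" if r: "r \<in> carrier R" for r
        using V.ideal_span_mem[OF \<open>x \<in> I\<close>, of r P] r by (simp add: m_comm)
      then show ?thesis using xc by simp
    qed
    ultimately have "frob_power R p I \<subseteq> ?J" by (rule frob_power_least)
    moreover have "y \<in> ?T" if "y \<in> ?J" for y
    proof -
      have "y \<in> carrier R" "\<one> \<otimes> y \<in> ?T" using that one_closed by blast+
      then show ?thesis by simp
    qed
    ultimately show ?thesis by blast
  qed
  then have "P <+> frob_power R p I \<subseteq> ?T"
    using V.set_add_least[OF T V.ideal_span_superset] by simp
  ultimately show ?thesis by blast
qed

end

text \<open>\<open>ring_char\<close> is a gcd, so it has to be shown that the gcd is attained.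
  Positive n with n 1 = 0 exist since the gcd is prime, hence nonzero, and the least of them divides
  all others by division with remainder.\<close>

lemma (in cring) char_add_pow:
  assumes "ring_char R = p" "Factorial_Ring.prime p"
  shows "add_pow R p \<one> = \<zero>"
proof -
  let ?A = "{n::nat. add_pow R n \<one> = \<zero>}"
  have G: "Gcd ?A = p" using assms by (simp add: ring_char_def)
  have "\<exists>n\<in>?A. n > 0"
  proof (rule ccontr)
    assume "\<not> (\<exists>n\<in>?A. n > 0)"
    then have "Gcd ?A = 0" by (simp add: Gcd_0_iff subset_iff)
    then show False using G assms(2) by simp
  qed
  then obtain m where m: "m \<in> ?A" "m > 0" "\<And>k. k \<in> ?A \<Longrightarrow> k > 0 \<Longrightarrow> m \<le> k"
    using exists_least_iff[of "\<lambda>n. n \<in> ?A \<and> n > 0"] by (metis linorder_not_le)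
  have "m dvd n" if n: "n \<in> ?A" for n
  proof -
    have "add_pow R n \<one> = add_pow R (n mod m) \<one> \<oplus> add_pow R (m * (n div m)) \<one>"
      by (simp add: add.nat_pow_mult)
    also have "add_pow R (m * (n div m)) \<one> = add_pow R (n div m) (add_pow R m \<one>)" by (simp add: add.nat_pow_pow)
    finally have "n mod m \<in> ?A" using n m(1) by simp
    then have "n mod m = 0" using m(2) m(3)[of "n mod m"] by (metis gr0I mod_less_divisor not_le)
    then show ?thesis by presburger
  qed
  then have "m dvd p" using G Gcd_greatest by metis
  moreover have "p dvd m" using G Gcd_dvd[OF m(1)] by simp
  ultimately have "m = p" by (rule dvd_antisym)
  then show ?thesis using m(1) by simp
qed

context prime_char_ring
begin

lemma frobenius_complement:
  assumes "primeideal Q R" "s \<in> carrier R - Q" shows "s [^] (n::nat) \<in> carrier R - Q"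
proof (induction n)
  interpret V: prime_module R "regular_module R" Q
    using module_regular cring_axioms assms(1) by (simp add: prime_module_def)
  case 0 then show ?case using V.complement_one by simp
next
  interpret V: prime_module R "regular_module R" Q
    using module_regular cring_axioms assms(1) by (simp add: prime_module_def)
  case (Suc n) then show ?case using V.complement_mult[OF Suc assms(2)] by simp
qed

lemma frobenius_smult_mem:
  assumes P: "ideal P R" and j: "j \<in> P" and y: "y \<in> carrier R"
  shows "j \<odot>\<^bsub>frobenius_module\<^esub> y \<in> P"
proof -
  obtain k where k: "p = Suc k" using pos gr0_implies_Suc by blast
  have "j [^] p \<in> P" using ideal.Icarr[OF P j] ideal.I_l_closed[OF P j] by (simp add: k)
  then show ?thesis using ideal.I_r_closed[OF P _ y] by simp
qed

text \<open>A multiplier s acts on F_* R as s^p, and s^p x is a multiple of s x because p is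
  positive.\<close>

lemma local_le_frobenius:
  assumes "ideal B R" "A \<subseteq> carrier R" "local_le R (regular_module R) Q A B"
  shows "local_le R frobenius_module Q A B"
  unfolding local_le_def
proof
  fix x assume x: "x \<in> A"
  then obtain s where s: "s \<in> carrier R - Q" "s \<otimes> x \<in> B" using assms(3) by (auto simp: local_le_def)
  obtain k where k: "p = Suc k" using pos gr0_implies_Suc by blast
  have "s [^] p \<otimes> x = s [^] k \<otimes> (s \<otimes> x)" using s x assms(2) by (auto simp: k m_assoc)
  also have "\<dots> \<in> B" using ideal.I_l_closed[OF assms(1) s(2)] s by simp
  finally show "\<exists>s\<in>carrier R - Q. s \<odot>\<^bsub>frobenius_module\<^esub> x \<in> B" using s by auto
qed

text \<open>The dimension of $F_* \kappa(Q)$ over $\kappa(Q)$.\<close>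

abbreviation frobenius_rank where
  "frobenius_rank Q \<equiv> local_length R frobenius_module Q Q (carrier R)"

text \<open>Locally B/A is generated by one element y with annihilator Q. Multiplication by y is
  linear for the Frobenius structure as well, so locally it identifies F_*(R/Q) with F_*(B/A). The
  ideals N1 = Qy + A and N2 = Ry + A have the same localizations as A and B.\<close>

lemma frobenius_length_simple:
  assumes Q: "primeideal Q R" and A: "ideal A R" and B: "ideal B R" and AB: "A \<subseteq> B"
    and one: "local_length R (regular_module R) Q A B = 1"
  shows "local_length R frobenius_module Q A B = frobenius_rank Q"
proof -
  interpret V: prime_module R "regular_module R" Q
    using module_regular cring_axioms Q by (simp add: prime_module_def)
  interpret F: prime_module R frobenius_module Q
    using module_frobenius Q by (simp add: prime_module_def)
  have Bc: "B \<subseteq> carrier R" using ideal.Icarr[OF B] by blast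
  note Qi = primeideal.axioms(1)[OF Q]
  have sA: "submodule A R (regular_module R)" and sB: "submodule B R (regular_module R)"
    using ideal.submodule_regular A B by blast+
  have "\<not> local_le R (regular_module R) Q B A"
    using V.local_length_eq_0[OF sA sB AB] one by auto
  then obtain y where y: "y \<in> B" "\<And>s. s \<in> carrier R - Q \<Longrightarrow> s \<otimes> y \<notin> A"
    unfolding local_le_def by auto
  have yc: "y \<in> carrier R" using y Bc by blast
  interpret f: linear_map_pair R "regular_module R" "regular_module R" "\<lambda>r. r \<otimes> y"
    using V.linear_map_smult_elem[of y] yc V.module_axioms
    by (simp add: linear_map_pair_def linear_map_pair_axioms_def)
  interpret g: linear_map_pair R frobenius_module frobenius_module "\<lambda>r. r \<otimes> y"
    using yc F.module_axioms
    by (auto simp: linear_map_pair_def linear_map_pair_axioms_def linear_map_def l_distr m_assoc)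
  let ?N1 = "(\<lambda>r. r \<otimes> y) ` Q <+> A" and ?N2 = "(\<lambda>r. r \<otimes> y) ` carrier R <+> A"
  have s: "submodule ((\<lambda>r. r \<otimes> y) ` Q) R (regular_module R)"
    "submodule ((\<lambda>r. r \<otimes> y) ` carrier R) R (regular_module R)"
    using f.submodule_image[OF ideal.submodule_regular] Qi oneideal by blast+
  have s1: "submodule ?N1 R (regular_module R)" and s2: "submodule ?N2 R (regular_module R)"
    using V.submodule_set_add[OF s(1) sA] V.submodule_set_add[OF s(2) sA] by simp_all
  have N1: "ideal ?N1 R" and N2: "ideal ?N2 R" using s1 s2 ideal_of_submodule_regular by blast+
  have AN1: "A \<subseteq> ?N1" using V.set_add_upper2[OF s(1) sA] by simp
  have Qc: "Q \<subseteq> carrier R" using ideal.Icarr[OF Qi] by blast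
  have N12: "?N1 \<subseteq> ?N2" using V.set_add_mono[OF image_mono[OF Qc] subset_refl] by simp
  have "r \<otimes> y \<in> B" if "r \<in> carrier R" for r using ideal.I_l_closed[OF B y(1) that] .
  then have N2B: "?N2 \<subseteq> B"
    using V.set_add_least[OF sB _ AB, of "(\<lambda>r. r \<otimes> y) ` carrier R"] by (simp add: image_subset_iff)
  \<comment> \<open>If r y = q y + a, then r - q multiplies y into A, which the choice of y allows
    only for r - q in Q.\<close>
  have inQ: "r \<in> Q" if r: "r \<in> carrier R" "r \<otimes> y \<in> ?N1" for r
  proof -
    obtain z a where z: "z \<in> (\<lambda>r. r \<otimes> y) ` Q" "a \<in> A" "r \<otimes> y = z \<oplus> a"
      using r(2) by (rule ideal_addE)
    then obtain q where q: "q \<in> Q" "z = q \<otimes> y" by blast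
    have c: "q \<in> carrier R" "a \<in> carrier R" using q z Qc ideal.Icarr[OF A] by auto
    have "(r \<ominus> q) \<otimes> y = r \<otimes> y \<ominus> q \<otimes> y" using r c yc by (simp add: a_minus_def l_distr l_minus)
    also have "\<dots> = a" using z(3) q(2) c yc by (simp add: a_minus_def a_comm[of "q \<otimes> y" a] a_assoc r_neg)
    finally have "r \<ominus> q \<in> Q" using y(2)[of "r \<ominus> q"] r c z(2) by auto
    then have "r \<ominus> q \<oplus> q \<in> Q" using additive_subgroup.a_closed[OF ideal.axioms(1)[OF Qi]] q by blast
    then show ?thesis using r c by (simp add: a_minus_def a_assoc l_neg)
  qed
  have yN2: "y \<in> ?N2"
    using V.set_add_upper1[OF s(2) sA] yc imageI[of \<one> "carrier R" "\<lambda>r. r \<otimes> y"] by auto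
  \<comment> \<open>Otherwise A, N1, N2 would form a chain with two strict steps, against length
    1.\<close>
  have "local_le R (regular_module R) Q ?N1 A"
  proof (rule ccontr)
    assume "\<not> ?thesis"
    then have c1: "local_chain R (regular_module R) Q A ?N1 (Suc 0)"
      using local_chain.step[OF local_chain.base[OF sA subset_refl] s1 AN1] by blast
    have "\<not> local_le R (regular_module R) Q ?N2 ?N1"
      using yN2 inQ unfolding local_le_def by fastforce
    then have "local_chain R (regular_module R) Q A ?N2 (Suc (Suc 0))"
      using local_chain.step[OF c1 s2 N12] by blast
    then have "enat (Suc (Suc 0)) \<le> local_length R (regular_module R) Q A B"
      using V.local_length_ge_iff[OF sB AB] V.local_chain_mono[OF _ sB N2B] by blast
    then show False using one by (simp add: one_enat_def)
  qed
  then have le1: "local_le R frobenius_module Q ?N1 A"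
    using local_le_frobenius[OF A] ideal.Icarr[OF N1] by blast
  have "local_le R (regular_module R) Q B ?N2"
  proof (rule ccontr)
    assume n: "\<not> ?thesis"
    have AN2: "A \<subseteq> ?N2" using AN1 N12 by blast
    have "\<not> local_le R (regular_module R) Q ?N2 A" using yN2 y(2) unfolding local_le_def by auto
    then have c1: "local_chain R (regular_module R) Q A ?N2 (Suc 0)"
      using local_chain.step[OF local_chain.base[OF sA subset_refl] s2 AN2] by blast
    then have "local_chain R (regular_module R) Q A B (Suc (Suc 0))"
      using local_chain.step[OF c1 sB N2B n] by blast
    then have "enat (Suc (Suc 0)) \<le> local_length R (regular_module R) Q A B"
      using V.local_length_ge_iff[OF sB AB] by blast
    then show False using one by (simp add: one_enat_def)
  qed
  then have le2: "local_le R frobenius_module Q B ?N2" using local_le_frobenius[OF N2 Bc] by blast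
  note fs = submodule_frobenius
  have "local_length R frobenius_module Q ?N1 ?N2 \<le> frobenius_rank Q"
  proof (rule g.local_length_le_of_surj[OF Q fs[OF oneideal] fs[OF N1] fs[OF N2] Qc N12])
    have "(\<lambda>r. r \<otimes> y) ` Q \<subseteq> ?N1" using V.set_add_upper1[OF s(1) sA] by simp
    then show "(\<lambda>r. r \<otimes> y) ` Q \<subseteq> ?N1" .
    have "?N2 \<subseteq> (\<lambda>r. r \<otimes> y) ` carrier R <+> ?N1"
      using V.set_add_mono[OF subset_refl AN1] by simp
    then show "local_le R frobenius_module Q ?N2 ((\<lambda>r. r \<otimes> y) ` carrier R <+>\<^bsub>frobenius_module\<^esub> ?N1)"
      using F.local_le_subset[OF _ F.submoduleE(1)[OF F.submodule_set_add[OF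
          g.submodule_image[OF fs[OF oneideal]] fs[OF N1]]]] by simp
  qed
  moreover have "frobenius_rank Q \<le> local_length R frobenius_module Q ?N1 ?N2"
  proof (rule g.local_length_le_of_inj[OF Q fs[OF oneideal] fs[OF N1] fs[OF N2] Qc N12])
    show "(\<lambda>r. r \<otimes> y) ` carrier R \<subseteq> ?N2" using V.set_add_upper1[OF s(2) sA] by simp
    show "local_le R frobenius_module Q {x \<in> carrier R. x \<otimes> y \<in> ?N1} Q"
      using inQ Qc by (intro F.local_le_subset) auto
  qed
  moreover have "local_length R frobenius_module Q A ?N1 = 0"
    using F.local_length_eq_0[OF fs[OF A] fs[OF N1] AN1 le1] .
  moreover have "local_length R frobenius_module Q ?N2 B = 0"
    using F.local_length_eq_0[OF fs[OF N2] fs[OF B] N2B le2] .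
  moreover have "local_length R frobenius_module Q A B = local_length R frobenius_module Q A ?N1
      + (local_length R frobenius_module Q ?N1 ?N2 + local_length R frobenius_module Q ?N2 B)"
    using F.local_length_additive[OF fs[OF N1] fs[OF B] AN1] F.local_length_additive[OF fs[OF N2] fs[OF B] N12 N2B]
      N12 N2B by (metis order_trans)
  ultimately show ?thesis by simp
qed

text \<open>The last step of a longest chain is simple and is peeled off; each simple piece
  contributes the rank at Q. Applied at \<mm>, this converts lengths of F_* back into
  lengths.\<close>

lemma frobenius_length:
  assumes Q: "primeideal Q R" and A: "ideal A R"
  shows "ideal B R \<Longrightarrow> A \<subseteq> B \<Longrightarrow> local_length R (regular_module R) Q A B = enat n \<Longrightarrow>
    local_length R frobenius_module Q A B = of_nat n * frobenius_rank Q"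
proof (induction n arbitrary: B)
  interpret V: prime_module R "regular_module R" Q
    using module_regular cring_axioms Q by (simp add: prime_module_def)
  interpret F: prime_module R frobenius_module Q
    using module_frobenius Q by (simp add: prime_module_def)
  case 0
  have "local_le R (regular_module R) Q B A"
    using V.local_length_ge_1[OF ideal.submodule_regular[OF A] ideal.submodule_regular[OF 0(1)] 0(2)] 0(3)
    by (auto simp flip: zero_enat_def)
  then have "local_le R frobenius_module Q B A"
    using local_le_frobenius[OF A] ideal.Icarr[OF 0(1)] by blast
  then show ?case
    using F.local_length_eq_0[OF submodule_frobenius[OF A] submodule_frobenius[OF 0(1)] 0(2)] by simp
next
  interpret V: prime_module R "regular_module R" Q
    using module_regular cring_axioms Q by (simp add: prime_module_def)
  interpret F: prime_module R frobenius_module Q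
    using module_frobenius Q by (simp add: prime_module_def)
  case (Suc n)
  have sB: "submodule B R (regular_module R)" using ideal.submodule_regular Suc.prems(1) by blast
  have "local_chain R (regular_module R) Q A B (Suc n)"
    using V.local_length_ge_iff[OF sB Suc.prems(2), of "Suc n"] Suc.prems(3) by simp
  then obtain N where N: "local_chain R (regular_module R) Q A N n" "N \<subseteq> B"
      "\<not> local_le R (regular_module R) Q B N"
    by (cases rule: local_chain.cases) auto
  have sN: "submodule N R (regular_module R)" "A \<subseteq> N"
    using local_chain_submodule[OF N(1)] local_chain_subset[OF N(1)] by auto
  have iN: "ideal N R" using ideal_of_submodule_regular sN by blast
  have a: "local_length R (regular_module R) Q A B
      = local_length R (regular_module R) Q A N + local_length R (regular_module R) Q N B"
    using V.local_length_additive[OF sN(1) sB sN(2) N(2)] .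
  have "enat n \<le> local_length R (regular_module R) Q A N" using V.local_length_ge_iff[OF sN] N(1) by simp
  moreover have "1 \<le> local_length R (regular_module R) Q N B"
    using V.local_length_ge_1[OF sN(1) sB N(2,3)] .
  ultimately have l: "local_length R (regular_module R) Q A N = enat n"
    "local_length R (regular_module R) Q N B = 1"
    using a Suc.prems(3)
    by (cases "local_length R (regular_module R) Q A N"; cases "local_length R (regular_module R) Q N B";
        auto simp: one_enat_def)+
  have "local_length R frobenius_module Q A B
      = of_nat n * frobenius_rank Q + frobenius_rank Q"
    using F.local_length_additive[OF submodule_frobenius[OF iN] submodule_frobenius[OF Suc.prems(1)] sN(2) N(2)]
      Suc.IH[OF iN sN(2) l(1)] frobenius_length_simple[OF Q iN Suc.prems(1) N(2) l(2)] by simp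
  then show ?case by (simp add: distrib_right add.commute)
qed

text \<open>The element 1 survives in F_*(R/Q), since powers of elements outside Q stay outside Q.
  The bound serves to cancel the rank at \<mm>.\<close>

lemma frobenius_rank_ge_1:
  assumes "primeideal Q R" shows "1 \<le> frobenius_rank Q"
proof -
  interpret F: prime_module R frobenius_module Q
    using module_frobenius assms by (simp add: prime_module_def)
  have "\<not> local_le R frobenius_module Q (carrier R) Q"
  proof
    assume "local_le R frobenius_module Q (carrier R) Q"
    then obtain s where "s \<in> carrier R - Q" "s \<odot>\<^bsub>frobenius_module\<^esub> \<one> \<in> Q"
      unfolding local_le_def using one_closed by blast
    then show False using frobenius_complement[OF assms, of s p] by simp
  qed
  then show ?thesis
    using F.local_length_ge_1[OF submodule_frobenius submodule_frobenius[OF oneideal]] F.ideal_axioms F.a_subset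
    by simp
qed

text \<open>Here F-finiteness enters: F_*(R/Q) is generated by the images of \<open>gs\<close>, and
  R/Q has local length 1.\<close>

lemma frobenius_rank_finite:
  assumes Q: "primeideal Q R" and gs: "generates R frobenius_module gs"
  shows "frobenius_rank Q \<noteq> \<infinity>"
proof -
  interpret F: prime_module R frobenius_module Q
    using module_frobenius Q by (simp add: prime_module_def)
  have "frobenius_rank Q \<le> of_nat (length gs) * local_length R (regular_module R) Q Q (carrier R)"
  proof -
    have "j \<odot>\<^bsub>frobenius_module\<^esub> g \<in> Q" if "g \<in> set gs" "j \<in> Q" for g j
      using frobenius_smult_mem[OF F.ideal_axioms that(2)] generatesD(1)[OF gs] that(1) by auto
    then show ?thesis
      using F.length_quotient_le[OF Q F.ideal_axioms submodule_frobenius[OF F.ideal_axioms] gs] by simp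
  qed
  then show ?thesis using local_length_prime[OF Q] by (auto simp: of_nat_eq_enat dest!: enat_ile)
qed

end

section \<open>Colength of ideals\<close>

lemma (in noetherian_ring) noetherian_induct:
  assumes "ideal J R"
    and step: "\<And>J. ideal J R \<Longrightarrow> (\<And>J'. ideal J' R \<Longrightarrow> J \<subset> J' \<Longrightarrow> \<Phi> J') \<Longrightarrow> \<Phi> J"
  shows "\<Phi> J"
proof (rule ccontr)
  let ?S = "{J. ideal J R \<and> \<not> \<Phi> J}"
  assume "\<not> \<Phi> J"
  then have ne: "?S \<noteq> {}" using assms(1) by blast
  have "\<Union>C \<in> ?S" if "C \<noteq> {}" "subset.chain ?S C" for C
  proof -
    have "subset.chain {I. ideal I R} C" using that(2) unfolding pred_on.chain_def by blast
    then have "\<Union>C \<in> C" using ideal_chain_is_trivial that(1) by blast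
    then show ?thesis using that(2) unfolding pred_on.chain_def by blast
  qed
  then have "\<exists>K\<in>?S. \<forall>L\<in>?S. K \<subseteq> L \<longrightarrow> L = K" by (rule subset_Zorn_nonempty[OF ne])
  then obtain K where K: "K \<in> ?S" "\<forall>L\<in>?S. K \<subseteq> L \<longrightarrow> L = K" ..
  have "\<Phi> K"
  proof (rule step)
    show "\<Phi> J'" if "ideal J' R" "K \<subset> J'" for J' using K that by blast
  qed (use K in blast)
  then show False using K by blast
qed

definition colon :: "('a, 'b) ring_scheme \<Rightarrow> 'a set \<Rightarrow> 'a \<Rightarrow> 'a set" where
  "colon R J a = {r \<in> carrier R. r \<otimes>\<^bsub>R\<^esub> a \<in> J}"

context cring
begin

lemma ideal_colon:
  assumes J: "ideal J R" and a: "a \<in> carrier R" shows "ideal (colon R J a) R"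
proof -
  interpret V: module R "regular_module R" using module_regular cring_axioms by blast
  interpret f: linear_map_pair R "regular_module R" "regular_module R" "\<lambda>r. r \<otimes> a"
    using V.linear_map_smult_elem[of a] a V.module_axioms
    by (simp add: linear_map_pair_def linear_map_pair_axioms_def)
  show ?thesis
    unfolding colon_def
    using f.submodule_vimage[OF ideal.submodule_regular[OF oneideal] ideal.submodule_regular[OF J]]
    by (rule ideal_of_submodule_regular)
qed

lemma colon_superset: "ideal J R \<Longrightarrow> a \<in> carrier R \<Longrightarrow> J \<subseteq> colon R J a"
  using ideal.I_r_closed ideal.Icarr unfolding colon_def by fastforce

lemma PIdl_mem: "a \<in> carrier R \<Longrightarrow> r \<in> carrier R \<Longrightarrow> r \<otimes> a \<in> PIdl a"
  unfolding cgenideal_def by blast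

lemma PIdl_image: "PIdl a = (\<lambda>r. r \<otimes> a) ` carrier R"
  unfolding cgenideal_def by blast

text \<open>A substitute for prime filtrations: if J is neither R nor prime, there are a and b
  outside J with a b in J, and then J + (a), J + (b) and the colon ideal of J by a are all strictly
  larger.\<close>

lemma noetherian_prime_induct [consumes 2, case_names top prime step]:
  assumes "noetherian_ring R" "ideal J R"
    and top: "\<Phi> (carrier R)"
    and prime: "\<And>P. primeideal P R \<Longrightarrow> (\<And>J'. ideal J' R \<Longrightarrow> P \<subset> J' \<Longrightarrow> \<Phi> J') \<Longrightarrow> \<Phi> P"
    and step: "\<And>J a b. ideal J R \<Longrightarrow> a \<in> carrier R \<Longrightarrow> b \<in> carrier R \<Longrightarrow> a \<notin> J \<Longrightarrow> b \<notin> J \<Longrightarrow> a \<otimes> b \<in> J \<Longrightarrow>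
      (\<And>J'. ideal J' R \<Longrightarrow> J \<subset> J' \<Longrightarrow> \<Phi> J') \<Longrightarrow> \<Phi> J"
  shows "\<Phi> J"
  using assms(1,2)
proof (rule noetherian_ring.noetherian_induct)
  fix J assume J: "ideal J R" and IH: "\<And>J'. ideal J' R \<Longrightarrow> J \<subset> J' \<Longrightarrow> \<Phi> J'"
  show "\<Phi> J"
  proof (cases "J = carrier R \<or> primeideal J R")
    case True
    then show ?thesis using top prime IH by blast
  next
    case False
    then obtain a b where "a \<in> carrier R" "b \<in> carrier R" "a \<notin> J" "b \<notin> J" "a \<otimes> b \<in> J"
      using primeidealI[OF J cring_axioms] by blast
    then show ?thesis using step[OF J] IH by blast
  qed
qed

lemma psubset_add_PIdl:
  assumes "ideal J R" "a \<in> carrier R" "a \<notin> J"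
  shows "ideal (J <+> PIdl a) R" "J \<subset> J <+> PIdl a" "a \<in> J <+> PIdl a"
  using ideal_add_mem[OF assms(1) cgenideal_ideal[OF assms(2)]] cgenideal_self[OF assms(2)] assms(3)
  by auto

lemma psubset_colon:
  assumes "ideal J R" "a \<in> carrier R" "b \<in> carrier R" "b \<notin> J" "a \<otimes> b \<in> J"
  shows "J \<subset> colon R J a"
proof -
  have "b \<in> colon R J a" using assms by (simp add: colon_def m_comm)
  then show ?thesis using colon_superset[OF assms(1,2)] assms(4) by blast
qed

lemma ideal_add_zero: "ideal J R \<Longrightarrow> J <+> {\<zero>} = J"
  using ideal.Icarr[of J R] by (simp add: set_add_def')

section \<open>Colength over a localization\<close>

abbreviation colength where
  "colength Q J \<equiv> local_length R (regular_module R) Q J (carrier R)"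

context
  fixes Q assumes Q: "primeideal Q R"
begin

interpretation V: prime_module R "regular_module R" Q
  using module_regular cring_axioms Q by (simp add: prime_module_def)

lemma colength_antimono:
  assumes "ideal I R" "ideal J R" "I \<subseteq> J" shows "colength Q J \<le> colength Q I"
proof -
  note c = ideal.submodule_regular[OF oneideal]
  have "J \<subseteq> carrier R" using ideal.Icarr[OF assms(2)] by blast
  then show ?thesis using V.local_length_mono[OF c c assms(3) _ subset_refl] by simp
qed

lemma colength_eq_0:
  assumes "ideal J R" "s \<in> J" "s \<notin> Q" shows "colength Q J = 0"
proof (rule V.local_length_eq_0)
  show "J \<subseteq> carrier R" using ideal.Icarr[OF assms(1)] by blast
  have "s \<otimes> x \<in> J" if "x \<in> carrier R" for x using ideal.I_r_closed[OF assms(1,2) that] .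
  then show "local_le R (regular_module R) Q (carrier R) J"
    unfolding local_le_def using assms(3) ideal.Icarr[OF assms(1,2)] by auto
qed (rule ideal.submodule_regular[OF assms(1)] ideal.submodule_regular[OF oneideal])+

lemma colength_ge_1:
  assumes J: "ideal J R" and JQ: "J \<subseteq> Q" shows "1 \<le> colength Q J"
  using colength_antimono[OF J primeideal.axioms(1)[OF Q] JQ] local_length_prime[OF Q] by simp

lemma colength_additive:
  assumes A: "ideal A R" and B: "ideal B R" and AB: "A \<subseteq> B"
  shows "colength Q A = local_length R (regular_module R) Q A B + colength Q B"
proof -
  have "B \<subseteq> carrier R" using ideal.Icarr[OF B] by blast
  then show ?thesis
    using V.local_length_additive[OF ideal.submodule_regular[OF B] ideal.submodule_regular[OF oneideal] AB]
    by simp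
qed

lemma length_mult_le:
  assumes a: "a \<in> carrier R" and A: "ideal A R" and A': "ideal A' R" and B': "ideal B' R"
    and sub: "A' \<subseteq> B'" and AA: "\<And>r. r \<in> A \<Longrightarrow> r \<otimes> a \<in> A'" and BB: "B' \<subseteq> PIdl a <+> A'"
  shows "local_length R (regular_module R) Q A' B' \<le> colength Q A"
proof -
  interpret f: linear_map_pair R "regular_module R" "regular_module R" "\<lambda>r. r \<otimes> a"
    using V.linear_map_smult_elem[of a] a V.module_axioms
    by (simp add: linear_map_pair_def linear_map_pair_axioms_def)
  note sm = ideal.submodule_regular
  show ?thesis
  proof (rule f.local_length_le_of_surj[OF Q sm[OF oneideal] sm[OF A'] sm[OF B'] _ sub])
    show "A \<subseteq> carrier R" using ideal.Icarr[OF A] by blast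
    have "PIdl a <+> A' \<subseteq> carrier R"
      using ideal.Icarr[OF ideal_add_mem(1)[OF cgenideal_ideal[OF a] A']] by blast
    then show "local_le R (regular_module R) Q B'
        ((\<lambda>r. r \<otimes> a) ` carrier R <+>\<^bsub>regular_module R\<^esub> A')"
      using V.local_le_subset[OF BB] by (simp add: PIdl_image)
  qed (use AA in auto)
qed

lemma length_mult_ge:
  assumes a: "a \<in> carrier R" and A: "ideal A R" and A': "ideal A' R" and B': "ideal B' R"
    and sub: "A' \<subseteq> B'" and aB: "a \<in> B'" and inj: "\<And>r. r \<in> carrier R \<Longrightarrow> r \<otimes> a \<in> A' \<Longrightarrow> r \<in> A"
  shows "colength Q A \<le> local_length R (regular_module R) Q A' B'"
proof -
  interpret f: linear_map_pair R "regular_module R" "regular_module R" "\<lambda>r. r \<otimes> a"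
    using V.linear_map_smult_elem[of a] a V.module_axioms
    by (simp add: linear_map_pair_def linear_map_pair_axioms_def)
  note sm = ideal.submodule_regular
  have Ac: "A \<subseteq> carrier R" using ideal.Icarr[OF A] by blast
  show ?thesis
  proof (rule f.local_length_le_of_inj[OF Q sm[OF oneideal] sm[OF A'] sm[OF B'] Ac sub])
    show "(\<lambda>r. r \<otimes> a) ` carrier R \<subseteq> B'" using ideal.I_l_closed[OF B' aB] by blast
    show "local_le R (regular_module R) Q {x \<in> carrier R. x \<otimes> a \<in> A'} A"
      using inj Ac by (intro V.local_le_subset) auto
  qed
qed

text \<open>The exact sequence from R/(J : a) through R/J to R/(J + (a)), reduced modulo I. Only
  right exactness survives the reduction, whence an inequality.\<close>

lemma colength_devissage:
  assumes J: "ideal J R" and I: "ideal I R" and a: "a \<in> carrier R"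
  shows "colength Q (J <+> I)
    \<le> colength Q (colon R J a <+> I) + colength Q ((J <+> PIdl a) <+> I)"
proof -
  note K = ideal_colon[OF J a]
  note Pa = cgenideal_ideal[OF a]
  note Ja = ideal_add_mem[OF J Pa]
  note JI = ideal_add_mem[OF J I]
  note KI = ideal_add_mem[OF K I]
  note JaI = ideal_add_mem[OF Ja(1) I]
  have sub: "J <+> I \<subseteq> (J <+> PIdl a) <+> I"
    using ideal_add_least[OF JaI(1)] Ja(2) JaI(2,3) by blast
  have "r \<otimes> a \<in> J <+> I" if r: "r \<in> colon R J a <+> I" for r
  proof -
    obtain k i where ki: "k \<in> colon R J a" "i \<in> I" "r = k \<oplus> i" using r by (rule ideal_addE)
    have "k \<otimes> a \<in> J <+> I" using ki(1) JI(2) by (auto simp: colon_def)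
    moreover have "i \<otimes> a \<in> J <+> I" using ideal.I_r_closed[OF I ki(2) a] JI(3) by blast
    ultimately have "k \<otimes> a \<oplus> i \<otimes> a \<in> J <+> I"
      using additive_subgroup.a_closed[OF ideal.axioms(1)[OF JI(1)]] by blast
    then show ?thesis using ki ideal.Icarr[OF K] ideal.Icarr[OF I] a by (simp add: l_distr)
  qed
  moreover have "(J <+> PIdl a) <+> I \<subseteq> PIdl a <+> (J <+> I)"
    using ideal_add_mem[OF Pa JI(1)] JI
    by (intro ideal_add_least) (auto intro: ideal_add_least)
  ultimately have "local_length R (regular_module R) Q (J <+> I) ((J <+> PIdl a) <+> I)
    \<le> colength Q (colon R J a <+> I)"
    by (intro length_mult_le[OF a KI(1) JI(1) JaI(1) sub])
  then show ?thesis
    unfolding colength_additive[OF JI(1) JaI(1) sub] by (rule add_right_mono)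
qed

text \<open>The quotients of the filtration by the ideals J + (x^t) are generated by x^t and killed
  by J + (x).\<close>

lemma ideal_add_power_chain:
  assumes J: "ideal J R" and x: "x \<in> carrier R"
  shows "J <+> PIdl (x [^] Suc t) \<subseteq> J <+> PIdl (x [^] t)"
    and "J <+> PIdl (x [^] t) \<subseteq> PIdl (x [^] t) <+> (J <+> PIdl (x [^] Suc t))"
    and "r \<in> J <+> PIdl x \<Longrightarrow> r \<otimes> x [^] t \<in> J <+> PIdl (x [^] Suc t)"
proof -
  have xt: "x [^] t \<in> carrier R" "x [^] Suc t \<in> carrier R" using x by auto
  note P = cgenideal_ideal[OF xt(1)] cgenideal_ideal[OF xt(2)]
  note A = ideal_add_mem[OF J P(1)] and B = ideal_add_mem[OF J P(2)]
  have "x [^] Suc t = x \<otimes> x [^] t" using x by (simp add: m_comm)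
  then have "x [^] Suc t \<in> PIdl (x [^] t)" using PIdl_mem[OF xt(1) x] by simp
  then have "PIdl (x [^] Suc t) \<subseteq> PIdl (x [^] t)" using cgenideal_minimal[OF P(1)] by blast
  then show "J <+> PIdl (x [^] Suc t) \<subseteq> J <+> PIdl (x [^] t)"
    using ideal_add_least[OF A(1)] A by blast
  show "J <+> PIdl (x [^] t) \<subseteq> PIdl (x [^] t) <+> (J <+> PIdl (x [^] Suc t))"
    using ideal_add_least[OF ideal_add_mem(1)[OF P(1) B(1)]] ideal_add_mem(2,3)[OF P(1) B(1)] B by blast
  assume "r \<in> J <+> PIdl x"
  then obtain j b where jb: "j \<in> J" "b \<in> PIdl x" "r = j \<oplus> b" by (rule ideal_addE)
  obtain c where c: "c \<in> carrier R" "b = c \<otimes> x" using jb(2) unfolding cgenideal_def by blast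
  have jc: "j \<in> carrier R" using ideal.Icarr[OF J jb(1)] .
  have "r \<otimes> x [^] t = j \<otimes> x [^] t \<oplus> c \<otimes> x [^] Suc t"
  proof -
    have "(c \<otimes> x) \<otimes> x [^] t = c \<otimes> x [^] Suc t" using c x by (simp add: m_ac)
    then show ?thesis using jb c jc x by (simp add: l_distr)
  qed
  moreover have "j \<otimes> x [^] t \<in> J" using ideal.I_r_closed[OF J jb(1) xt(1)] .
  ultimately show "r \<otimes> x [^] t \<in> J <+> PIdl (x [^] Suc t)"
    using PIdl_mem[OF xt(2) c(1)] by (auto simp: set_add_def')
qed

lemma ideal_add_PIdl_one: "ideal J R \<Longrightarrow> x \<in> carrier R \<Longrightarrow> J <+> PIdl (x [^] (0::nat)) = carrier R"
  using ideal_add_mem(1,3)[of J "PIdl \<one>"] cgenideal_ideal[of \<one>] cgenideal_self[of \<one>]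
    ideal.one_imp_carrier by auto

lemma colength_power_le:
  assumes J: "ideal J R" and x: "x \<in> carrier R"
  shows "colength Q (J <+> PIdl (x [^] t)) \<le> of_nat t * colength Q (J <+> PIdl x)"
proof (induction t)
  case 0
  have "\<one> \<notin> Q" using V.complement_one by blast
  then show ?case using colength_eq_0[OF oneideal one_closed] ideal_add_PIdl_one[OF J x] by simp
next
  case (Suc t)
  have xt: "x [^] t \<in> carrier R" "x [^] Suc t \<in> carrier R" using x by auto
  note P = cgenideal_ideal[OF x] cgenideal_ideal[OF xt(1)] cgenideal_ideal[OF xt(2)]
  note A = ideal_add_mem(1)[OF J P(1)] ideal_add_mem(1)[OF J P(2)] ideal_add_mem(1)[OF J P(3)]
  note c = ideal_add_power_chain[OF J x]
  have "local_length R (regular_module R) Q (J <+> PIdl (x [^] Suc t)) (J <+> PIdl (x [^] t))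
    \<le> colength Q (J <+> PIdl x)"
    using length_mult_le[OF xt(1) A(1) A(3) A(2) c(1) c(3) c(2)] .
  from add_mono[OF this Suc] show ?case
    unfolding colength_additive[OF A(3) A(2) c(1)] by (simp add: distrib_right)
qed

text \<open>Here the quotients of the filtration are full copies of R/(P + (x)): modulo the prime P
  the factor x^t can be cancelled.\<close>

lemma colength_power_eq:
  assumes P: "primeideal P R" and x: "x \<in> carrier R" "x \<notin> P"
  shows "colength Q (P <+> PIdl (x [^] t)) = of_nat t * colength Q (P <+> PIdl x)"
proof (induction t)
  case 0
  have "\<one> \<notin> Q" using V.complement_one by blast
  then show ?case
    using colength_eq_0[OF oneideal one_closed] ideal_add_PIdl_one[OF primeideal.axioms(1)[OF P] x(1)] by simp
next
  case (Suc t)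
  note J = primeideal.axioms(1)[OF P]
  interpret P: prime_module R "regular_module R" P
    using module_regular cring_axioms P by (simp add: prime_module_def)
  have xP: "x [^] n \<notin> P" for n :: nat
  proof (induction n)
    case 0 then show ?case using P.complement_one by simp
  next
    case (Suc n) then show ?case using P.I_prime[of "x [^] n" x] x by auto
  qed
  have xt: "x [^] t \<in> carrier R" "x [^] Suc t \<in> carrier R" using x by auto
  note Pi = cgenideal_ideal[OF x(1)] cgenideal_ideal[OF xt(1)] cgenideal_ideal[OF xt(2)]
  note A = ideal_add_mem(1)[OF J Pi(1)] ideal_add_mem(1)[OF J Pi(2)] ideal_add_mem(1)[OF J Pi(3)]
  note c = ideal_add_power_chain[OF J x(1)]
  have le: "local_length R (regular_module R) Q (P <+> PIdl (x [^] Suc t)) (P <+> PIdl (x [^] t))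
    \<le> colength Q (P <+> PIdl x)"
    using length_mult_le[OF xt(1) A(1) A(3) A(2) c(1) c(3) c(2)] .
  have "r \<in> P <+> PIdl x"
    if r: "r \<in> carrier R" "r \<otimes> x [^] t \<in> P <+> PIdl (x [^] Suc t)" for r
  proof -
    obtain a b where ab: "a \<in> P" "b \<in> PIdl (x [^] Suc t)" "r \<otimes> x [^] t = a \<oplus> b"
      using r(2) by (rule ideal_addE)
    obtain k where k: "k \<in> carrier R" "b = k \<otimes> x [^] Suc t" using ab(2) unfolding cgenideal_def by blast
    have ac: "a \<in> carrier R" using P.Icarr ab by blast
    have bk: "b = (k \<otimes> x) \<otimes> x [^] t" using k x by (simp add: m_ac)
    have "(r \<ominus> k \<otimes> x) \<otimes> x [^] t = r \<otimes> x [^] t \<ominus> b"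
      using r k x by (simp add: bk a_minus_def l_distr l_minus)
    also have "\<dots> = a" unfolding ab(3) using ac k x by (simp add: a_minus_def a_assoc r_neg)
    finally have "r \<ominus> k \<otimes> x \<in> P"
      using P.I_prime[of "r \<ominus> k \<otimes> x" "x [^] t"] ab(1) r k x xP by auto
    moreover have "k \<otimes> x \<in> PIdl x" using PIdl_mem[OF x(1) k(1)] .
    moreover have "r = (r \<ominus> k \<otimes> x) \<oplus> k \<otimes> x" using r k x by (simp add: a_minus_def a_assoc l_neg)
    ultimately show ?thesis by (metis V.set_addI set_add_module_via module_via_simps(3))
  qed
  moreover have "x [^] t \<in> P <+> PIdl (x [^] t)"
    using ideal_add_mem(3)[OF J Pi(2)] cgenideal_self[OF xt(1)] by blast
  ultimately have "colength Q (P <+> PIdl x)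
    \<le> local_length R (regular_module R) Q (P <+> PIdl (x [^] Suc t)) (P <+> PIdl (x [^] t))"
    using length_mult_ge[OF xt(1) A(1) A(3) A(2) c(1)] by blast
  with le have "local_length R (regular_module R) Q (P <+> PIdl (x [^] Suc t)) (P <+> PIdl (x [^] t))
    = colength Q (P <+> PIdl x)" by (rule order_antisym)
  then show ?case
    unfolding colength_additive[OF A(3) A(2) c(1)] Suc by (simp add: distrib_right)
qed

text \<open>The localization of R/J has no prime other than Q. So a prime met in the induction is Q
  itself, of colength 1, or is not contained in Q, of colength 0; all other ideals follow by
  devissage.\<close>

lemma colength_finite:
  assumes "noetherian_ring R" "ideal J R"
  shows "(\<And>P. primeideal P R \<Longrightarrow> J \<subseteq> P \<Longrightarrow> P \<subseteq> Q \<Longrightarrow> P = Q) \<Longrightarrow> colength Q J \<noteq> \<infinity>"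
  using assms
proof (induction J rule: noetherian_prime_induct)
  case top
  have "\<one> \<notin> Q" using V.complement_one by blast
  then show ?case using colength_eq_0[OF oneideal one_closed] by simp
next
  case (prime P)
  show ?case
  proof (cases "P \<subseteq> Q")
    case True
    then have "P = Q" using prime by blast
    then show ?thesis using local_length_prime[OF Q] by simp
  next
    case False
    then obtain s where "s \<in> P" "s \<notin> Q" by blast
    then show ?thesis using colength_eq_0[OF primeideal.axioms(1)[OF prime(1)]] by simp
  qed
next
  case (step J a b)
  note K = ideal_colon[OF step(1,2)] and KJ = psubset_colon[OF step(1-3,5,6)]
  note A = psubset_add_PIdl[OF step(1,2,4)]
  have "colength Q (colon R J a) \<noteq> \<infinity>"
  proof (rule step(7)[OF K KJ])
    show "P = Q" if "primeideal P R" "colon R J a \<subseteq> P" "P \<subseteq> Q" for P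
      using step(8)[OF that(1) _ that(3)] that(2) KJ by blast
  qed
  moreover have "colength Q (J <+> PIdl a) \<noteq> \<infinity>"
  proof (rule step(7)[OF A(1,2)])
    show "P = Q" if "primeideal P R" "J <+> PIdl a \<subseteq> P" "P \<subseteq> Q" for P
      using step(8)[OF that(1) _ that(3)] that(2) A(2) by blast
  qed
  moreover have "colength Q J \<le> colength Q (colon R J a) + colength Q (J <+> PIdl a)"
    using colength_devissage[OF step(1) zeroideal step(2)]
    unfolding ideal_add_zero[OF K] ideal_add_zero[OF A(1)] ideal_add_zero[OF step(1)] .
  ultimately show ?case
    by (cases "colength Q (colon R J a)"; cases "colength Q (J <+> PIdl a)")
      (auto dest!: enat_ile)
qed

end
end

context prime_char_ring
begin

text \<open>The comparison with a free module for M = F_* R and K = P, where I acts through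
  I^[p].\<close>

lemma frobenius_compare_free:
  assumes P: "primeideal P R" and gs: "generates R frobenius_module gs"
  obtains n s where "s \<in> carrier R" "s \<notin> P" "of_nat n = frobenius_rank P"
    "\<And>Q I. primeideal Q R \<Longrightarrow> ideal I R \<Longrightarrow>
      local_length R frobenius_module Q (P <+> frob_power R p I) (carrier R)
        \<le> of_nat n * colength Q (P <+> I)
          + of_nat (length gs) * colength Q ((P <+> PIdl s) <+> I)"
    "\<And>Q I. primeideal Q R \<Longrightarrow> ideal I R \<Longrightarrow>
      of_nat n * colength Q (P <+> I)
        \<le> local_length R frobenius_module Q (P <+> frob_power R p I) (carrier R)
          + of_nat (length gs) * colength Q ((P <+> PIdl s) <+> I)"
proof -
  note Pi = primeideal.axioms(1)[OF P]
  interpret F: module R frobenius_module by (rule module_frobenius)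
  have PK: "j \<odot>\<^bsub>frobenius_module\<^esub> y \<in> P" if "j \<in> P" "y \<in> carrier frobenius_module" for j y
    using frobenius_smult_mem[OF Pi that(1)] that(2) by simp
  show ?thesis
  proof (rule F.length_compare_free[OF P submodule_frobenius[OF Pi] PK gs], assumption, assumption, goal_cases)
    case (1 n s)
    show ?thesis
    proof (rule that[of s n])
      show "s \<in> carrier R" "s \<notin> P" "of_nat n = frobenius_rank P" using 1(2,3) by auto
    qed (use 1(4,5) ideal_span_frobenius[OF Pi] in simp_all)
  qed
qed

text \<open>
  Both sides count the local length at \<open>Q\<close> of $F_*(R/(P + x^t))$ for some \<open>x\<close> in \<open>Q\<close> but not in \<open>P\<close>: it is
  $t$ times a constant times \<open>frobenius_rank P\<close> up to a bounded error, and exactly $p t$ times the same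
  constant times \<open>frobenius_rank Q\<close>.
\<close>

lemma frobenius_rank_step:
  assumes noeth: "noetherian_ring R" and gs: "generates R frobenius_module gs"
    and P: "primeideal P R" and Q: "primeideal Q R" and PQ: "P \<subset> Q"
    and consec: "\<And>P'. primeideal P' R \<Longrightarrow> P \<subset> P' \<Longrightarrow> P' \<subseteq> Q \<Longrightarrow> P' = Q"
  shows "frobenius_rank P = of_nat p * frobenius_rank Q"
proof -
  note Pi = primeideal.axioms(1)[OF P]
  obtain x where x: "x \<in> Q" "x \<notin> P" using PQ by blast
  have xc: "x \<in> carrier R" using x ideal.Icarr[OF primeideal.axioms(1)[OF Q]] by blast
  define A where "A t = P <+> PIdl (x [^] t)" for t :: nat
  have A: "ideal (A t) R" for t
    unfolding A_def using ideal_add_mem(1)[OF Pi cgenideal_ideal] xc by simp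
  \<comment> \<open>A prime inside Q that contains an ideal strictly above P is Q, so such ideals
    have finite colength over Q.\<close>
  have fin: "colength Q J \<noteq> \<infinity>" if "ideal J R" "P \<subset> J" for J
    using colength_finite[OF Q noeth that(1)] consec that(2) by blast
  obtain l where l: "colength Q (P <+> PIdl x) = enat l"
    using fin[OF psubset_add_PIdl(1,2)[OF Pi xc x(2)]] by blast
  have "P <+> PIdl x \<subseteq> Q"
    using ideal_add_least[OF primeideal.axioms(1)[OF Q]] PQ cgenideal_minimal[OF primeideal.axioms(1)[OF Q] x(1)]
    by blast
  then have l1: "1 \<le> l"
    using colength_ge_1[OF Q psubset_add_PIdl(1)[OF Pi xc x(2)]] l by (simp add: one_enat_def)
  have lA: "colength Q (A t) = enat (t * l)" for t
    unfolding A_def colength_power_eq[OF Q P xc x(2)] l by (simp add: of_nat_eq_enat)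
  obtain r where r: "frobenius_rank Q = enat r" using frobenius_rank_finite[OF Q gs] by blast
  have Ac: "A t \<subseteq> carrier R" for t using ideal.Icarr[OF A] by blast
  have lF: "local_length R frobenius_module Q (A t) (carrier R) = enat (t * l * r)" for t
    using frobenius_length[OF Q A oneideal Ac lA] r by (simp add: of_nat_eq_enat)
  obtain n s where sc: "s \<in> carrier R" "s \<notin> P"
    and n: "of_nat n = frobenius_rank P"
    and up: "\<And>Q I. primeideal Q R \<Longrightarrow> ideal I R \<Longrightarrow>
      local_length R frobenius_module Q (P <+> frob_power R p I) (carrier R)
        \<le> of_nat n * colength Q (P <+> I)
          + of_nat (length gs) * colength Q ((P <+> PIdl s) <+> I)"
    and lo: "\<And>Q I. primeideal Q R \<Longrightarrow> ideal I R \<Longrightarrow>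
      of_nat n * colength Q (P <+> I)
        \<le> local_length R frobenius_module Q (P <+> frob_power R p I) (carrier R)
          + of_nat (length gs) * colength Q ((P <+> PIdl s) <+> I)"
    using frobenius_compare_free[OF P gs] by metis
  note W = psubset_add_PIdl[OF Pi sc]
  obtain w where w: "colength Q (P <+> PIdl s) = enat w" using fin[OF W(1,2)] by blast
  \<comment> \<open>Reducing F_*(R/P) modulo x^t gives F_*(R/(P + (x^(p t)))), so the exponent is
    multiplied by p; this is the origin of the factor p.\<close>
  have span: "P <+> frob_power R p (PIdl (x [^] t)) = A (p * t)" for t :: nat
  proof -
    have xt: "x [^] t \<in> carrier R" using xc by simp
    note I = cgenideal_ideal[OF xt]
    have Ic: "PIdl (x [^] t) \<subseteq> carrier R" using ideal.Icarr[OF I] by blast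
    have e: "(x [^] t) [^] p = x [^] (p * t)" using xc by (simp add: nat_pow_pow mult.commute)
    have xpt: "x [^] (p * t) \<in> carrier R" using xc by simp
    have "frob_power R p (PIdl (x [^] t)) = PIdl (x [^] (p * t))"
    proof
      show "frob_power R p (PIdl (x [^] t)) \<subseteq> PIdl (x [^] (p * t))"
      proof (rule frob_power_least[OF cgenideal_ideal[OF xpt]])
        fix y assume "y \<in> PIdl (x [^] t)"
        then obtain c where c: "c \<in> carrier R" "y = c \<otimes> x [^] t" unfolding cgenideal_def by blast
        then have "y [^] p = c [^] p \<otimes> x [^] (p * t)" using xt e by (simp add: nat_pow_distrib)
        then show "y [^] p \<in> PIdl (x [^] (p * t))" using PIdl_mem[OF xpt, of "c [^] p"] c by simp
      qed
      show "PIdl (x [^] (p * t)) \<subseteq> frob_power R p (PIdl (x [^] t))"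
        using cgenideal_minimal[OF ideal_frob_power[OF Ic]]
          frob_power_mem[OF Ic cgenideal_self[OF xt], of p] e by simp
    qed
    then show ?thesis unfolding A_def by simp
  qed
  define c where "c = length gs * w"
  \<comment> \<open>The error involves R/(P + (s) + (x^t)), which is a quotient of R/(P + (s));
    hence c does not depend on t.\<close>
  have ineq: "p * t * l * r \<le> n * (t * l) + c" "n * (t * l) \<le> p * t * l * r + c" for t
  proof -
    have xt: "x [^] t \<in> carrier R" using xc by simp
    note I = cgenideal_ideal[OF xt]
    have "colength Q ((P <+> PIdl s) <+> PIdl (x [^] t)) \<le> enat w"
      using colength_antimono[OF Q W(1) ideal_add_mem(1)[OF W(1) I] ideal_add_mem(2)[OF W(1) I]] w by simp
    then have "of_nat (length gs) * colength Q ((P <+> PIdl s) <+> PIdl (x [^] t)) \<le> enat c"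
      using mult_left_mono[of _ "enat w" "of_nat (length gs)"] by (simp add: c_def of_nat_eq_enat)
    from order_trans[OF up[OF Q I] add_left_mono[OF this]] order_trans[OF lo[OF Q I] add_left_mono[OF this]]
    show "p * t * l * r \<le> n * (t * l) + c" "n * (t * l) \<le> p * t * l * r + c"
      unfolding span lF lA[unfolded A_def] by (simp_all add: of_nat_eq_enat)
  qed
  \<comment> \<open>For t = c + 1 the two main terms are n z and p r z with z > c, so they cannot be
    within c of each other unless n = p r.\<close>
  define z where "z = (c + 1) * l"
  have "(c + 1) * 1 \<le> (c + 1) * l" using l1 by (rule mult_left_mono) simp
  then have cz: "c < z" by (simp add: z_def)
  have z: "p * r * z \<le> n * z + c" "n * z \<le> p * r * z + c"
    using ineq[of "c + 1"] unfolding z_def by (simp_all only: mult_ac)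
  have "n = p * r"
  proof (rule ccontr)
    assume "n \<noteq> p * r"
    then consider "n + 1 \<le> p * r" | "p * r + 1 \<le> n" by linarith
    then show False
    proof cases
      case 1
      have "(n + 1) * z \<le> p * r * z" using 1 by (rule mult_right_mono) simp
      then show False using z(1) cz by simp
    next
      case 2
      have "(p * r + 1) * z \<le> n * z" using 2 by (rule mult_right_mono) simp
      then show False using z(2) cz by simp
    qed
  qed
  then show ?thesis using n r by (simp add: of_nat_eq_enat)
qed

end

section \<open>Dimension and growth\<close>

definition prime_chain :: "('a, 'b) ring_scheme \<Rightarrow> 'a set \<Rightarrow> nat \<Rightarrow> (nat \<Rightarrow> 'a set) \<Rightarrow> bool" where
  "prime_chain R J n P \<longleftrightarrow> (\<forall>i\<le>n. primeideal (P i) R \<and> J \<subseteq> P i) \<and> (\<forall>i<n. P i \<subset> P (Suc i))"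

text \<open>The Krull dimension of $R/J$ is less than \<open>j\<close>; for \<open>j = 0\<close> this means that the quotient is zero.\<close>

definition dim_less :: "('a, 'b) ring_scheme \<Rightarrow> 'a set \<Rightarrow> nat \<Rightarrow> bool" where
  "dim_less R J j \<longleftrightarrow> (\<forall>n P. prime_chain R J n P \<longrightarrow> n < j)"

lemma dim_less_mono: "dim_less R J j \<Longrightarrow> J \<subseteq> J' \<Longrightarrow> dim_less R J' j"
  unfolding dim_less_def prime_chain_def by (meson order_trans)

lemma prime_chain_0: "primeideal P R \<Longrightarrow> J \<subseteq> P \<Longrightarrow> prime_chain R J 0 (\<lambda>_. P)"
  unfolding prime_chain_def by simp

lemma prime_chain_prepend:
  assumes P: "primeideal P R" "J \<subseteq> P" and c: "prime_chain R J' n Ps" and lt: "P \<subset> Ps 0"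
  shows "prime_chain R J (Suc n) (case_nat P Ps)"
proof -
  have sub: "P \<subseteq> Ps i" if "i \<le> n" for i
    using that
  proof (induction i)
    case 0
    then show ?case using lt by blast
  next
    case (Suc i)
    have "Ps i \<subset> Ps (Suc i)" using c Suc.prems unfolding prime_chain_def by simp
    then show ?case using Suc by auto
  qed
  show ?thesis
    unfolding prime_chain_def
  proof (intro conjI allI impI)
    fix i assume i: "i \<le> Suc n"
    show "primeideal (case_nat P Ps i) R"
      using P c i unfolding prime_chain_def by (cases i) auto
    show "J \<subseteq> case_nat P Ps i"
      using P(2) sub i by (cases i) auto
  next
    fix i assume i: "i < Suc n"
    show "case_nat P Ps i \<subset> case_nat P Ps (Suc i)"
    proof (cases i)
      case 0 then show ?thesis using lt by simp
    next
      case (Suc k)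
      then show ?thesis using c i unfolding prime_chain_def by simp
    qed
  qed
qed

text \<open>A chain of primes above J' can be prolonged by P at the bottom.\<close>

lemma dim_less_psubset:
  assumes "dim_less R J (Suc j)" "primeideal P R" "J \<subseteq> P" "P \<subset> J'"
  shows "dim_less R J' j"
  unfolding dim_less_def
proof (intro allI impI)
  fix n Ps assume c: "prime_chain R J' n Ps"
  have "P \<subset> Ps 0" using c assms(4) unfolding prime_chain_def by blast
  from prime_chain_prepend[OF assms(2,3) c this] show "n < j"
    using assms(1) unfolding dim_less_def by blast
qed

section \<open>Growth of colengths and ranks over the local ring\<close>

locale F_finite_local_ring = prime_char_ring +
  fixes \<mm> gs
  assumes noeth: "noetherian_ring R" and loc: "local_ring R \<mm>"
    and gs: "generates R frobenius_module gs"
begin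

lemma max: "maximalideal \<mm> R"
  using loc by (simp add: local_ring_def)

lemma prime_max: "primeideal \<mm> R"
  using maximalideal_prime max by blast

lemma ideal_max: "ideal \<mm> R"
  using prime_max primeideal.axioms(1) by blast

lemma max_carrier: "\<mm> \<subseteq> carrier R"
  using ideal.Icarr[OF ideal_max] by blast

text \<open>\<open>local_ring\<close> says that \<mm> is the only maximal ideal; Noetherian
  induction provides a maximal ideal above a given proper one.\<close>

lemma proper_ideal_subset_max:
  assumes "ideal J R" shows "J \<noteq> carrier R \<longrightarrow> J \<subseteq> \<mm>"
  using noeth assms
proof (rule noetherian_ring.noetherian_induct)
  fix J assume J: "ideal J R" and IH: "\<And>J'. ideal J' R \<Longrightarrow> J \<subset> J' \<Longrightarrow> J' \<noteq> carrier R \<longrightarrow> J' \<subseteq> \<mm>"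
  show "J \<noteq> carrier R \<longrightarrow> J \<subseteq> \<mm>"
  proof
    assume n: "J \<noteq> carrier R"
    show "J \<subseteq> \<mm>"
    proof (cases "maximalideal J R")
      case True
      then show ?thesis using loc by (simp add: local_ring_def local_ring_axioms_def)
    next
      case False
      then obtain J' where "ideal J' R" "J \<subseteq> J'" "J' \<subseteq> carrier R" "J' \<noteq> J" "J' \<noteq> carrier R"
        using maximalidealI[OF J] n by blast
      then show ?thesis using IH[of J'] by blast
    qed
  qed
qed

lemma prime_subset_max: "primeideal P R \<Longrightarrow> P \<subseteq> \<mm>"
  using proper_ideal_subset_max primeideal.axioms(1) primeideal.I_notcarr by metis

lemma complement_max_unit:
  assumes "s \<in> carrier R - \<mm>" obtains t where "t \<in> carrier R" "t \<otimes> s = \<one>"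
proof -
  have s: "s \<in> carrier R" "s \<notin> \<mm>" using assms by auto
  have "PIdl s = carrier R"
    using proper_ideal_subset_max[OF cgenideal_ideal[OF s(1)]] cgenideal_self[OF s(1)] s(2) by blast
  then obtain t where "t \<in> carrier R" "\<one> = t \<otimes> s" using one_closed unfolding cgenideal_def by blast
  then show ?thesis using that by simp
qed

abbreviation mpow where "mpow e \<equiv> frob_power R (p ^ e) \<mm>"

lemma ideal_mpow: "ideal (mpow e) R"
  using ideal_frob_power[OF max_carrier] .

text \<open>For a prime P other than \<mm>, an x in \<mm> outside P and q = p^e, the power x^q lies
  in \<mm>^[q]. So R/(P + \<mm>^[q]) has a filtration by q quotients of R/(P + (x) + \<mm>^[q]), and
  the dimension has dropped. Other ideals are reduced to primes by devissage. The factor q on the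
  left lets the induction start at j = 0, where R/J vanishes.\<close>

lemma colength_growth:
  "ideal J R \<Longrightarrow> dim_less R J j \<Longrightarrow>
    \<exists>C. \<forall>e. colength \<mm> (J <+> mpow e) * of_nat (p ^ e) \<le> of_nat (C * p ^ (e * j))"
proof (induction j arbitrary: J)
  case 0
  have "\<not> primeideal P R" if "J \<subseteq> P" for P
    using 0(2) prime_chain_0[of P R J] that unfolding dim_less_def by blast
  then have "J = carrier R"
    using proper_ideal_subset_max[OF 0(1)] prime_max by blast
  then have "\<one> \<in> J <+> mpow e" for e using ideal_add_mem(2)[OF 0(1) ideal_mpow] by blast
  moreover have "\<one> \<notin> \<mm>" using ideal.one_imp_carrier[OF ideal_max] primeideal.I_notcarr[OF prime_max] by blast
  ultimately have "colength \<mm> (J <+> mpow e) = 0" for e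
    using colength_eq_0[OF prime_max ideal_add_mem(1)[OF 0(1) ideal_mpow]] by blast
  then show ?case by (simp add: of_nat_eq_enat)
next
  case (Suc j)
  have "dim_less R J (Suc j) \<longrightarrow> (\<exists>C. \<forall>e. colength \<mm> (J <+> mpow e) * of_nat (p ^ e) \<le> of_nat (C * p ^ (e * Suc j)))"
    using noeth Suc.prems(1)
  proof (induction J rule: noetherian_prime_induct)
    case top
    have "\<one> \<in> carrier R <+> mpow e" for e using ideal_add_mem(2)[OF oneideal ideal_mpow] by blast
    moreover have "\<one> \<notin> \<mm>" using ideal.one_imp_carrier[OF ideal_max] primeideal.I_notcarr[OF prime_max] by blast
    ultimately have "colength \<mm> (carrier R <+> mpow e) = 0" for e
      using colength_eq_0[OF prime_max ideal_add_mem(1)[OF oneideal ideal_mpow]] by blast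
    then show ?case by (simp add: of_nat_eq_enat)
  next
    case (prime P)
    note Pi = primeideal.axioms(1)[OF prime(1)]
    show ?case
    proof (intro impI)
      assume dim: "dim_less R P (Suc j)"
      show "\<exists>C. \<forall>e. colength \<mm> (P <+> mpow e) * of_nat (p ^ e) \<le> of_nat (C * p ^ (e * Suc j))"
      proof (cases "P = \<mm>")
        case True
        have "colength \<mm> (\<mm> <+> mpow e) * of_nat (p ^ e) \<le> of_nat (1 * p ^ (e * Suc j))" for e
        proof -
          have "colength \<mm> (\<mm> <+> mpow e) \<le> 1"
            using colength_antimono[OF prime_max ideal_max ideal_add_mem(1,2)[OF ideal_max ideal_mpow]]
              local_length_prime[OF prime_max] by simp
          then have "colength \<mm> (\<mm> <+> mpow e) * of_nat (p ^ e) \<le> 1 * of_nat (p ^ e)"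
            by (rule mult_right_mono) simp
          also have "\<dots> \<le> of_nat (1 * p ^ (e * Suc j))"
            using power_increasing[of e "e * Suc j" p] pos by (simp add: of_nat_eq_enat)
          finally show ?thesis .
        qed
        then show ?thesis using True by blast
      next
        case False
        then obtain x where x: "x \<in> \<mm>" "x \<notin> P" using prime_subset_max[OF prime(1)] by blast
        have xc: "x \<in> carrier R" using x max_carrier by blast
        note A = psubset_add_PIdl[OF Pi xc x(2)]
        obtain C where C: "\<And>e. colength \<mm> ((P <+> PIdl x) <+> mpow e) * of_nat (p ^ e)
            \<le> of_nat (C * p ^ (e * j))"
          using Suc.IH[OF A(1) dim_less_psubset[OF dim prime(1) subset_refl A(2)]] by blast
        have "colength \<mm> (P <+> mpow e) * of_nat (p ^ e) \<le> of_nat (C * p ^ (e * Suc j))" for e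
        proof -
          let ?q = "p ^ e" and ?L = "P <+> mpow e"
          have xq: "x [^] ?q \<in> carrier R" using xc by simp
          note L = ideal_add_mem[OF Pi ideal_mpow[of e]]
          note Lx = ideal_add_mem[OF L(1) cgenideal_ideal[OF xc]]
          note Ax = ideal_add_mem[OF A(1) ideal_mpow[of e]]
          have "P \<subseteq> ?L <+> PIdl x" "mpow e \<subseteq> ?L <+> PIdl x" using L Lx by auto
          then have sub: "(P <+> PIdl x) <+> mpow e \<subseteq> ?L <+> PIdl x"
            using ideal_add_least[OF Lx(1) ideal_add_least[OF Lx(1) _ Lx(3)]] by simp
          \<comment> \<open>Adding x^q changes nothing, so the bound for powers of x applies with
            exponent q.\<close>
          have "x [^] ?q \<in> ?L" using frob_power_mem[OF max_carrier x(1)] L(3) by blast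
          then have "?L <+> PIdl (x [^] ?q) \<subseteq> ?L"
            using ideal_add_least[OF L(1) subset_refl cgenideal_minimal[OF L(1)]] by blast
          then have "colength \<mm> ?L \<le> colength \<mm> (?L <+> PIdl (x [^] ?q))"
            by (rule colength_antimono[OF prime_max ideal_add_mem(1)[OF L(1) cgenideal_ideal[OF xq]] L(1)])
          also have "\<dots> \<le> of_nat ?q * colength \<mm> (?L <+> PIdl x)"
            by (rule colength_power_le[OF prime_max L(1) xc])
          also have "of_nat ?q * colength \<mm> (?L <+> PIdl x)
              \<le> of_nat ?q * colength \<mm> ((P <+> PIdl x) <+> mpow e)"
            using colength_antimono[OF prime_max Ax(1) Lx(1) sub] by (rule mult_left_mono) simp
          finally have "colength \<mm> ?L * of_nat ?q
              \<le> of_nat ?q * colength \<mm> ((P <+> PIdl x) <+> mpow e) * of_nat ?q"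
            by (rule mult_right_mono) simp
          also have "\<dots> = of_nat ?q * (colength \<mm> ((P <+> PIdl x) <+> mpow e) * of_nat ?q)"
            by (rule mult.assoc)
          also have "\<dots> \<le> of_nat ?q * of_nat (C * p ^ (e * j))" using C by (intro mult_left_mono) auto
          also have "\<dots> = of_nat (C * p ^ (e * Suc j))" by (simp add: of_nat_eq_enat power_add mult_ac)
          finally show ?thesis .
        qed
        then show ?thesis by blast
      qed
    qed
  next
    case (step J a b)
    note K = ideal_colon[OF step(1,2)] and KJ = psubset_colon[OF step(1-3,5,6)]
    note A = psubset_add_PIdl[OF step(1,2,4)]
    show ?case
    proof (intro impI)
      assume dim: "dim_less R J (Suc j)"
      have "dim_less R (colon R J a) (Suc j)" "dim_less R (J <+> PIdl a) (Suc j)"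
        using dim_less_mono[OF dim] KJ A(2) by blast+
      then obtain C1 C2 where C:
        "\<And>e. colength \<mm> (colon R J a <+> mpow e) * of_nat (p ^ e) \<le> of_nat (C1 * p ^ (e * Suc j))"
        "\<And>e. colength \<mm> ((J <+> PIdl a) <+> mpow e) * of_nat (p ^ e) \<le> of_nat (C2 * p ^ (e * Suc j))"
        using step(7)[OF K KJ] step(7)[OF A(1,2)] by blast
      have "colength \<mm> (J <+> mpow e) * of_nat (p ^ e) \<le> of_nat ((C1 + C2) * p ^ (e * Suc j))" for e
      proof -
        have "colength \<mm> (J <+> mpow e) * of_nat (p ^ e)
          \<le> (colength \<mm> (colon R J a <+> mpow e)
              + colength \<mm> ((J <+> PIdl a) <+> mpow e)) * of_nat (p ^ e)"
          using colength_devissage[OF prime_max step(1) ideal_mpow step(2)] by (rule mult_right_mono) simp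
        also have "\<dots> \<le> of_nat (C1 * p ^ (e * Suc j)) + of_nat (C2 * p ^ (e * Suc j))"
          unfolding distrib_right using C by (intro add_mono)
        finally show ?thesis by (simp add: of_nat_eq_enat distrib_right)
      qed
      then show "\<exists>C. \<forall>e. colength \<mm> (J <+> mpow e) * of_nat (p ^ e) \<le> of_nat (C * p ^ (e * Suc j))"
        by blast
    qed
  qed
  then show ?case using Suc.prems(2) by blast
qed

text \<open>As dim R/P is at most d, a chain of length d above P starts at P, has no gaps and ends
  at \<mm>: otherwise it could be lengthened. So \<open>frobenius_rank_step\<close> applies to each
  pair of neighbours.\<close>

lemma frobenius_rank_chain:
  "primeideal P R \<Longrightarrow> prime_chain R P d Ps \<Longrightarrow> dim_less R P (Suc d) \<Longrightarrow>
    frobenius_rank P = of_nat (p ^ d) * frobenius_rank \<mm>"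
proof (induction d arbitrary: P Ps)
  case 0
  have "P = \<mm>"
  proof (rule ccontr)
    assume "P \<noteq> \<mm>"
    then have "P \<subset> \<mm>" using prime_subset_max[OF 0(1)] by blast
    from prime_chain_prepend[OF 0(1) subset_refl prime_chain_0[OF prime_max subset_refl] this]
    show False using 0(3) unfolding dim_less_def by blast
  qed
  then show ?case by simp
next
  case (Suc d)
  have P0: "primeideal (Ps 0) R" "P \<subseteq> Ps 0" using Suc.prems(2) unfolding prime_chain_def by auto
  have "P = Ps 0"
  proof (rule ccontr)
    assume "P \<noteq> Ps 0"
    then have "P \<subset> Ps 0" using P0 by blast
    from prime_chain_prepend[OF Suc.prems(1) subset_refl Suc.prems(2) this]
    show False using Suc.prems(3) unfolding dim_less_def by blast
  qed
  let ?Q = "Ps (Suc 0)" and ?Qs = "\<lambda>i. Ps (Suc i)"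
  have Q: "primeideal ?Q R" "P \<subset> ?Q"
    using Suc.prems(2) \<open>P = Ps 0\<close> unfolding prime_chain_def by auto
  have lt: "?Qs i \<subset> ?Qs (Suc i)" if "i < d" for i
    using Suc.prems(2) that unfolding prime_chain_def by simp
  have sub: "?Q \<subseteq> ?Qs i" if "i \<le> d" for i
    using that
  proof (induction i)
    case (Suc i)
    then show ?case using lt[of i] by auto
  qed simp
  have Qs: "prime_chain R ?Q d ?Qs"
    using Suc.prems(2) sub unfolding prime_chain_def by auto
  have dimQ: "dim_less R ?Q (Suc d)"
    using dim_less_psubset[OF Suc.prems(3,1) subset_refl Q(2)] .
  have "P' = ?Q" if P': "primeideal P' R" "P \<subset> P'" "P' \<subseteq> ?Q" for P'
  proof (rule ccontr)
    assume "P' \<noteq> ?Q"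
    then have "P' \<subset> ?Qs 0" using P' by blast
    from prime_chain_prepend[OF P'(1) subset_refl Qs this]
    have "prime_chain R P' (Suc d) (case_nat P' ?Qs)" .
    then show False
      using dim_less_psubset[OF Suc.prems(3,1) subset_refl P'(2)] unfolding dim_less_def by blast
  qed
  then have "frobenius_rank P = of_nat p * frobenius_rank ?Q"
    using frobenius_rank_step[OF noeth gs Suc.prems(1) Q] by blast
  also have "\<dots> = of_nat (p ^ Suc d) * frobenius_rank \<mm>"
    unfolding Suc.IH[OF Q(1) Qs dimQ] by (simp add: mult.assoc)
  finally show ?case .
qed

text \<open>If a b lies in J, the product of J + (a) and J + (b) lies in J. So the primes found for
  these two larger ideals together serve for J, with exponents added.\<close>

lemma exists_primes_radical:
  assumes "ideal J R"
  shows "\<exists>Ps. (\<forall>P\<in>set Ps. primeideal P R) \<and>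
    (\<forall>x\<in>carrier R. (\<forall>P\<in>set Ps. x \<in> P) \<longrightarrow> (\<exists>n::nat. x [^] n \<in> J))"
  using noeth assms
proof (induction J rule: noetherian_prime_induct)
  case top
  then show ?case by (intro exI[of _ "[]"]) auto
next
  case (prime P)
  have "\<exists>n::nat. x [^] n \<in> P" if "x \<in> carrier R" "x \<in> P" for x
    using that by (intro exI[of _ 1]) simp
  then show ?case using prime(1) by (intro exI[of _ "[P]"]) auto
next
  case (step J a b)
  note A = psubset_add_PIdl[OF step(1,2,4)] and B = psubset_add_PIdl[OF step(1,3,5)]
  obtain Ps where Ps: "\<forall>P\<in>set Ps. primeideal P R"
    "\<And>x. x \<in> carrier R \<Longrightarrow> (\<forall>P\<in>set Ps. x \<in> P) \<Longrightarrow> \<exists>n::nat. x [^] n \<in> J <+> PIdl a"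
    using step(7)[OF A(1,2)] by blast
  obtain Qs where Qs: "\<forall>P\<in>set Qs. primeideal P R"
    "\<And>x. x \<in> carrier R \<Longrightarrow> (\<forall>P\<in>set Qs. x \<in> P) \<Longrightarrow> \<exists>n::nat. x [^] n \<in> J <+> PIdl b"
    using step(7)[OF B(1,2)] by blast
  have "\<exists>n::nat. x [^] n \<in> J" if x: "x \<in> carrier R" "\<forall>P\<in>set (Ps @ Qs). x \<in> P" for x
  proof -
    obtain n m :: nat where nm: "x [^] n \<in> J <+> PIdl a" "x [^] m \<in> J <+> PIdl b"
      using Ps(2)[OF x(1)] Qs(2)[OF x(1)] x(2) by auto
    obtain j u where u: "j \<in> J" "u \<in> PIdl a" "x [^] n = j \<oplus> u" using nm(1) by (rule ideal_addE)
    obtain k v where v: "k \<in> J" "v \<in> PIdl b" "x [^] m = k \<oplus> v" using nm(2) by (rule ideal_addE)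
    obtain r where r: "r \<in> carrier R" "u = r \<otimes> a" using u(2) unfolding cgenideal_def by blast
    obtain s where s: "s \<in> carrier R" "v = s \<otimes> b" using v(2) unfolding cgenideal_def by blast
    have c: "j \<in> carrier R" "k \<in> carrier R" "u \<in> carrier R" "v \<in> carrier R"
      using u v r s step(2,3) ideal.Icarr[OF step(1)] by auto
    have "u \<otimes> v = (r \<otimes> s) \<otimes> (a \<otimes> b)" using r s step(2,3) by (simp add: m_ac)
    also have "\<dots> \<in> J" using ideal.I_l_closed[OF step(1) step(6)] r s by blast
    finally have uv: "u \<otimes> v \<in> J" .
    have "x [^] (n + m) = (j \<oplus> u) \<otimes> (k \<oplus> v)" using x u v by (simp flip: nat_pow_mult)
    also have "\<dots> = j \<otimes> (k \<oplus> v) \<oplus> (u \<otimes> k \<oplus> u \<otimes> v)"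
      using c by (simp add: l_distr r_distr a_ac)
    also have "\<dots> \<in> J"
      using additive_subgroup.a_closed[OF ideal.axioms(1)[OF step(1)]] uv
        ideal.I_r_closed[OF step(1) u(1), of "k \<oplus> v"] ideal.I_l_closed[OF step(1) v(1) c(3)] c by simp
    finally show ?thesis by blast
  qed
  then show ?case using Ps(1) Qs(1) by (intro exI[of _ "Ps @ Qs"]) auto
qed

end

section \<open>Comparing an ideal with its Frobenius power\<close>

text \<open>The value at infinity is unspecified, so the arithmetic lemmas carry finiteness
  conditions.\<close>

definition real_of_enat :: "enat \<Rightarrow> real" where
  "real_of_enat x = real (the_enat x)"

lemma real_of_enat_mono: "x \<le> y \<Longrightarrow> y \<noteq> \<infinity> \<Longrightarrow> real_of_enat x \<le> real_of_enat y"
  by (cases x; cases y) (auto simp: real_of_enat_def)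

lemma real_of_enat_add:
  "x \<noteq> \<infinity> \<Longrightarrow> y \<noteq> \<infinity> \<Longrightarrow> real_of_enat (x + y) = real_of_enat x + real_of_enat y"
  by (cases x; cases y) (auto simp: real_of_enat_def)

lemma real_of_enat_mult:
  "x \<noteq> \<infinity> \<Longrightarrow> y \<noteq> \<infinity> \<Longrightarrow> real_of_enat (x * y) = real_of_enat x * real_of_enat y"
  by (cases x; cases y) (auto simp: real_of_enat_def)

lemma real_of_enat_of_nat [simp]: "real_of_enat (of_nat n) = real n"
  by (simp add: real_of_enat_def of_nat_eq_enat)

lemma real_of_enat_0 [simp]: "real_of_enat 0 = 0"
  by (simp add: real_of_enat_def zero_enat_def)

lemma real_of_enat_nonneg [simp]: "0 \<le> real_of_enat x"
  by (simp add: real_of_enat_def)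

lemma of_nat_enat_neq_infinity [simp]: "(of_nat n :: enat) \<noteq> \<infinity>"
  by (simp add: of_nat_eq_enat)

lemma enat_le_finite: "x \<le> y \<Longrightarrow> y \<noteq> \<infinity> \<Longrightarrow> x \<noteq> (\<infinity> :: enat)"
  by (auto dest: enat_ile)

lemma enat_mult_finite: "x \<noteq> \<infinity> \<Longrightarrow> y \<noteq> \<infinity> \<Longrightarrow> x * y \<noteq> (\<infinity> :: enat)"
  by (cases x; cases y) auto

lemma enat_add_finite: "x \<noteq> \<infinity> \<Longrightarrow> y \<noteq> \<infinity> \<Longrightarrow> x + y \<noteq> (\<infinity> :: enat)"
  by (cases x; cases y) auto

lemma abs_add_diff_le: "\<bar>a + b - c\<bar> \<le> \<bar>a\<bar> + \<bar>b\<bar> + \<bar>c :: real\<bar>"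
  by linarith

lemma (in module) ideal_span_add:
  assumes P: "ideal P R" and I: "ideal I R"
  shows "ideal_span R M (ideal_span R M {\<zero>\<^bsub>M\<^esub>} P) I = ideal_span R M {\<zero>\<^bsub>M\<^esub>} (P <+> I)"
    (is "?L = ?S")
proof
  have Pc: "P \<subseteq> carrier R" and Ic: "I \<subseteq> carrier R" using ideal.Icarr[OF P] ideal.Icarr[OF I] by auto
  note PI = ideal_add_mem[OF P I]
  have PIc: "P <+> I \<subseteq> carrier R" using ideal.Icarr[OF PI(1)] by blast
  have z: "{\<zero>\<^bsub>M\<^esub>} \<subseteq> carrier M" by simp
  have S: "submodule ?S R M" using submodule_ideal_span[OF z PIc] .
  have P0: "submodule (ideal_span R M {\<zero>\<^bsub>M\<^esub>} P) R M" using submodule_ideal_span[OF z Pc] .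
  have L: "submodule ?L R M" using submodule_ideal_span[OF submoduleE(1)[OF P0] Ic] .
  have PL: "ideal_span R M {\<zero>\<^bsub>M\<^esub>} P \<subseteq> ?L" by (rule ideal_span_superset)
  show "?L \<subseteq> ?S"
  proof (rule ideal_span_least[OF S ideal_span_mono[OF z PIc subset_refl PI(2)]])
    show "i \<odot>\<^bsub>M\<^esub> x \<in> ?S" if "i \<in> I" "x \<in> carrier M" for i x
      using ideal_span_mem[of i "P <+> I" x] that PI(3) by blast
  qed
  show "?S \<subseteq> ?L"
  proof (rule ideal_span_least[OF L])
    show "{\<zero>\<^bsub>M\<^esub>} \<subseteq> ?L" using submodule_zero[OF L] by simp
    fix j x assume j: "j \<in> P <+> I" and x: "x \<in> carrier M"
    obtain a b where ab: "a \<in> P" "b \<in> I" "j = a \<oplus> b" using j by (rule ideal_addE)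
    have "a \<odot>\<^bsub>M\<^esub> x \<in> ?L" using ideal_span_mem[OF ab(1) x] PL by blast
    moreover have "b \<odot>\<^bsub>M\<^esub> x \<in> ?L" using ideal_span_mem[OF ab(2) x] by blast
    moreover have "j \<odot>\<^bsub>M\<^esub> x = a \<odot>\<^bsub>M\<^esub> x \<oplus>\<^bsub>M\<^esub> b \<odot>\<^bsub>M\<^esub> x"
      unfolding ab(3) using ideal.Icarr[OF P ab(1)] ideal.Icarr[OF I ab(2)] x by (rule smult_l_distr)
    ultimately show "j \<odot>\<^bsub>M\<^esub> x \<in> ?L" using submoduleE(5)[OF L] by simp
  qed
qed

context F_finite_local_ring
begin

definition cl :: "'a set \<Rightarrow> real" where "cl J = real_of_enat (colength \<mm> J)"

lemma mpow_Suc: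
  assumes I: "ideal I R" and e: "mpow e \<subseteq> I" shows "mpow (Suc e) \<subseteq> frob_power R p I"
proof -
  have Ic: "I \<subseteq> carrier R" using ideal.Icarr[OF I] by blast
  have "mpow (Suc e) = frob_power R p (mpow e)"
    using frob_power_frob_power[OF max_carrier, where j = 1 and i = e] by simp
  then show ?thesis using frob_power_mono[OF Ic e] by simp
qed

lemma ideal_frob:
  assumes "ideal I R" shows "ideal (frob_power R q I) R"
proof -
  have "I \<subseteq> carrier R" using ideal.Icarr[OF assms] by blast
  then show ?thesis by (rule ideal_frob_power)
qed

text \<open>Finiteness is read off from the growth bound for the zero ideal, as the factor p^e in it
  is positive.\<close>

lemma colength_mpow_finite:
  assumes dim: "dim_less R {\<zero>} j" and J: "ideal J R" and e: "mpow e \<subseteq> J"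
  shows "colength \<mm> J \<noteq> \<infinity>"
proof -
  obtain C where C: "colength \<mm> ({\<zero>} <+> mpow e) * of_nat (p ^ e) \<le> of_nat (C * p ^ (e * j))"
    using colength_growth[OF zeroideal dim] by blast
  have "0 < p ^ e" using pos by simp
  then have "colength \<mm> ({\<zero>} <+> mpow e) \<noteq> \<infinity>"
    using C by (cases "colength \<mm> ({\<zero>} <+> mpow e)") (auto simp: of_nat_eq_enat)
  moreover have "{\<zero>} <+> mpow e \<subseteq> J"
    using ideal_add_least[OF J _ e] additive_subgroup.zero_closed[OF ideal.axioms(1)[OF J]] by simp
  ultimately show ?thesis
    using colength_antimono[OF prime_max ideal_add_mem(1)[OF zeroideal ideal_mpow] J] enat_le_finite by blast
qed

text \<open>The constant depends on J only: every I in question contains J + \<mm>^[p^e], so its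
  colength is bounded by that of this sum.\<close>

lemma cl_growth:
  assumes J: "ideal J R" and dim: "dim_less R J j"
  shows "\<exists>C\<ge>0. \<forall>e I. ideal I R \<longrightarrow> J \<subseteq> I \<longrightarrow> mpow e \<subseteq> I \<longrightarrow> cl I * real p ^ e \<le> C * real p ^ (e * j)"
proof -
  obtain C where C: "\<And>e. colength \<mm> (J <+> mpow e) * of_nat (p ^ e) \<le> of_nat (C * p ^ (e * j))"
    using colength_growth[OF J dim] by blast
  have "cl I * real p ^ e \<le> real C * real p ^ (e * j)" if I: "ideal I R" "J \<subseteq> I" "mpow e \<subseteq> I" for e I
  proof -
    have "colength \<mm> I \<le> colength \<mm> (J <+> mpow e)"
      using colength_antimono[OF prime_max ideal_add_mem(1)[OF J ideal_mpow] I(1) ideal_add_least[OF I]] .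
    then have "colength \<mm> I * of_nat (p ^ e) \<le> colength \<mm> (J <+> mpow e) * of_nat (p ^ e)"
      by (rule mult_right_mono) simp
    then have le: "colength \<mm> I * of_nat (p ^ e) \<le> of_nat (C * p ^ (e * j))" using C[of e] by (rule order_trans)
    have fin: "colength \<mm> I \<noteq> \<infinity>"
    proof
      assume "colength \<mm> I = \<infinity>"
      then show False using le pos by (simp add: of_nat_eq_enat del: of_nat_power)
    qed
    have "real_of_enat (colength \<mm> I * of_nat (p ^ e)) \<le> real (C * p ^ (e * j))"
      using real_of_enat_mono[OF le of_nat_enat_neq_infinity] unfolding real_of_enat_of_nat .
    then show ?thesis
      unfolding cl_def real_of_enat_mult[OF fin of_nat_enat_neq_infinity] real_of_enat_of_nat by simp
  qed
  then show ?thesis by (intro exI[of _ "real C"]) auto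
qed

end

section \<open>Lengths of M/JM and the case of a prime\<close>

locale F_finite_local_module = F_finite_local_ring R p \<mm> gs + M: module R M
  for R (structure) and p \<mm> gs and M (structure) +
  fixes hs d
  assumes hs: "generates R M hs" and dim: "dim_less R {\<zero>} (Suc d)"
begin

text \<open>The length of M/JM, which is the length of R/J \<otimes> M by
  \<open>module_length_tensor_quotient\<close>.\<close>

definition mlen :: "'a set \<Rightarrow> enat" where
  "mlen J = local_length R M \<mm> (ideal_span R M {\<zero>\<^bsub>M\<^esub>} J) (carrier M)"

definition ml :: "'a set \<Rightarrow> real" where "ml J = real_of_enat (mlen J)"

lemma zero_subset: "ideal J R \<Longrightarrow> {\<zero>} \<subseteq> J"
  using additive_subgroup.zero_closed[OF ideal.axioms(1)] by auto

lemma span_submodule: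
  assumes "ideal J R" shows "submodule (ideal_span R M {\<zero>\<^bsub>M\<^esub>} J) R M"
proof -
  have "J \<subseteq> carrier R" using ideal.Icarr[OF assms] by blast
  then show ?thesis by (intro M.submodule_ideal_span) auto
qed

lemma mlen_le:
  assumes "ideal J R" shows "mlen J \<le> of_nat (length hs) * colength \<mm> J"
  unfolding mlen_def
proof (rule M.length_quotient_le[OF prime_max assms span_submodule[OF assms] hs])
  show "j \<odot>\<^bsub>M\<^esub> g \<in> ideal_span R M {\<zero>\<^bsub>M\<^esub>} J" if "g \<in> set hs" "j \<in> J" for g j
    using M.ideal_span_mem[OF that(2)] generatesD(1)[OF hs] that(1) by blast
qed

lemma colength_finite_of_mpow: "ideal J R \<Longrightarrow> mpow e \<subseteq> J \<Longrightarrow> colength \<mm> J \<noteq> \<infinity>"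
  by (rule colength_mpow_finite[OF dim])

lemma mlen_finite: "ideal J R \<Longrightarrow> mpow e \<subseteq> J \<Longrightarrow> mlen J \<noteq> \<infinity>"
  by (rule enat_le_finite[OF mlen_le enat_mult_finite[OF of_nat_enat_neq_infinity colength_finite_of_mpow]])

lemma dim_less_of_prime:
  assumes "primeideal P R" "P \<subset> J" shows "dim_less R J d"
  using dim_less_psubset[OF dim assms(1) zero_subset assms(2)] primeideal.axioms(1)[OF assms(1)] by blast

lemma add_mpow:
  assumes "ideal J R" "ideal I R" "mpow e \<subseteq> I"
  shows "ideal (J <+> I) R" "J \<subseteq> J <+> I" "mpow e \<subseteq> J <+> I"
  using ideal_add_mem[OF assms(1,2)] assms(3) by auto

text \<open>The number n is the rank of M/PM over R/P. The error comes from an ideal P + (s)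
  strictly above P, whose quotient has dimension less than d.\<close>

lemma module_compare:
  assumes P: "primeideal P R"
  shows "\<exists>n::nat. \<exists>C\<ge>0. \<forall>e I. ideal I R \<longrightarrow> mpow e \<subseteq> I \<longrightarrow>
    \<bar>ml (P <+> I) - n * cl (P <+> I)\<bar> * real p ^ e \<le> C * real p ^ (e * d)"
proof -
  note Pi = primeideal.axioms(1)[OF P]
  let ?K = "ideal_span R M {\<zero>\<^bsub>M\<^esub>} P"
  have PK: "r \<odot>\<^bsub>M\<^esub> x \<in> ?K" if "r \<in> P" "x \<in> carrier M" for r x
    using M.ideal_span_mem[OF that] .
  obtain n s where s: "s \<in> carrier R - P"
    and up: "\<And>Q I. primeideal Q R \<Longrightarrow> ideal I R \<Longrightarrow>
      local_length R M Q (ideal_span R M ?K I) (carrier M)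
        \<le> of_nat n * colength Q (P <+> I)
          + of_nat (length hs) * colength Q ((P <+> PIdl s) <+> I)"
    and lo: "\<And>Q I. primeideal Q R \<Longrightarrow> ideal I R \<Longrightarrow>
      of_nat n * colength Q (P <+> I)
        \<le> local_length R M Q (ideal_span R M ?K I) (carrier M)
          + of_nat (length hs) * colength Q ((P <+> PIdl s) <+> I)"
    using M.length_compare_free[OF P span_submodule[OF Pi] PK hs] by metis
  have sc: "s \<in> carrier R" "s \<notin> P" using s by auto
  note W = psubset_add_PIdl[OF Pi sc]
  obtain C where C: "C \<ge> 0" "\<And>e I. ideal I R \<Longrightarrow> P <+> PIdl s \<subseteq> I \<Longrightarrow> mpow e \<subseteq> I \<Longrightarrow>
      cl I * real p ^ e \<le> C * real p ^ (e * d)"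
    using cl_growth[OF W(1) dim_less_of_prime[OF P W(2)]] by blast
  have "\<bar>ml (P <+> I) - n * cl (P <+> I)\<bar> * real p ^ e \<le> (length hs * C) * real p ^ (e * d)"
    if I: "ideal I R" "mpow e \<subseteq> I" for e I
  proof -
    let ?J = "(P <+> PIdl s) <+> I"
    note A = add_mpow[OF Pi I] and B = add_mpow[OF W(1) I]
    note f = mlen_finite[OF A(1,3)] colength_finite_of_mpow[OF A(1,3)] colength_finite_of_mpow[OF B(1,3)]
    have u: "mlen (P <+> I) \<le> of_nat n * colength \<mm> (P <+> I) + of_nat (length hs) * colength \<mm> ?J"
      and l: "of_nat n * colength \<mm> (P <+> I) \<le> mlen (P <+> I) + of_nat (length hs) * colength \<mm> ?J"
      using up[OF prime_max I(1)] lo[OF prime_max I(1)]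
      unfolding M.ideal_span_add[OF Pi I(1)] mlen_def by auto
    have "ml (P <+> I) \<le> n * cl (P <+> I) + length hs * cl ?J"
      using real_of_enat_mono[OF u] f
      by (simp add: ml_def cl_def real_of_enat_add real_of_enat_mult enat_add_finite enat_mult_finite)
    moreover have "n * cl (P <+> I) \<le> ml (P <+> I) + length hs * cl ?J"
      using real_of_enat_mono[OF l] f
      by (simp add: ml_def cl_def real_of_enat_add real_of_enat_mult enat_add_finite enat_mult_finite)
    ultimately have "\<bar>ml (P <+> I) - n * cl (P <+> I)\<bar> \<le> length hs * cl ?J" by linarith
    then have "\<bar>ml (P <+> I) - n * cl (P <+> I)\<bar> * real p ^ e \<le> length hs * cl ?J * real p ^ e"
      by (rule mult_right_mono) simp
    also have "\<dots> \<le> length hs * (C * real p ^ (e * d))"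
      using mult_left_mono[OF C(2)[OF B]] by (simp add: mult.assoc)
    finally show ?thesis by (simp add: mult.assoc)
  qed
  then show ?thesis using C(1) by (intro exI[of _ n] exI[of _ "length hs * C"]) auto
qed

text \<open>Comparison with a free module produces the rank of F_*(R/P) as a factor of the length
  for I. On the other side \<open>frobenius_length\<close> turns the length of F_*(R/(P + I^[p]))
  into the length of R/(P + I^[p]) times the rank at \<mm>.\<close>

lemma frobenius_compare:
  assumes P: "primeideal P R"
  shows "\<exists>C\<ge>0. \<forall>e I. ideal I R \<longrightarrow> mpow e \<subseteq> I \<longrightarrow>
    \<bar>cl (P <+> frob_power R p I) * real_of_enat (frobenius_rank \<mm>)
      - real_of_enat (frobenius_rank P) * cl (P <+> I)\<bar> * real p ^ e \<le> C * real p ^ (e * d)"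
proof -
  note Pi = primeideal.axioms(1)[OF P]
  obtain n s where sc: "s \<in> carrier R" "s \<notin> P"
    and n: "of_nat n = frobenius_rank P"
    and up: "\<And>Q I. primeideal Q R \<Longrightarrow> ideal I R \<Longrightarrow>
      local_length R frobenius_module Q (P <+> frob_power R p I) (carrier R)
        \<le> of_nat n * colength Q (P <+> I)
          + of_nat (length gs) * colength Q ((P <+> PIdl s) <+> I)"
    and lo: "\<And>Q I. primeideal Q R \<Longrightarrow> ideal I R \<Longrightarrow>
      of_nat n * colength Q (P <+> I)
        \<le> local_length R frobenius_module Q (P <+> frob_power R p I) (carrier R)
          + of_nat (length gs) * colength Q ((P <+> PIdl s) <+> I)"
    using frobenius_compare_free[OF P gs] by metis
  note W = psubset_add_PIdl[OF Pi sc]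
  have rP: "real_of_enat (frobenius_rank P) = n" using n by (simp flip: n)
  have fr: "frobenius_rank \<mm> \<noteq> \<infinity>" using frobenius_rank_finite[OF prime_max gs] .
  obtain C where C: "C \<ge> 0" "\<And>e I. ideal I R \<Longrightarrow> P <+> PIdl s \<subseteq> I \<Longrightarrow> mpow e \<subseteq> I \<Longrightarrow>
      cl I * real p ^ e \<le> C * real p ^ (e * d)"
    using cl_growth[OF W(1) dim_less_of_prime[OF P W(2)]] by blast
  have "\<bar>cl (P <+> frob_power R p I) * real_of_enat (frobenius_rank \<mm>)
      - real_of_enat (frobenius_rank P) * cl (P <+> I)\<bar> * real p ^ e \<le> (length gs * C) * real p ^ (e * d)"
    if I: "ideal I R" "mpow e \<subseteq> I" for e I
  proof -
    let ?J = "(P <+> PIdl s) <+> I" and ?F = "P <+> frob_power R p I"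
    note A = add_mpow[OF Pi I] and B = add_mpow[OF W(1) I]
      and D = add_mpow[OF Pi ideal_frob[OF I(1)] mpow_Suc[OF I]]
    note f = colength_finite_of_mpow[OF D(1,3)] colength_finite_of_mpow[OF A(1,3)] colength_finite_of_mpow[OF B(1,3)]
    obtain c where c: "colength \<mm> ?F = enat c" using f(1) by blast
    have Fc: "?F \<subseteq> carrier R" using ideal.Icarr[OF D(1)] by blast
    have lF: "local_length R frobenius_module \<mm> ?F (carrier R) = of_nat c * frobenius_rank \<mm>"
      using frobenius_length[OF prime_max D(1) oneideal Fc c] .
    have clF: "cl ?F = c" unfolding cl_def c by (simp add: real_of_enat_def)
    have u: "of_nat c * frobenius_rank \<mm> \<le> of_nat n * colength \<mm> (P <+> I) + of_nat (length gs) * colength \<mm> ?J"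
      and l: "of_nat n * colength \<mm> (P <+> I) \<le> of_nat c * frobenius_rank \<mm> + of_nat (length gs) * colength \<mm> ?J"
      using up[OF prime_max I(1)] lo[OF prime_max I(1)]
      unfolding lF by auto
    have "cl ?F * real_of_enat (frobenius_rank \<mm>) \<le> n * cl (P <+> I) + length gs * cl ?J"
      using real_of_enat_mono[OF u] f(2,3) fr unfolding clF
      by (simp add: cl_def real_of_enat_add real_of_enat_mult enat_add_finite enat_mult_finite)
    moreover have "n * cl (P <+> I) \<le> cl ?F * real_of_enat (frobenius_rank \<mm>) + length gs * cl ?J"
      using real_of_enat_mono[OF l] f(2,3) fr unfolding clF
      by (simp add: cl_def real_of_enat_add real_of_enat_mult enat_add_finite enat_mult_finite)
    ultimately have "\<bar>cl ?F * real_of_enat (frobenius_rank \<mm>) - n * cl (P <+> I)\<bar> \<le> length gs * cl ?J"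
      by linarith
    then have "\<bar>cl ?F * real_of_enat (frobenius_rank \<mm>) - n * cl (P <+> I)\<bar> * real p ^ e \<le> length gs * cl ?J * real p ^ e"
      by (rule mult_right_mono) simp
    also have "\<dots> \<le> length gs * (C * real p ^ (e * d))"
      using mult_left_mono[OF C(2)[OF B]] by (simp add: mult.assoc)
    finally show ?thesis unfolding rP by (simp add: mult.assoc)
  qed
  then show ?thesis using C(1) by (intro exI[of _ "length gs * C"]) auto
qed

text \<open>
  The one-step comparison of $I$ with $I^{[p]}$ for the module $M/\aa M$. It holds for primes and passes to
  intersections with primes, hence it holds for \<open>\<aa> = 0\<close> when \<open>R\<close> is reduced.
\<close>

definition stable :: "'a set \<Rightarrow> bool" where
  "stable \<aa> \<longleftrightarrow> (\<exists>C\<ge>0. \<forall>e I. ideal I R \<longrightarrow> mpow e \<subseteq> I \<longrightarrow>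
    \<bar>ml (\<aa> <+> frob_power R p I) - real p ^ d * ml (\<aa> <+> I)\<bar> * real p ^ e \<le> C * real p ^ (e * d))"

lemma stableI:
  assumes "C \<ge> 0" "\<And>e I. ideal I R \<Longrightarrow> mpow e \<subseteq> I \<Longrightarrow>
    \<bar>ml (\<aa> <+> frob_power R p I) - real p ^ d * ml (\<aa> <+> I)\<bar> * real p ^ e \<le> C * real p ^ (e * d)"
  shows "stable \<aa>"
  using assms unfolding stable_def by blast

lemma p_gt_1: "1 < real p"
  using prime prime_gt_1_nat by auto

text \<open>If \<mm>^[p^e] lies in I, then I^[p] contains \<mm>^[p^(e+1)]. So bounds for I^[p] come
  with exponent e + 1; bringing them back to e costs a factor p^d in the constant.\<close>

lemma shift_bound:
  assumes b: "x * real p ^ Suc e \<le> C * real p ^ (Suc e * d)" and x: "0 \<le> x"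
  shows "x * real p ^ e \<le> (C * real p ^ d) * real p ^ (e * d)"
proof -
  have "x * real p ^ e \<le> x * real p ^ Suc e"
    using x p_gt_1 by (intro mult_left_mono power_increasing) auto
  also have "\<dots> \<le> (C * real p ^ d) * real p ^ (e * d)" using b by (simp add: power_add mult_ac)
  finally show ?thesis .
qed

text \<open>Replacing M/PM by n copies of R/P, both at I and at I^[p], reduces the claim to R/P.
  There the factor is the quotient of two ranks if dim R/P = d; if dim R/P < d, both lengths are
  within the error.\<close>

lemma stable_prime:
  assumes P: "primeideal P R" shows "stable P"
proof -
  note Pi = primeideal.axioms(1)[OF P]
  obtain n :: nat and C1 where C1: "C1 \<ge> 0" "\<And>e I. ideal I R \<Longrightarrow> mpow e \<subseteq> I \<Longrightarrow>
      \<bar>ml (P <+> I) - n * cl (P <+> I)\<bar> * real p ^ e \<le> C1 * real p ^ (e * d)"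
    using module_compare[OF P] by blast
  have "\<exists>C2\<ge>0. \<forall>e I. ideal I R \<longrightarrow> mpow e \<subseteq> I \<longrightarrow>
    \<bar>cl (P <+> frob_power R p I) - real p ^ d * cl (P <+> I)\<bar> * real p ^ e \<le> C2 * real p ^ (e * d)"
  proof (cases "dim_less R P d")
    case True
    obtain C where C: "C \<ge> 0" "\<And>e I. ideal I R \<Longrightarrow> P \<subseteq> I \<Longrightarrow> mpow e \<subseteq> I \<Longrightarrow>
        cl I * real p ^ e \<le> C * real p ^ (e * d)"
      using cl_growth[OF Pi True] by blast
    have "\<bar>cl (P <+> frob_power R p I) - real p ^ d * cl (P <+> I)\<bar> * real p ^ e
        \<le> (2 * C * real p ^ d) * real p ^ (e * d)" if I: "ideal I R" "mpow e \<subseteq> I" for e I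
    proof -
      note A = add_mpow[OF Pi I] and D = add_mpow[OF Pi ideal_frob[OF I(1)] mpow_Suc[OF I]]
      have nn: "0 \<le> cl J" for J by (simp add: cl_def)
      have a: "cl (P <+> frob_power R p I) * real p ^ e \<le> (C * real p ^ d) * real p ^ (e * d)"
        using shift_bound[OF C(2)[OF D, unfolded] nn] by simp
      have b: "real p ^ d * (cl (P <+> I) * real p ^ e) \<le> real p ^ d * (C * real p ^ (e * d))"
        by (rule mult_left_mono[OF C(2)[OF A]]) simp
      have "\<bar>cl (P <+> frob_power R p I) - real p ^ d * cl (P <+> I)\<bar>
          \<le> cl (P <+> frob_power R p I) + real p ^ d * cl (P <+> I)"
        using nn[of "P <+> frob_power R p I"] nn[of "P <+> I"]
          mult_nonneg_nonneg[of "real p ^ d" "cl (P <+> I)"] by (simp add: abs_le_iff)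
      then have "\<bar>cl (P <+> frob_power R p I) - real p ^ d * cl (P <+> I)\<bar> * real p ^ e
          \<le> (cl (P <+> frob_power R p I) + real p ^ d * cl (P <+> I)) * real p ^ e"
        by (rule mult_right_mono) simp
      also have "\<dots> = cl (P <+> frob_power R p I) * real p ^ e + real p ^ d * (cl (P <+> I) * real p ^ e)"
        by (simp add: distrib_right mult.assoc)
      also have "\<dots> \<le> (C * real p ^ d) * real p ^ (e * d) + real p ^ d * (C * real p ^ (e * d))"
        using a b by (intro add_mono) simp_all
      finally show ?thesis by simp
    qed
    then show ?thesis using C(1) by (intro exI[of _ "2 * C * real p ^ d"]) auto
  next
    case False
    \<comment> \<open>Negating \<open>dim_less R P d\<close> gives a chain of length at least d
      above P; the bound on the dimension of R makes it exactly d.\<close>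
    then obtain m Ps where m: "prime_chain R P m Ps" "d \<le> m" unfolding dim_less_def by (meson not_less)
    have dimP: "dim_less R P (Suc d)" using dim_less_mono[OF dim zero_subset[OF Pi]] .
    then have "m = d" using m unfolding dim_less_def by fastforce
    then have rk: "frobenius_rank P = of_nat (p ^ d) * frobenius_rank \<mm>"
      using frobenius_rank_chain[OF P _ dimP] m by blast
    define L where "L = real_of_enat (frobenius_rank \<mm>)"
    have fr: "frobenius_rank \<mm> \<noteq> \<infinity>" using frobenius_rank_finite[OF prime_max gs] .
    have L1: "1 \<le> L"
      using real_of_enat_mono[OF frobenius_rank_ge_1[OF prime_max] fr] real_of_enat_of_nat[of 1]
      by (simp add: L_def)
    have rP: "real_of_enat (frobenius_rank P) = real p ^ d * L"
      unfolding rk L_def using fr by (simp add: real_of_enat_mult del: of_nat_power)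
    obtain C where C: "C \<ge> 0" "\<And>e I. ideal I R \<Longrightarrow> mpow e \<subseteq> I \<Longrightarrow>
        \<bar>cl (P <+> frob_power R p I) * L - real p ^ d * L * cl (P <+> I)\<bar> * real p ^ e \<le> C * real p ^ (e * d)"
      using frobenius_compare[OF P] unfolding rP L_def[symmetric] by blast
    have "\<bar>cl (P <+> frob_power R p I) - real p ^ d * cl (P <+> I)\<bar> * real p ^ e
        \<le> C * real p ^ (e * d)" if I: "ideal I R" "mpow e \<subseteq> I" for e I
    proof -
      let ?x = "cl (P <+> frob_power R p I) - real p ^ d * cl (P <+> I)"
      \<comment> \<open>Cancelling L keeps the bound, as L is at least 1.\<close>
      have "\<bar>?x\<bar> * real p ^ e \<le> \<bar>?x\<bar> * real p ^ e * L" using L1 mult_left_mono[of 1 L "\<bar>?x\<bar> * real p ^ e"] by simp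
      also have "\<dots> = \<bar>?x * L\<bar> * real p ^ e" using L1 by (simp add: abs_mult)
      also have "?x * L = cl (P <+> frob_power R p I) * L - real p ^ d * L * cl (P <+> I)"
        by (simp add: left_diff_distrib)
      finally show ?thesis using C(2)[OF I] by linarith
    qed
    then show ?thesis using C(1) by blast
  qed
  then obtain C2 where C2: "C2 \<ge> 0" "\<And>e I. ideal I R \<Longrightarrow> mpow e \<subseteq> I \<Longrightarrow>
    \<bar>cl (P <+> frob_power R p I) - real p ^ d * cl (P <+> I)\<bar> * real p ^ e \<le> C2 * real p ^ (e * d)" by blast
  show ?thesis
  proof (rule stableI)
    show "0 \<le> C1 * real p ^ d + n * C2 + real p ^ d * C1" using C1(1) C2(1) by simp
    fix e I assume I: "ideal I R" "mpow e \<subseteq> I"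
    let ?F = "P <+> frob_power R p I" and ?A = "P <+> I"
    let ?q = "real p ^ e" and ?E = "real p ^ (e * d)"
    have 1: "\<bar>ml ?F - n * cl ?F\<bar> * ?q \<le> (C1 * real p ^ d) * ?E"
      using shift_bound[OF C1(2)[OF ideal_frob[OF I(1)] mpow_Suc[OF I]]] by simp
    have 2: "n * (\<bar>cl ?F - real p ^ d * cl ?A\<bar> * ?q) \<le> n * (C2 * ?E)"
      using mult_left_mono[OF C2(2)[OF I]] by simp
    have 3: "real p ^ d * (\<bar>ml ?A - n * cl ?A\<bar> * ?q) \<le> real p ^ d * (C1 * ?E)"
      using mult_left_mono[OF C1(2)[OF I], of "real p ^ d"] by simp
    \<comment> \<open>Three errors: M/PM against n copies of R/P at I^[p], the passage from I to
      I^[p] for R/P, and M/PM against n copies of R/P at I.\<close>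
    have eq: "ml ?F - real p ^ d * ml ?A = (ml ?F - n * cl ?F) + n * (cl ?F - real p ^ d * cl ?A) - real p ^ d * (ml ?A - n * cl ?A)"
      by (simp add: algebra_simps)
    have "\<bar>ml ?F - real p ^ d * ml ?A\<bar> \<le> \<bar>ml ?F - n * cl ?F\<bar> + \<bar>n * (cl ?F - real p ^ d * cl ?A)\<bar> + \<bar>real p ^ d * (ml ?A - n * cl ?A)\<bar>"
      unfolding eq by (rule abs_add_diff_le)
    also have "\<dots> = \<bar>ml ?F - n * cl ?F\<bar> + n * \<bar>cl ?F - real p ^ d * cl ?A\<bar> + real p ^ d * \<bar>ml ?A - n * cl ?A\<bar>"
      by (simp only: abs_mult power_abs abs_of_nat)
    finally have "\<bar>ml ?F - real p ^ d * ml ?A\<bar> * ?q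
      \<le> (\<bar>ml ?F - n * cl ?F\<bar> + n * \<bar>cl ?F - real p ^ d * cl ?A\<bar> + real p ^ d * \<bar>ml ?A - n * cl ?A\<bar>) * ?q"
      by (rule mult_right_mono) simp
    also have "\<dots> = \<bar>ml ?F - n * cl ?F\<bar> * ?q + n * (\<bar>cl ?F - real p ^ d * cl ?A\<bar> * ?q)
        + real p ^ d * (\<bar>ml ?A - n * cl ?A\<bar> * ?q)"
      by (simp only: distrib_right mult.assoc)
    also have "\<dots> \<le> (C1 * real p ^ d) * ?E + n * (C2 * ?E) + real p ^ d * (C1 * ?E)"
      using 1 2 3 by (intro add_mono)
    also have "\<dots> = (C1 * real p ^ d + n * C2 + real p ^ d * C1) * ?E"
      by (simp only: distrib_right mult.assoc)
    finally show "\<bar>ml ?F - real p ^ d * ml ?A\<bar> * real p ^ e \<le> (C1 * real p ^ d + n * C2 + real p ^ d * C1) * real p ^ (e * d)"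
      by simp
  qed
qed

end

lemma (in module) smult_vimage:
  assumes "r \<in> carrier R" "submodule H R M"
  shows "submodule {x \<in> carrier M. r \<odot>\<^bsub>M\<^esub> x \<in> H} R M"
proof -
  interpret f: linear_map_pair R M M "\<lambda>x. r \<odot>\<^bsub>M\<^esub> x"
    using linear_map_smult[OF assms(1)] module_axioms
    by (simp add: linear_map_pair_def linear_map_pair_axioms_def)
  show ?thesis by (rule f.submodule_vimage[OF carrier_is_submodule assms(2)])
qed

text \<open>The annihilator of M/H. As it is an ideal, whether \<aa> M lies in H can be tested on
  generators of \<aa>.\<close>

lemma (in module) ideal_multipliers:
  assumes "submodule H R M"
  shows "ideal {r \<in> carrier R. \<forall>x\<in>carrier M. r \<odot>\<^bsub>M\<^esub> x \<in> H} R" (is "ideal ?J R")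
proof -
  interpret reg: module R "regular_module R" by (rule regular)
  have "submodule ?J R (regular_module R)"
  proof (rule reg.submoduleI)
    show "\<zero>\<^bsub>regular_module R\<^esub> \<in> ?J" using submodule_zero[OF assms] by simp
    show "\<ominus>\<^bsub>regular_module R\<^esub> a \<in> ?J" if "a \<in> ?J" for a
      using that submoduleE(3)[OF assms] by (auto simp: smult_l_minus)
    show "a \<oplus>\<^bsub>regular_module R\<^esub> b \<in> ?J" if "a \<in> ?J" "b \<in> ?J" for a b
      using that submoduleE(5)[OF assms] by (auto simp: smult_l_distr)
    show "a \<odot>\<^bsub>regular_module R\<^esub> b \<in> ?J" if "a \<in> carrier R" "b \<in> ?J" for a b
      using that submoduleE(4)[OF assms] by (auto simp: smult_assoc1)
  qed auto
  then show ?thesis by (rule R.ideal_of_submodule_regular)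
qed

section \<open>Intersections with a prime, and iteration\<close>

context F_finite_local_module
begin

lemma span_mem_add:
  assumes J: "ideal J R" and I: "ideal I R" and H: "submodule H R M"
    and x: "x \<in> carrier M" and j: "j \<in> J <+> I"
    and 1: "\<And>a. a \<in> J \<Longrightarrow> a \<odot>\<^bsub>M\<^esub> x \<in> H" and 2: "\<And>a. a \<in> I \<Longrightarrow> a \<odot>\<^bsub>M\<^esub> x \<in> H"
  shows "j \<odot>\<^bsub>M\<^esub> x \<in> H"
proof -
  obtain a b where ab: "a \<in> J" "b \<in> I" "j = a \<oplus> b" using j by (rule ideal_addE)
  have "j \<odot>\<^bsub>M\<^esub> x = a \<odot>\<^bsub>M\<^esub> x \<oplus>\<^bsub>M\<^esub> b \<odot>\<^bsub>M\<^esub> x"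
    unfolding ab(3) using ideal.Icarr[OF J ab(1)] ideal.Icarr[OF I ab(2)] x by (rule M.smult_l_distr)
  then show ?thesis using M.submoduleE(5)[OF H 1[OF ab(1)] 2[OF ab(2)]] by simp
qed

text \<open>M is filtered from T0 = (\<aa> \<inter> P + I)M by D = sM + T0 and D1 = D + \<aa>M.
  Multiplication by s maps M/(P + I)M onto D/T0, because sP lies in the intersection. D1/D is killed
  by P + (s) + I, because P\<aa> lies in the intersection and sM in D. M/D1 is a quotient of
  M/(\<aa> + I)M.\<close>

lemma mlen_inter_le:
  assumes \<aa>: "ideal \<aa> R" and P: "primeideal P R" and s: "s \<in> \<aa>" "s \<notin> P"
  shows "\<exists>m::nat. \<forall>I. ideal I R \<longrightarrow> mlen ((\<aa> \<inter> P) <+> I)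
    \<le> mlen (\<aa> <+> I) + mlen (P <+> I) + of_nat m * colength \<mm> ((P <+> PIdl s) <+> I)"
proof -
  interpret V: prime_module R M \<mm> using M.module_axioms prime_max by (simp add: prime_module_def)
  note Pi = primeideal.axioms(1)[OF P]
  have sc: "s \<in> carrier R" using ideal.Icarr[OF \<aa> s(1)] .
  note W = psubset_add_PIdl[OF Pi sc s(2)]
  note b = i_intersect[OF \<aa> Pi]
  obtain A where A: "A \<subseteq> carrier R" "finite A" "\<aa> = Idl A"
    using noetherian_ring.finetely_gen[OF noeth \<aa>] by blast
  obtain as where as: "set as = A" using A(2) finite_list by blast
  \<comment> \<open>Products of generators of \<aa> and of M: a finite generating family of \<aa>M.
    Its length, the number m claimed, does not involve I.\<close>
  define es where "es = concat (map (\<lambda>a. map (\<lambda>g. a \<odot>\<^bsub>M\<^esub> g) hs) as)"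
  have hsc: "set hs \<subseteq> carrier M" using generatesD(1)[OF hs] .
  have es_iff: "set es = {a \<odot>\<^bsub>M\<^esub> g | a g. a \<in> A \<and> g \<in> set hs}" unfolding es_def using as by auto
  have esc: "set es \<subseteq> carrier M" using A(1) hsc unfolding es_iff by blast
  have Aa: "A \<subseteq> \<aa>" using genideal_self[OF A(1)] A(3) by simp
  have "mlen ((\<aa> \<inter> P) <+> I) \<le> mlen (\<aa> <+> I) + mlen (P <+> I)
      + of_nat (length es) * colength \<mm> ((P <+> PIdl s) <+> I)" if I: "ideal I R" for I
  proof -
    let ?T0 = "ideal_span R M {\<zero>\<^bsub>M\<^esub>} ((\<aa> \<inter> P) <+> I)"
    let ?TP = "ideal_span R M {\<zero>\<^bsub>M\<^esub>} (P <+> I)"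
    let ?Ta = "ideal_span R M {\<zero>\<^bsub>M\<^esub>} (\<aa> <+> I)"
    let ?S = "(\<lambda>x. s \<odot>\<^bsub>M\<^esub> x) ` carrier M"
    let ?D = "?S <+>\<^bsub>M\<^esub> ?T0"
    let ?D1 = "lin_span R M (carrier R) ?D es"
    interpret f: linear_map_pair R M M "\<lambda>x. s \<odot>\<^bsub>M\<^esub> x"
      using M.linear_map_smult[OF sc] M.module_axioms
      by (simp add: linear_map_pair_def linear_map_pair_axioms_def)
    note bI = ideal_add_mem[OF b I] and PI = ideal_add_mem[OF Pi I] and aI = ideal_add_mem[OF \<aa> I]
    have T0: "submodule ?T0 R M" and TP: "submodule ?TP R M" and Ta: "submodule ?Ta R M"
      using span_submodule bI(1) PI(1) aI(1) by blast+
    have S: "submodule ?S R M" using f.submodule_image[OF M.carrier_is_submodule] .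
    have D: "submodule ?D R M" using M.submodule_set_add[OF S T0] .
    have D1: "submodule ?D1 R M" using M.submodule_lin_span[OF oneideal D esc] .
    have T0D: "?T0 \<subseteq> ?D" using M.set_add_upper2[OF S T0] .
    have SD: "?S \<subseteq> ?D" using M.set_add_upper1[OF S T0] .
    have DD1: "?D \<subseteq> ?D1" using M.lin_span_superset[OF oneideal D esc] .
    have mT0: "r \<odot>\<^bsub>M\<^esub> x \<in> ?T0" if "r \<in> \<aa> \<inter> P \<or> r \<in> I" "x \<in> carrier M" for r x
      using M.ideal_span_mem[of r "(\<aa> \<inter> P) <+> I" x] that bI(2,3) by blast
    have "local_length R M \<mm> ?T0 ?D \<le> mlen (P <+> I)"
      unfolding mlen_def
    proof (rule f.local_length_le_of_surj[OF prime_max M.carrier_is_submodule T0 D M.submoduleE(1)[OF TP] T0D])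
      have "?TP \<subseteq> {x \<in> carrier M. s \<odot>\<^bsub>M\<^esub> x \<in> ?T0}"
      proof (rule M.ideal_span_least[OF M.smult_vimage[OF sc T0]])
        show "{\<zero>\<^bsub>M\<^esub>} \<subseteq> {x \<in> carrier M. s \<odot>\<^bsub>M\<^esub> x \<in> ?T0}"
          using M.submodule_zero[OF M.smult_vimage[OF sc T0]] by simp
        fix j x assume j: "j \<in> P <+> I" and x: "x \<in> carrier M"
        show "j \<odot>\<^bsub>M\<^esub> x \<in> {x \<in> carrier M. s \<odot>\<^bsub>M\<^esub> x \<in> ?T0}"
        proof (rule span_mem_add[OF Pi I M.smult_vimage[OF sc T0] x j])
          fix a assume a: "a \<in> P"
          have ac: "a \<in> carrier R" using ideal.Icarr[OF Pi a] .
          have "s \<otimes> a \<in> \<aa> \<inter> P"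
            using ideal.I_r_closed[OF \<aa> s(1) ac] ideal.I_l_closed[OF Pi a sc] by simp
          then have "(s \<otimes> a) \<odot>\<^bsub>M\<^esub> x \<in> ?T0" using mT0 x by blast
          then show "a \<odot>\<^bsub>M\<^esub> x \<in> {x \<in> carrier M. s \<odot>\<^bsub>M\<^esub> x \<in> ?T0}"
            using sc ac x by (simp add: M.smult_assoc1)
        next
          fix a assume a: "a \<in> I"
          have ac: "a \<in> carrier R" using ideal.Icarr[OF I a] .
          have "a \<odot>\<^bsub>M\<^esub> x \<in> ?T0" using mT0 a x by blast
          then show "a \<odot>\<^bsub>M\<^esub> x \<in> {x \<in> carrier M. s \<odot>\<^bsub>M\<^esub> x \<in> ?T0}"
            using M.submoduleE(4)[OF T0 sc] ac x by simp
        qed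
      qed
      then show "(\<lambda>x. s \<odot>\<^bsub>M\<^esub> x) ` ?TP \<subseteq> ?T0" by blast
      show "local_le R M \<mm> ?D ?D" by (rule V.local_le_subset[OF subset_refl M.submoduleE(1)[OF D]])
    qed
    moreover have "local_length R M \<mm> ?D ?D1
        \<le> of_nat (length es) * colength \<mm> ((P <+> PIdl s) <+> I)"
    proof (rule M.length_lin_span_le[OF prime_max ideal_add_mem(1)[OF W(1) I] D esc])
      fix y j assume y: "y \<in> set es" and j: "j \<in> (P <+> PIdl s) <+> I"
      obtain a g where ag: "a \<in> A" "g \<in> set hs" "y = a \<odot>\<^bsub>M\<^esub> g" using y unfolding es_iff by blast
      have gc: "g \<in> carrier M" and ac: "a \<in> carrier R" and yc: "y \<in> carrier M"
        using ag hsc A(1) y esc by blast+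
      show "j \<odot>\<^bsub>M\<^esub> y \<in> ?D"
      proof (rule span_mem_add[OF W(1) I D yc j])
        show "w \<odot>\<^bsub>M\<^esub> y \<in> ?D" if w: "w \<in> P <+> PIdl s" for w
        proof (rule span_mem_add[OF Pi cgenideal_ideal[OF sc] D yc w])
          fix r assume r: "r \<in> P"
          have rc: "r \<in> carrier R" using ideal.Icarr[OF Pi r] .
          have "r \<otimes> a \<in> \<aa> \<inter> P"
            using ideal.I_l_closed[OF \<aa> _ rc, of a] ideal.I_r_closed[OF Pi r ac] Aa ag(1) by blast
          then have "(r \<otimes> a) \<odot>\<^bsub>M\<^esub> g \<in> ?D" using mT0 gc T0D by blast
          then show "r \<odot>\<^bsub>M\<^esub> y \<in> ?D" using ag(3) rc ac gc by (simp add: M.smult_assoc1)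
        next
          fix r assume "r \<in> PIdl s"
          then obtain c where c: "c \<in> carrier R" "r = c \<otimes> s" unfolding cgenideal_def by blast
          have "r \<odot>\<^bsub>M\<^esub> y = s \<odot>\<^bsub>M\<^esub> (c \<odot>\<^bsub>M\<^esub> y)"
            using c sc yc by (simp add: m_comm[of c s] M.smult_assoc1)
          then show "r \<odot>\<^bsub>M\<^esub> y \<in> ?D" using SD c(1) yc by auto
        qed
        show "i \<odot>\<^bsub>M\<^esub> y \<in> ?D" if "i \<in> I" for i using mT0 that yc T0D by blast
      qed
    qed
    moreover have "local_length R M \<mm> ?D1 (carrier M) \<le> mlen (\<aa> <+> I)"
      unfolding mlen_def
    proof (rule V.local_length_mono[OF M.carrier_is_submodule M.carrier_is_submodule _ _ subset_refl])
      show "?D1 \<subseteq> carrier M" using M.submoduleE(1)[OF D1] .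
      have aD1: "a \<odot>\<^bsub>M\<^esub> x \<in> ?D1" if a: "a \<in> \<aa>" and x: "x \<in> carrier M" for a x
      proof -
        have "A \<subseteq> {r \<in> carrier R. \<forall>x\<in>carrier M. r \<odot>\<^bsub>M\<^esub> x \<in> ?D1}"
        proof
          fix r assume r: "r \<in> A"
          have rc: "r \<in> carrier R" using r A(1) by blast
          have "r \<odot>\<^bsub>M\<^esub> g \<in> ?D1" if g: "g \<in> set hs" for g
          proof -
            have "r \<odot>\<^bsub>M\<^esub> g \<in> set es" using r g unfolding es_iff by blast
            then have "\<one> \<odot>\<^bsub>M\<^esub> (r \<odot>\<^bsub>M\<^esub> g) \<in> ?D1" by (rule M.lin_span_mem[OF oneideal D one_closed esc])
            then show ?thesis using g hsc rc by auto
          qed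
          then have "set hs \<subseteq> {x \<in> carrier M. r \<odot>\<^bsub>M\<^esub> x \<in> ?D1}" using hsc by blast
          then have "{x \<in> carrier M. r \<odot>\<^bsub>M\<^esub> x \<in> ?D1} = carrier M"
            by (rule generatesD(2)[OF hs M.smult_vimage[OF rc D1]])
          then show "r \<in> {r \<in> carrier R. \<forall>x\<in>carrier M. r \<odot>\<^bsub>M\<^esub> x \<in> ?D1}" using rc by blast
        qed
        then have "Idl A \<subseteq> {r \<in> carrier R. \<forall>x\<in>carrier M. r \<odot>\<^bsub>M\<^esub> x \<in> ?D1}"
          by (rule genideal_minimal[OF M.ideal_multipliers[OF D1]])
        then show ?thesis unfolding A(3)[symmetric] using a x by blast
      qed
      show "?Ta \<subseteq> ?D1"
      proof (rule M.ideal_span_least[OF D1])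
        show "{\<zero>\<^bsub>M\<^esub>} \<subseteq> ?D1" using M.submodule_zero[OF D1] by simp
        fix j x assume j: "j \<in> \<aa> <+> I" and x: "x \<in> carrier M"
        show "j \<odot>\<^bsub>M\<^esub> x \<in> ?D1"
        proof (rule span_mem_add[OF \<aa> I D1 x j])
          show "a \<odot>\<^bsub>M\<^esub> x \<in> ?D1" if "a \<in> I" for a using mT0[of a x] that x T0D DD1 by blast
        qed (use aD1 x in blast)
      qed
    qed
    moreover have "mlen ((\<aa> \<inter> P) <+> I) = local_length R M \<mm> ?T0 ?D
        + (local_length R M \<mm> ?D ?D1 + local_length R M \<mm> ?D1 (carrier M))"
      unfolding mlen_def
      using V.local_length_additive[OF D M.carrier_is_submodule T0D M.submoduleE(1)[OF D]]
        V.local_length_additive[OF D1 M.carrier_is_submodule DD1 M.submoduleE(1)[OF D1]] by simp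
    ultimately have "mlen ((\<aa> \<inter> P) <+> I) \<le> mlen (P <+> I)
      + (of_nat (length es) * colength \<mm> ((P <+> PIdl s) <+> I) + mlen (\<aa> <+> I))"
      by (simp add: add_mono)
    then show ?thesis by (simp add: ac_simps)
  qed
  then show ?thesis by blast
qed

text \<open>For A = (\<aa> + I)M and B = (P + I)M, the lengths of M/A and M/B add up to at most
  those of M/(A \<inter> B) and M/(A + B). The former is a quotient of M/(\<aa> \<inter> P + I)M,
  the latter is killed by P + (s) + I since s lies in \<aa>.\<close>

lemma mlen_inter_ge:
  assumes \<aa>: "ideal \<aa> R" and P: "primeideal P R" and s: "s \<in> \<aa>" and I: "ideal I R"
  shows "mlen (\<aa> <+> I) + mlen (P <+> I)
    \<le> mlen ((\<aa> \<inter> P) <+> I) + of_nat (length hs) * colength \<mm> ((P <+> PIdl s) <+> I)"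
proof -
  interpret V: prime_module R M \<mm> using M.module_axioms prime_max by (simp add: prime_module_def)
  interpret id: linear_map_pair R M M "\<lambda>x. x"
    using M.linear_map_id M.module_axioms by (simp add: linear_map_pair_def linear_map_pair_axioms_def)
  note Pi = primeideal.axioms(1)[OF P]
  have sc: "s \<in> carrier R" using ideal.Icarr[OF \<aa> s] .
  note W = ideal_add_mem[OF Pi cgenideal_ideal[OF sc]]
  note b = i_intersect[OF \<aa> Pi]
  let ?T0 = "ideal_span R M {\<zero>\<^bsub>M\<^esub>} ((\<aa> \<inter> P) <+> I)"
  let ?B = "ideal_span R M {\<zero>\<^bsub>M\<^esub>} (P <+> I)"
  let ?A = "ideal_span R M {\<zero>\<^bsub>M\<^esub>} (\<aa> <+> I)"
  let ?c = "carrier M" and ?l = "local_length R M \<mm>"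
  note bI = ideal_add_mem[OF b I] and PI = ideal_add_mem[OF Pi I] and aI = ideal_add_mem[OF \<aa> I]
  have T0: "submodule ?T0 R M" and B: "submodule ?B R M" and A: "submodule ?A R M"
    using span_submodule bI(1) PI(1) aI(1) by blast+
  have AB: "submodule (?A <+>\<^bsub>M\<^esub> ?B) R M" and IAB: "submodule (?A \<inter> ?B) R M"
    using M.submodule_set_add[OF A B] M.submodule_Int[OF A B] by auto
  note uA = M.set_add_upper1[OF A B] and uB = M.set_add_upper2[OF A B]
  note car = M.carrier_is_submodule
  have 1: "?l ?B (?A <+>\<^bsub>M\<^esub> ?B) \<le> ?l (?A \<inter> ?B) ?A"
  proof (rule id.local_length_le_of_surj[OF prime_max A B AB _ uB])
    show "local_le R M \<mm> (?A <+>\<^bsub>M\<^esub> ?B) ((\<lambda>x. x) ` ?A <+>\<^bsub>M\<^esub> ?B)"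
      using V.local_le_subset[OF subset_refl M.submoduleE(1)[OF AB]] by simp
  qed auto
  have 2: "?l ?B ?c = ?l ?B (?A <+>\<^bsub>M\<^esub> ?B) + ?l (?A <+>\<^bsub>M\<^esub> ?B) ?c"
    by (rule V.local_length_additive[OF AB car uB M.submoduleE(1)[OF AB]])
  have 3: "?l (?A \<inter> ?B) ?c = ?l (?A \<inter> ?B) ?A + ?l ?A ?c"
    by (rule V.local_length_additive[OF A car _ M.submoduleE(1)[OF A]]) simp
  have 4: "?l (?A \<inter> ?B) ?c \<le> ?l ?T0 ?c"
  proof (rule V.local_length_mono[OF car car _ M.submoduleE(1)[OF IAB] subset_refl])
    have c: "P <+> I \<subseteq> carrier R" "\<aa> <+> I \<subseteq> carrier R"
      using ideal.Icarr[OF PI(1)] ideal.Icarr[OF aI(1)] by auto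
    have i: "\<aa> \<inter> P <+> I \<subseteq> P <+> I" "\<aa> \<inter> P <+> I \<subseteq> \<aa> <+> I"
      using ideal_add_least[OF PI(1) _ PI(3), of "\<aa> \<inter> P"] PI(2)
        ideal_add_least[OF aI(1) _ aI(3), of "\<aa> \<inter> P"] aI(2) by blast+
    show "?T0 \<subseteq> ?A \<inter> ?B"
      using M.ideal_span_mono[OF _ c(1) subset_refl i(1)] M.ideal_span_mono[OF _ c(2) subset_refl i(2)] by simp
  qed
  have 5: "?l (?A <+>\<^bsub>M\<^esub> ?B) ?c \<le> of_nat (length hs) * colength \<mm> ((P <+> PIdl s) <+> I)"
  proof (rule M.length_quotient_le[OF prime_max ideal_add_mem(1)[OF W(1) I] AB hs])
    fix g j assume g: "g \<in> set hs" and j: "j \<in> (P <+> PIdl s) <+> I"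
    have gc: "g \<in> carrier M" using g generatesD(1)[OF hs] by blast
    have mB: "r \<odot>\<^bsub>M\<^esub> g \<in> ?A <+>\<^bsub>M\<^esub> ?B" if "r \<in> P \<or> r \<in> I" for r
      using M.ideal_span_mem[of r "P <+> I" g] that gc PI(2,3) uB by blast
    show "j \<odot>\<^bsub>M\<^esub> g \<in> ?A <+>\<^bsub>M\<^esub> ?B"
    proof (rule span_mem_add[OF W(1) I AB gc j])
      show "w \<odot>\<^bsub>M\<^esub> g \<in> ?A <+>\<^bsub>M\<^esub> ?B" if w: "w \<in> P <+> PIdl s" for w
      proof (rule span_mem_add[OF Pi cgenideal_ideal[OF sc] AB gc w])
        fix r assume "r \<in> PIdl s"
        then have "r \<in> \<aa>" using cgenideal_minimal[OF \<aa> s] by blast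
        then show "r \<odot>\<^bsub>M\<^esub> g \<in> ?A <+>\<^bsub>M\<^esub> ?B"
          using M.ideal_span_mem[of r "\<aa> <+> I" g] gc aI(2) uA by blast
      qed (use mB in blast)
    qed (use mB in blast)
  qed
  have "mlen (\<aa> <+> I) + mlen (P <+> I)
      = ?l ?A ?c + (?l ?B (?A <+>\<^bsub>M\<^esub> ?B) + ?l (?A <+>\<^bsub>M\<^esub> ?B) ?c)"
    unfolding mlen_def 2 ..
  also have "\<dots> \<le> ?l ?A ?c + (?l (?A \<inter> ?B) ?A + ?l (?A <+>\<^bsub>M\<^esub> ?B) ?c)"
    using 1 by (intro add_left_mono add_right_mono)
  also have "\<dots> = ?l (?A \<inter> ?B) ?c + ?l (?A <+>\<^bsub>M\<^esub> ?B) ?c" unfolding 3 by (simp add: ac_simps)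
  also have "\<dots> \<le> ?l ?T0 ?c + of_nat (length hs) * colength \<mm> ((P <+> PIdl s) <+> I)"
    using 4 5 by (rule add_mono)
  finally show ?thesis unfolding mlen_def .
qed

text \<open>If some s in \<aa> lies outside P, then up to the error \<open>ml\<close> at the
  intersection is the sum of its values at \<aa> and at P, for I as well as for I^[p]. If \<aa> lies
  in P, the intersection is \<aa> itself; so primes that contribute nothing new to an intersection
  do no harm.\<close>

lemma stable_inter:
  assumes \<aa>: "ideal \<aa> R" and P: "primeideal P R" and st: "stable \<aa>"
  shows "stable (\<aa> \<inter> P)"
proof (cases "\<aa> \<subseteq> P")
  case True
  then have "\<aa> \<inter> P = \<aa>" by blast
  then show ?thesis using st by simp
next
  case False
  then obtain s where s: "s \<in> \<aa>" "s \<notin> P" by blast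
  note Pi = primeideal.axioms(1)[OF P]
  have sc: "s \<in> carrier R" using ideal.Icarr[OF \<aa> s(1)] .
  note W = psubset_add_PIdl[OF Pi sc s(2)]
  note b = i_intersect[OF \<aa> Pi]
  obtain m :: nat where m: "\<And>I. ideal I R \<Longrightarrow> mlen ((\<aa> \<inter> P) <+> I)
    \<le> mlen (\<aa> <+> I) + mlen (P <+> I) + of_nat m * colength \<mm> ((P <+> PIdl s) <+> I)"
    using mlen_inter_le[OF \<aa> P s] by blast
  obtain C where C: "C \<ge> 0" "\<And>e I. ideal I R \<Longrightarrow> P <+> PIdl s \<subseteq> I \<Longrightarrow> mpow e \<subseteq> I \<Longrightarrow>
      cl I * real p ^ e \<le> C * real p ^ (e * d)"
    using cl_growth[OF W(1) dim_less_of_prime[OF P W(2)]] by blast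
  obtain Ca where Ca: "Ca \<ge> 0" "\<And>e I. ideal I R \<Longrightarrow> mpow e \<subseteq> I \<Longrightarrow>
    \<bar>ml (\<aa> <+> frob_power R p I) - real p ^ d * ml (\<aa> <+> I)\<bar> * real p ^ e \<le> Ca * real p ^ (e * d)"
    using st unfolding stable_def by blast
  obtain Cp where Cp: "Cp \<ge> 0" "\<And>e I. ideal I R \<Longrightarrow> mpow e \<subseteq> I \<Longrightarrow>
    \<bar>ml (P <+> frob_power R p I) - real p ^ d * ml (P <+> I)\<bar> * real p ^ e \<le> Cp * real p ^ (e * d)"
    using stable_prime[OF P] unfolding stable_def by blast
  define N where "N = real m + real (length hs)"
  let ?x = "\<lambda>I. ml ((\<aa> \<inter> P) <+> I) - ml (\<aa> <+> I) - ml (P <+> I)"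
  have x: "\<bar>?x I\<bar> * real p ^ e \<le> N * C * real p ^ (e * d)" if I: "ideal I R" "mpow e \<subseteq> I" for e I
  proof -
    let ?J = "(P <+> PIdl s) <+> I"
    note A0 = add_mpow[OF b I] and A1 = add_mpow[OF \<aa> I] and A2 = add_mpow[OF Pi I] and B = add_mpow[OF W(1) I]
    note f = mlen_finite[OF A0(1,3)] mlen_finite[OF A1(1,3)] mlen_finite[OF A2(1,3)]
      colength_finite_of_mpow[OF B(1,3)]
    have "ml ((\<aa> \<inter> P) <+> I) \<le> ml (\<aa> <+> I) + ml (P <+> I) + m * cl ?J"
      using real_of_enat_mono[OF m[OF I(1)]] f
      by (simp add: ml_def cl_def real_of_enat_add real_of_enat_mult enat_add_finite enat_mult_finite)
    moreover have "ml (\<aa> <+> I) + ml (P <+> I) \<le> ml ((\<aa> \<inter> P) <+> I) + length hs * cl ?J"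
      using real_of_enat_mono[OF mlen_inter_ge[OF \<aa> P s(1) I(1)]] f
      by (simp add: ml_def cl_def real_of_enat_add real_of_enat_mult enat_add_finite enat_mult_finite)
    moreover have "0 \<le> m * cl ?J" "0 \<le> length hs * cl ?J" by (simp_all add: cl_def)
    ultimately have "\<bar>?x I\<bar> \<le> N * cl ?J" by (simp add: N_def distrib_right)
    then have "\<bar>?x I\<bar> * real p ^ e \<le> N * cl ?J * real p ^ e" by (rule mult_right_mono) simp
    also have "\<dots> \<le> N * (C * real p ^ (e * d))"
      unfolding mult.assoc[of N] by (rule mult_left_mono[OF C(2)[OF B]]) (simp add: N_def)
    finally show ?thesis by (simp add: mult.assoc)
  qed
  show ?thesis
  proof (rule stableI)
    show "0 \<le> N * C * real p ^ d + real p ^ d * (N * C) + Ca + Cp" using C(1) Ca(1) Cp(1) by (simp add: N_def)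
    fix e I assume I: "ideal I R" "mpow e \<subseteq> I"
    let ?F = "frob_power R p I" and ?q = "real p ^ e" and ?E = "real p ^ (e * d)"
    let ?y = "ml (\<aa> <+> ?F) - real p ^ d * ml (\<aa> <+> I)"
    let ?z = "ml (P <+> ?F) - real p ^ d * ml (P <+> I)"
    have 1: "\<bar>?x ?F\<bar> * ?q \<le> N * C * real p ^ d * ?E"
      using shift_bound[OF x[OF ideal_frob[OF I(1)] mpow_Suc[OF I]]] by simp
    have 2: "real p ^ d * (\<bar>?x I\<bar> * ?q) \<le> real p ^ d * (N * C * ?E)"
      using mult_left_mono[OF x[OF I], of "real p ^ d"] by simp
    note 3 = Ca(2)[OF I] and 4 = Cp(2)[OF I]
    have eq: "ml (\<aa> \<inter> P <+> ?F) - real p ^ d * ml (\<aa> \<inter> P <+> I) = ?x ?F + (?y + ?z) - real p ^ d * ?x I"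
      by (simp add: algebra_simps)
    have "\<bar>ml (\<aa> \<inter> P <+> ?F) - real p ^ d * ml (\<aa> \<inter> P <+> I)\<bar>
        \<le> \<bar>?x ?F\<bar> + \<bar>?y + ?z\<bar> + \<bar>real p ^ d * ?x I\<bar>"
      unfolding eq by (rule abs_add_diff_le)
    also have "\<dots> \<le> \<bar>?x ?F\<bar> + (\<bar>?y\<bar> + \<bar>?z\<bar>) + \<bar>real p ^ d * ?x I\<bar>"
      by (intro add_mono order_refl abs_triangle_ineq)
    also have "\<dots> = \<bar>?x ?F\<bar> + \<bar>real p ^ d * ?x I\<bar> + \<bar>?y\<bar> + \<bar>?z\<bar>" by (simp only: add_ac)
    also have "\<dots> = \<bar>?x ?F\<bar> + real p ^ d * \<bar>?x I\<bar> + \<bar>?y\<bar> + \<bar>?z\<bar>"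
      by (simp only: abs_mult power_abs abs_of_nat)
    finally have "\<bar>ml (\<aa> \<inter> P <+> ?F) - real p ^ d * ml (\<aa> \<inter> P <+> I)\<bar> * ?q
      \<le> (\<bar>?x ?F\<bar> + real p ^ d * \<bar>?x I\<bar> + \<bar>?y\<bar> + \<bar>?z\<bar>) * ?q"
      by (rule mult_right_mono) simp
    also have "\<dots> = \<bar>?x ?F\<bar> * ?q + real p ^ d * (\<bar>?x I\<bar> * ?q) + \<bar>?y\<bar> * ?q + \<bar>?z\<bar> * ?q"
      by (simp only: distrib_right mult.assoc)
    also have "\<dots> \<le> N * C * real p ^ d * ?E + real p ^ d * (N * C * ?E) + Ca * ?E + Cp * ?E"
      using 1 2 3 4 by (intro add_mono)
    also have "\<dots> = (N * C * real p ^ d + real p ^ d * (N * C) + Ca + Cp) * ?E"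
      by (simp only: distrib_right mult.assoc)
    finally show "\<bar>ml (\<aa> \<inter> P <+> ?F) - real p ^ d * ml (\<aa> \<inter> P <+> I)\<bar> * ?q
      \<le> (N * C * real p ^ d + real p ^ d * (N * C) + Ca + Cp) * ?E" .
  qed
qed

lemma stable_carrier: "stable (carrier R)"
proof (rule stableI[of 0])
  have "ml (carrier R <+> I) = 0" if I: "ideal I R" for I
  proof -
    note A = ideal_add_mem[OF oneideal I]
    have "\<one> \<notin> \<mm>" using ideal.one_imp_carrier[OF ideal_max] primeideal.I_notcarr[OF prime_max] by blast
    then have "colength \<mm> (carrier R <+> I) = 0" using colength_eq_0[OF prime_max A(1)] A(2) by blast
    then show ?thesis using mlen_le[OF A(1)] by (simp add: ml_def)
  qed
  then show "\<bar>ml (carrier R <+> frob_power R p I) - real p ^ d * ml (carrier R <+> I)\<bar> * real p ^ e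
      \<le> 0 * real p ^ (e * d)" if "ideal I R" for e I
    using that ideal_frob by simp
qed simp

lemma stable_Inter_primes:
  "\<forall>P\<in>set Ps. primeideal P R \<Longrightarrow>
    ideal {x \<in> carrier R. \<forall>P\<in>set Ps. x \<in> P} R \<and> stable {x \<in> carrier R. \<forall>P\<in>set Ps. x \<in> P}"
proof (induction Ps)
  case Nil
  then show ?case using stable_carrier oneideal by simp
next
  case (Cons P Ps)
  have eq: "{x \<in> carrier R. \<forall>P\<in>set (P # Ps). x \<in> P} = {x \<in> carrier R. \<forall>P\<in>set Ps. x \<in> P} \<inter> P" by auto
  have P: "primeideal P R" using Cons.prems by simp
  show ?case
    unfolding eq using Cons stable_inter[OF _ P] i_intersect[OF _ primeideal.axioms(1)[OF P]] by simp
qed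

text \<open>In a reduced ring the primes found for the zero ideal intersect in 0.\<close>

lemma stable_zero:
  assumes red: "reduced R" shows "stable {\<zero>}"
proof -
  obtain Ps where Ps: "\<forall>P\<in>set Ps. primeideal P R"
    "\<And>x. x \<in> carrier R \<Longrightarrow> \<forall>P\<in>set Ps. x \<in> P \<Longrightarrow> \<exists>n::nat. x [^] n \<in> {\<zero>}"
    using exists_primes_radical[OF zeroideal] by blast
  have "{x \<in> carrier R. \<forall>P\<in>set Ps. x \<in> P} = {\<zero>}"
  proof
    show "{x \<in> carrier R. \<forall>P\<in>set Ps. x \<in> P} \<subseteq> {\<zero>}" using Ps(2) red unfolding reduced_def by blast
    show "{\<zero>} \<subseteq> {x \<in> carrier R. \<forall>P\<in>set Ps. x \<in> P}"
      using additive_subgroup.zero_closed[OF ideal.axioms(1)[OF conjunct1[OF stable_Inter_primes[OF Ps(1)]]]]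
      by simp
  qed
  then show ?thesis using stable_Inter_primes[OF Ps(1)] by simp
qed

text \<open>The normalized length \<open>x j\<close> of M/I^[p^j]M changes from j to j + 1 by at
  most B / 2^j, where B is the error at I; the geometric series gives the factor 2. Taking C0 + 1
  instead of C0 makes the constant positive.\<close>

theorem frobenius_stability:
  assumes red: "reduced R"
  shows "\<exists>C>0. \<forall>e n I. ideal I R \<longrightarrow> mpow e \<subseteq> I \<longrightarrow>
    \<bar>ml I - ml (frob_power R (p ^ n) I) / real p ^ (n * d)\<bar> \<le> C * (real p ^ (e * d) / real p ^ e)"
proof -
  obtain C0 where C0: "C0 \<ge> 0" "\<And>e I. ideal I R \<Longrightarrow> mpow e \<subseteq> I \<Longrightarrow>
    \<bar>ml ({\<zero>} <+> frob_power R p I) - real p ^ d * ml ({\<zero>} <+> I)\<bar> * real p ^ e \<le> C0 * real p ^ (e * d)"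
    using stable_zero[OF red] unfolding stable_def by blast
  have z: "{\<zero>} <+> J = J" if "ideal J R" for J
    using ideal.Icarr[OF that] by (simp add: set_add_def')
  have step: "\<bar>ml (frob_power R p I) - real p ^ d * ml I\<bar> * real p ^ e \<le> C0 * real p ^ (e * d)"
    if I: "ideal I R" "mpow e \<subseteq> I" for e I
    using C0(2)[OF I] z[OF I(1)] z[OF ideal_frob[OF I(1)]] by simp
  have p2: "2 \<le> real p" using prime prime_ge_2_nat[of p] of_nat_le_iff[of 2 p, where 'a = real] by simp
  have "\<bar>ml I - ml (frob_power R (p ^ n) I) / real p ^ (n * d)\<bar> \<le> 2 * (C0 + 1) * (real p ^ (e * d) / real p ^ e)"
    if I: "ideal I R" "mpow e \<subseteq> I" for e n I
  proof -
    define B where "B = C0 * (real p ^ (e * d) / real p ^ e)"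
    define x where "x j = ml (frob_power R (p ^ j) I) / real p ^ (j * d)" for j
    have B0: "0 \<le> B" using C0(1) by (simp add: B_def)
    have Ic: "I \<subseteq> carrier R" using ideal.Icarr[OF I(1)] by blast
    have diff: "\<bar>x (Suc j) - x j\<bar> \<le> B * (1 / 2) ^ j" for j
    proof -
      let ?J = "frob_power R (p ^ j) I"
      have J: "ideal ?J R" using ideal_frob[OF I(1)] .
      have "mpow (e + j) \<subseteq> ?J"
        using frob_power_frob_power[OF max_carrier, of j e] frob_power_mono[OF Ic I(2), of "p ^ j"] by simp
      from step[OF J this]
      have s: "\<bar>ml (frob_power R p ?J) - real p ^ d * ml ?J\<bar> \<le> C0 * real p ^ ((e + j) * d) / real p ^ (e + j)"
        using p2 by (simp add: pos_le_divide_eq)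
      have "frob_power R p ?J = frob_power R (p ^ Suc j) I"
        using frob_power_frob_power[OF Ic, where j = 1 and i = j] by simp
      then have "x (Suc j) - x j = (ml (frob_power R p ?J) - real p ^ d * ml ?J) / real p ^ (Suc j * d)"
        using p2 by (simp add: x_def diff_divide_distrib power_add)
      then have "\<bar>x (Suc j) - x j\<bar> = \<bar>ml (frob_power R p ?J) - real p ^ d * ml ?J\<bar> / real p ^ (Suc j * d)"
        by (simp add: abs_divide)
      also have "\<dots> \<le> (C0 * real p ^ ((e + j) * d) / real p ^ (e + j)) / real p ^ (Suc j * d)"
        using s by (rule divide_right_mono) simp
      \<comment> \<open>The growth p^(j d) of the error cancels against the normalization. What
        remains is 1/p^j, from the shift of e to e + j, and 1/p^d.\<close>
      also have "\<dots> = B * (1 / (real p ^ j * real p ^ d))"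
        using p2 by (simp add: B_def add_mult_distrib power_add)
      also have "\<dots> \<le> B * (1 / 2) ^ j"
      proof (rule mult_left_mono[OF _ B0])
        have "2 ^ j * 1 \<le> real p ^ j * real p ^ d"
          using p2 by (intro mult_mono power_mono one_le_power) auto
        then show "1 / (real p ^ j * real p ^ d) \<le> (1 / 2) ^ j"
          by (simp add: power_one_over frac_le)
      qed
      finally show ?thesis .
    qed
    have "\<bar>x n - x 0\<bar> \<le> 2 * B * (1 - (1 / 2) ^ n)"
    proof (induction n)
      case (Suc n)
      have "\<bar>x (Suc n) - x 0\<bar> \<le> \<bar>x (Suc n) - x n\<bar> + \<bar>x n - x 0\<bar>" by linarith
      also have "\<dots> \<le> B * (1 / 2) ^ n + 2 * B * (1 - (1 / 2) ^ n)" using diff[of n] Suc by linarith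
      also have "\<dots> = 2 * B * (1 - (1 / 2) ^ Suc n)" by (simp add: algebra_simps)
      finally show ?case .
    qed simp
    also have "\<dots> \<le> 2 * B" using B0 mult_left_mono[of "1 - (1 / 2) ^ n" 1 "2 * B"] by simp
    also have "\<dots> \<le> 2 * (C0 + 1) * (real p ^ (e * d) / real p ^ e)"
      unfolding B_def mult.assoc[symmetric] by (rule mult_right_mono) simp_all
    finally show ?thesis using frob_power_1[OF I(1)] by (simp add: x_def abs_minus_commute)
  qed
  then show ?thesis using C0(1) by (intro exI[of _ "2 * (C0 + 1)"]) auto
qed

end

section \<open>Tensor products with a residue ring\<close>

context module
begin

lemma abelian_subgroup_submodule:
  assumes "submodule N R M" shows "abelian_subgroup N M"
  by (rule abelian_subgroupI3[OF additive_subgroupI[OF submodule.axioms(1)[OF assms]] M.abelian_group_axioms])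

lemma quot_module_simps:
  "carrier (quot_module M N) = {N +>\<^bsub>M\<^esub> x | x. x \<in> carrier M}"
  "\<zero>\<^bsub>quot_module M N\<^esub> = N"
  "A \<oplus>\<^bsub>quot_module M N\<^esub> B = A <+>\<^bsub>M\<^esub> B"
  by (auto simp: quot_module_def A_RCOSETS_def')

lemma quot_module_smult:
  assumes N: "submodule N R M" and r: "r \<in> carrier R" and x: "x \<in> carrier M"
  shows "r \<odot>\<^bsub>quot_module M N\<^esub> (N +>\<^bsub>M\<^esub> x) = N +>\<^bsub>M\<^esub> (r \<odot>\<^bsub>M\<^esub> x)"
proof -
  interpret N: abelian_subgroup N M using abelian_subgroup_submodule[OF N] .
  have *: "N +>\<^bsub>M\<^esub> (r \<odot>\<^bsub>M\<^esub> y) = N +>\<^bsub>M\<^esub> (r \<odot>\<^bsub>M\<^esub> x)" if y: "y \<in> N +>\<^bsub>M\<^esub> x" for y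
  proof -
    obtain n where n: "n \<in> N" "y = n \<oplus>\<^bsub>M\<^esub> x" using y unfolding a_r_coset_def' by blast
    have "r \<odot>\<^bsub>M\<^esub> y = r \<odot>\<^bsub>M\<^esub> n \<oplus>\<^bsub>M\<^esub> r \<odot>\<^bsub>M\<^esub> x"
      using n r x submodule_mem_carrier[OF N n(1)] by (simp add: smult_r_distr)
    then have "r \<odot>\<^bsub>M\<^esub> y \<in> N +>\<^bsub>M\<^esub> (r \<odot>\<^bsub>M\<^esub> x)"
      unfolding a_r_coset_def' by (intro UN_I[OF submoduleE(4)[OF N r n(1)]]) simp
    then show ?thesis using N.a_repr_independence'[of "r \<odot>\<^bsub>M\<^esub> y" "r \<odot>\<^bsub>M\<^esub> x"] r x by simp
  qed
  have "x \<in> N +>\<^bsub>M\<^esub> x" using N.a_rcos_self[OF x] .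
  moreover have "(\<Union>y\<in>N +>\<^bsub>M\<^esub> x. N +>\<^bsub>M\<^esub> (r \<odot>\<^bsub>M\<^esub> y)) = (\<Union>y\<in>N +>\<^bsub>M\<^esub> x. N +>\<^bsub>M\<^esub> (r \<odot>\<^bsub>M\<^esub> x))"
    by (rule SUP_cong[OF refl *])
  ultimately show ?thesis unfolding quot_module_def by auto
qed

lemma module_quot_module:
  assumes N: "submodule N R M" shows "module R (quot_module M N)"
proof -
  interpret N: abelian_subgroup N M using abelian_subgroup_submodule[OF N] .
  note sum = N.a_rcos_sum and sm = quot_module_smult[OF N]
  have N0: "N = N +>\<^bsub>M\<^esub> \<zero>\<^bsub>M\<^esub>" using M.a_coset_add_zero[OF submoduleE(1)[OF N]] by simp
  show ?thesis
  proof (rule moduleI)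
    show "abelian_group (quot_module M N)"
    proof (rule abelian_groupI)
      fix A B assume "A \<in> carrier (quot_module M N)" "B \<in> carrier (quot_module M N)"
      then obtain a b where ab: "a \<in> carrier M" "b \<in> carrier M" "A = N +>\<^bsub>M\<^esub> a" "B = N +>\<^bsub>M\<^esub> b"
        by (auto simp: quot_module_simps)
      show "A \<oplus>\<^bsub>quot_module M N\<^esub> B \<in> carrier (quot_module M N)"
        using ab by (auto simp: quot_module_simps sum)
      show "A \<oplus>\<^bsub>quot_module M N\<^esub> B = B \<oplus>\<^bsub>quot_module M N\<^esub> A"
        using ab by (simp add: quot_module_simps sum M.a_comm)
      fix C assume "C \<in> carrier (quot_module M N)"
      then obtain c where "c \<in> carrier M" "C = N +>\<^bsub>M\<^esub> c" by (auto simp: quot_module_simps)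
      then show "A \<oplus>\<^bsub>quot_module M N\<^esub> B \<oplus>\<^bsub>quot_module M N\<^esub> C
          = A \<oplus>\<^bsub>quot_module M N\<^esub> (B \<oplus>\<^bsub>quot_module M N\<^esub> C)"
        using ab by (simp add: quot_module_simps sum M.a_assoc)
    next
      show "\<zero>\<^bsub>quot_module M N\<^esub> \<in> carrier (quot_module M N)" using N0 by (auto simp: quot_module_simps)
    next
      fix A assume "A \<in> carrier (quot_module M N)"
      then obtain a where a: "a \<in> carrier M" "A = N +>\<^bsub>M\<^esub> a" by (auto simp: quot_module_simps)
      have "\<zero>\<^bsub>quot_module M N\<^esub> \<oplus>\<^bsub>quot_module M N\<^esub> A = (N +>\<^bsub>M\<^esub> \<zero>\<^bsub>M\<^esub>) <+>\<^bsub>M\<^esub> (N +>\<^bsub>M\<^esub> a)"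
        using N0 a(2) by (simp add: quot_module_simps)
      then show "\<zero>\<^bsub>quot_module M N\<^esub> \<oplus>\<^bsub>quot_module M N\<^esub> A = A" using a by (simp add: sum)
      have "(N +>\<^bsub>M\<^esub> \<ominus>\<^bsub>M\<^esub> a) <+>\<^bsub>M\<^esub> (N +>\<^bsub>M\<^esub> a) = N +>\<^bsub>M\<^esub> \<zero>\<^bsub>M\<^esub>" using a by (simp add: sum M.l_neg)
      then show "\<exists>B\<in>carrier (quot_module M N). B \<oplus>\<^bsub>quot_module M N\<^esub> A = \<zero>\<^bsub>quot_module M N\<^esub>"
        using a N0 by (intro bexI[of _ "N +>\<^bsub>M\<^esub> \<ominus>\<^bsub>M\<^esub> a"]) (auto simp: quot_module_simps)
    qed
  next
    fix r A assume r: "r \<in> carrier R" and "A \<in> carrier (quot_module M N)"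
    then obtain a where a: "a \<in> carrier M" "A = N +>\<^bsub>M\<^esub> a" by (auto simp: quot_module_simps)
    show "r \<odot>\<^bsub>quot_module M N\<^esub> A \<in> carrier (quot_module M N)"
      using r a by (auto simp: sm) (auto simp: quot_module_simps)
    fix s assume s: "s \<in> carrier R"
    show "(r \<oplus> s) \<odot>\<^bsub>quot_module M N\<^esub> A
        = r \<odot>\<^bsub>quot_module M N\<^esub> A \<oplus>\<^bsub>quot_module M N\<^esub> s \<odot>\<^bsub>quot_module M N\<^esub> A"
      using r s a by (simp add: sm quot_module_simps(3) sum smult_l_distr)
    show "(r \<otimes> s) \<odot>\<^bsub>quot_module M N\<^esub> A = r \<odot>\<^bsub>quot_module M N\<^esub> (s \<odot>\<^bsub>quot_module M N\<^esub> A)"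
      using r s a by (simp add: sm smult_assoc1)
  next
    fix A assume "A \<in> carrier (quot_module M N)"
    then obtain a where a: "a \<in> carrier M" "A = N +>\<^bsub>M\<^esub> a" by (auto simp: quot_module_simps)
    then show "\<one> \<odot>\<^bsub>quot_module M N\<^esub> A = A" by (simp add: sm)
  next
    fix r A B assume r: "r \<in> carrier R"
      and "A \<in> carrier (quot_module M N)" "B \<in> carrier (quot_module M N)"
    then obtain a b where ab: "a \<in> carrier M" "b \<in> carrier M" "A = N +>\<^bsub>M\<^esub> a" "B = N +>\<^bsub>M\<^esub> b"
      by (auto simp: quot_module_simps)
    then show "r \<odot>\<^bsub>quot_module M N\<^esub> (A \<oplus>\<^bsub>quot_module M N\<^esub> B)
        = r \<odot>\<^bsub>quot_module M N\<^esub> A \<oplus>\<^bsub>quot_module M N\<^esub> r \<odot>\<^bsub>quot_module M N\<^esub> B"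
      using r by (simp add: sm quot_module_simps(3) sum smult_r_distr)
  qed (rule R.cring_axioms)
qed

lemma linear_map_quot_module:
  assumes N: "submodule N R M" shows "linear_map R M (quot_module M N) (\<lambda>x. N +>\<^bsub>M\<^esub> x)"
proof -
  interpret N: abelian_subgroup N M using abelian_subgroup_submodule[OF N] .
  show ?thesis
    unfolding linear_map_def
    by (auto simp: quot_module_smult[OF N] quot_module_simps(3) N.a_rcos_sum) (auto simp: quot_module_simps)
qed

lemma quot_module_zero_iff:
  assumes N: "submodule N R M" and x: "x \<in> carrier M"
  shows "N +>\<^bsub>M\<^esub> x = N \<longleftrightarrow> x \<in> N"
proof -
  interpret N: abelian_subgroup N M using abelian_subgroup_submodule[OF N] .
  show ?thesis
    using N.a_rcos_self[OF x] M.a_coset_join2[OF x submodule.axioms(1)[OF N]] by auto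
qed

end

context F_finite_local_ring
begin

text \<open>Elements outside \<mm> are units, so localizing at \<mm> changes nothing.\<close>

lemma local_le_max_iff:
  assumes "module R M" "submodule A R M" "B \<subseteq> carrier M"
  shows "local_le R M \<mm> B A \<longleftrightarrow> B \<subseteq> A"
proof
  interpret M: prime_module R M \<mm> using assms(1) prime_max by (simp add: prime_module_def)
  show "local_le R M \<mm> B A" if "B \<subseteq> A" using M.local_le_subset[OF that M.submoduleE(1)[OF assms(2)]] .
  show "B \<subseteq> A" if le: "local_le R M \<mm> B A"
  proof
    fix x assume x: "x \<in> B"
    then obtain s where s: "s \<in> carrier R - \<mm>" "s \<odot>\<^bsub>M\<^esub> x \<in> A" using le unfolding local_le_def by blast
    obtain t where t: "t \<in> carrier R" "t \<otimes> s = \<one>" using complement_max_unit[OF s(1)] .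
    have xc: "x \<in> carrier M" using x assms(3) by blast
    have "x = t \<odot>\<^bsub>M\<^esub> (s \<odot>\<^bsub>M\<^esub> x)" using s(1) t xc by (simp flip: M.smult_assoc1)
    then show "x \<in> A" using M.submoduleE(4)[OF assms(2) t(1) s(2)] by simp
  qed
qed

text \<open>Chains indexed by a function and inductive chains have the same strict steps by
  \<open>local_le_max_iff\<close>. Both may start at any submodule, and the top of an inductive
  chain can be enlarged to all of M.\<close>

lemma module_length_eq_local_length:
  assumes M: "module R M"
  shows "module_length R M = local_length R M \<mm> {\<zero>\<^bsub>M\<^esub>} (carrier M)"
proof -
  interpret M: prime_module R M \<mm> using M prime_max by (simp add: prime_module_def)
  have "(\<exists>N. (\<forall>i\<le>n. submodule (N i) R M) \<and> (\<forall>i<n. N i \<subset> N (Suc i)))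
    \<longleftrightarrow> local_chain R M \<mm> {\<zero>\<^bsub>M\<^esub>} (carrier M) n" for n
  proof
    assume "\<exists>N. (\<forall>i\<le>n. submodule (N i) R M) \<and> (\<forall>i<n. N i \<subset> N (Suc i))"
    then obtain N where N: "\<And>i. i \<le> n \<Longrightarrow> submodule (N i) R M" "\<And>i. i < n \<Longrightarrow> N i \<subset> N (Suc i)" by blast
    have "local_chain R M \<mm> {\<zero>\<^bsub>M\<^esub>} (N i) i" if "i \<le> n" for i
      using that
    proof (induction i)
      case 0
      then show ?case using N(1) M.submodule_zero by (intro local_chain.base) auto
    next
      case (Suc i)
      have s: "submodule (N i) R M" "submodule (N (Suc i)) R M" "N i \<subset> N (Suc i)"
        using N(1)[of i] N(1)[of "Suc i"] N(2)[of i] Suc.prems by auto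
      have "\<not> local_le R M \<mm> (N (Suc i)) (N i)"
        using local_le_max_iff[OF M s(1) M.submoduleE(1)[OF s(2)]] s(3) by blast
      then show ?case using local_chain.step[OF Suc.IH s(2)] s(3) Suc.prems by auto
    qed
    then have "local_chain R M \<mm> {\<zero>\<^bsub>M\<^esub>} (N n) n" by simp
    then show "local_chain R M \<mm> {\<zero>\<^bsub>M\<^esub>} (carrier M) n"
      by (rule M.local_chain_mono[OF _ M.carrier_is_submodule]) (use N(1) M.submoduleE(1) in simp)
  next
    have *: "\<exists>N. N n = B \<and> (\<forall>i\<le>n. submodule (N i) R M) \<and> (\<forall>i<n. N i \<subset> N (Suc i))"
      if "local_chain R M \<mm> {\<zero>\<^bsub>M\<^esub>} B n" for B
      using that
    proof (induction rule: local_chain.induct)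
      case (base N)
      then show ?case by (intro exI[of _ "\<lambda>_. N"]) auto
    next
      case (step K n K')
      then obtain N where N: "N n = K" "\<And>i. i \<le> n \<Longrightarrow> submodule (N i) R M" "\<And>i. i < n \<Longrightarrow> N i \<subset> N (Suc i)"
        by blast
      have K: "submodule K R M" using local_chain_submodule[OF step.hyps(1)] .
      have "K \<subset> K'"
        using local_le_max_iff[OF M K M.submoduleE(1)[OF step.hyps(2)]] step.hyps(3,4) by blast
      then have "(N(Suc n := K')) i \<subset> (N(Suc n := K')) (Suc i)" if "i < Suc n" for i
        using that N(1) N(3)[of i] by (cases "i = n") auto
      moreover have "submodule ((N(Suc n := K')) i) R M" if "i \<le> Suc n" for i
        using that N(2)[of i] step.hyps(2) by (cases "i = Suc n") auto
      ultimately show ?case by (intro exI[of _ "N(Suc n := K')"]) auto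
    qed
    assume "local_chain R M \<mm> {\<zero>\<^bsub>M\<^esub>} (carrier M) n"
    from *[OF this] show "\<exists>N. (\<forall>i\<le>n. submodule (N i) R M) \<and> (\<forall>i<n. N i \<subset> N (Suc i))"
      by (elim exE conjE) (rule exI, rule conjI)
  qed
  then show ?thesis unfolding module_length_def local_length_def by simp
qed

text \<open>The projection is surjective with kernel N, so length is compared along it in both
  directions.\<close>

lemma module_length_quot_module:
  assumes M: "module R M" and N: "submodule N R M"
  shows "module_length R (quot_module M N) = local_length R M \<mm> N (carrier M)"
proof -
  interpret M: prime_module R M \<mm> using M prime_max by (simp add: prime_module_def)
  let ?T = "quot_module M N"
  have T: "module R ?T" by (rule M.module_quot_module[OF N])
  interpret T: prime_module R ?T \<mm> using T prime_max by (simp add: prime_module_def)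
  interpret f: linear_map_pair R M ?T "\<lambda>x. N +>\<^bsub>M\<^esub> x"
    using M T M.linear_map_quot_module[OF N] by (simp add: linear_map_pair_def linear_map_pair_axioms_def)
  have z: "submodule {\<zero>\<^bsub>?T\<^esub>} R ?T" by (rule T.submoduleI) auto
  have im: "(\<lambda>x. N +>\<^bsub>M\<^esub> x) ` carrier M = carrier ?T" by (auto simp: M.quot_module_simps)
  have Nc: "N \<subseteq> carrier M" using M.submoduleE(1)[OF N] .
  have "local_length R ?T \<mm> {\<zero>\<^bsub>?T\<^esub>} (carrier ?T) \<le> local_length R M \<mm> N (carrier M)"
  proof (rule f.local_length_le_of_surj[OF prime_max M.carrier_is_submodule z T.carrier_is_submodule Nc])
    show "(\<lambda>x. N +>\<^bsub>M\<^esub> x) ` N \<subseteq> {\<zero>\<^bsub>?T\<^esub>}"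
      using M.quot_module_zero_iff[OF N] Nc by (auto simp: M.quot_module_simps(2))
    show "local_le R ?T \<mm> (carrier ?T) ((\<lambda>x. N +>\<^bsub>M\<^esub> x) ` carrier M <+>\<^bsub>?T\<^esub> {\<zero>\<^bsub>?T\<^esub>})"
      unfolding im
      using T.local_le_subset[OF T.set_add_upper1[OF T.carrier_is_submodule z]
          T.submoduleE(1)[OF T.submodule_set_add[OF T.carrier_is_submodule z]]] .
  qed simp
  moreover have "local_length R M \<mm> N (carrier M) \<le> local_length R ?T \<mm> {\<zero>\<^bsub>?T\<^esub>} (carrier ?T)"
  proof (rule f.local_length_le_of_inj[OF prime_max M.carrier_is_submodule z T.carrier_is_submodule Nc])
    have "{x \<in> carrier M. N +>\<^bsub>M\<^esub> x \<in> {\<zero>\<^bsub>?T\<^esub>}} \<subseteq> N"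
      using M.quot_module_zero_iff[OF N] by (auto simp: M.quot_module_simps(2))
    then show "local_le R M \<mm> {x \<in> carrier M. N +>\<^bsub>M\<^esub> x \<in> {\<zero>\<^bsub>?T\<^esub>}} N"
      by (rule M.local_le_subset[OF _ Nc])
  qed (use im in auto)
  ultimately show ?thesis unfolding module_length_eq_local_length[OF T] by (rule order_antisym)
qed

end

section \<open>Congruence modulo a submodule\<close>

context module
begin

lemma diff_mem_sym:
  assumes "submodule H R M" "x \<in> carrier M" "y \<in> carrier M" "x \<ominus>\<^bsub>M\<^esub> y \<in> H"
  shows "y \<ominus>\<^bsub>M\<^esub> x \<in> H"
proof -
  have "\<ominus>\<^bsub>M\<^esub> (x \<ominus>\<^bsub>M\<^esub> y) = y \<ominus>\<^bsub>M\<^esub> x"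
    using assms by (simp add: a_minus_def M.minus_add M.a_comm)
  then show ?thesis using submoduleE(3)[OF assms(1,4)] by simp
qed

lemma diff_mem_trans:
  assumes "submodule H R M" "x \<in> carrier M" "y \<in> carrier M" "z \<in> carrier M"
    and "x \<ominus>\<^bsub>M\<^esub> y \<in> H" "y \<ominus>\<^bsub>M\<^esub> z \<in> H"
  shows "x \<ominus>\<^bsub>M\<^esub> z \<in> H"
proof -
  have "(x \<ominus>\<^bsub>M\<^esub> y) \<oplus>\<^bsub>M\<^esub> (y \<ominus>\<^bsub>M\<^esub> z) = x \<ominus>\<^bsub>M\<^esub> z"
    using assms(2-4) by (simp add: a_minus_def M.a_assoc M.r_neg1)
  then show ?thesis using submoduleE(5)[OF assms(1,5,6)] by simp
qed

lemma diff_mem_add: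
  assumes "submodule H R M" "x \<in> carrier M" "y \<in> carrier M" "x' \<in> carrier M" "y' \<in> carrier M"
    and "x \<ominus>\<^bsub>M\<^esub> y \<in> H" "x' \<ominus>\<^bsub>M\<^esub> y' \<in> H"
  shows "(x \<oplus>\<^bsub>M\<^esub> x') \<ominus>\<^bsub>M\<^esub> (y \<oplus>\<^bsub>M\<^esub> y') \<in> H"
proof -
  have "(x \<ominus>\<^bsub>M\<^esub> y) \<oplus>\<^bsub>M\<^esub> (x' \<ominus>\<^bsub>M\<^esub> y') = (x \<oplus>\<^bsub>M\<^esub> x') \<ominus>\<^bsub>M\<^esub> (y \<oplus>\<^bsub>M\<^esub> y')"
    using assms(2-5) by (simp add: a_minus_def M.minus_add M.a_ac)
  then show ?thesis using submoduleE(5)[OF assms(1,6,7)] by simp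
qed

lemma smult_minus:
  assumes "r \<in> carrier R" "x \<in> carrier M" "y \<in> carrier M"
  shows "r \<odot>\<^bsub>M\<^esub> (x \<ominus>\<^bsub>M\<^esub> y) = r \<odot>\<^bsub>M\<^esub> x \<ominus>\<^bsub>M\<^esub> r \<odot>\<^bsub>M\<^esub> y"
  using assms by (simp add: a_minus_def smult_r_distr smult_r_minus)

lemma diff_mem_smult:
  assumes "submodule H R M" "x \<in> carrier M" "y \<in> carrier M" "r \<in> carrier R" "x \<ominus>\<^bsub>M\<^esub> y \<in> H"
  shows "r \<odot>\<^bsub>M\<^esub> x \<ominus>\<^bsub>M\<^esub> r \<odot>\<^bsub>M\<^esub> y \<in> H"
  using submoduleE(4)[OF assms(1,4,5)] smult_minus[OF assms(4,2,3)] by simp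

lemma diff_mem_cancel:
  assumes "submodule H R M" "x \<in> carrier M" "y \<in> carrier M" "x \<ominus>\<^bsub>M\<^esub> y \<in> H" "y \<in> H"
  shows "x \<in> H"
proof -
  have "(x \<ominus>\<^bsub>M\<^esub> y) \<oplus>\<^bsub>M\<^esub> y = x" using assms(2,3) by (simp add: a_minus_def M.a_assoc M.l_neg)
  then show ?thesis using submoduleE(5)[OF assms(1,4,5)] by simp
qed

end

section \<open>Free modules and linear extension\<close>

context cring
begin

lemma free_module_simps:
  "f \<in> carrier (free_module R S) \<longleftrightarrow> range f \<subseteq> carrier R \<and> finite {i. f i \<noteq> \<zero>} \<and> {i. f i \<noteq> \<zero>} \<subseteq> S"
  "\<zero>\<^bsub>free_module R S\<^esub> = (\<lambda>i. \<zero>)"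
  "f \<oplus>\<^bsub>free_module R S\<^esub> g = (\<lambda>i. f i \<oplus> g i)"
  "r \<odot>\<^bsub>free_module R S\<^esub> f = (\<lambda>i. r \<otimes> f i)"
  by (simp_all add: free_module_def)

lemma free_moduleI:
  assumes "\<And>i. f i \<in> carrier R" "{i. f i \<noteq> \<zero>} \<subseteq> U" "finite U" "U \<subseteq> S"
  shows "f \<in> carrier (free_module R S)"
  unfolding free_module_simps using assms(1,4) finite_subset[OF assms(2,3)] order_trans[OF assms(2,4)] by blast

lemma free_module_closed: "f \<in> carrier (free_module R S) \<Longrightarrow> f i \<in> carrier R"
  by (auto simp: free_module_simps)

lemma free_module_support:
  assumes "f \<in> carrier (free_module R S)"
  shows "finite {i. f i \<noteq> \<zero>}" "{i. f i \<noteq> \<zero>} \<subseteq> S"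
  using assms by (auto simp: free_module_simps)

lemma free_module_add_closed:
  assumes f: "f \<in> carrier (free_module R S)" and g: "g \<in> carrier (free_module R S)"
  shows "(\<lambda>i. f i \<oplus> g i) \<in> carrier (free_module R S)"
proof (rule free_moduleI)
  show "{i. f i \<oplus> g i \<noteq> \<zero>} \<subseteq> {i. f i \<noteq> \<zero>} \<union> {i. g i \<noteq> \<zero>}" by auto
qed (use free_module_closed[OF f] free_module_closed[OF g] free_module_support[OF f]
    free_module_support[OF g] in auto)

lemma free_module_smult_closed:
  assumes f: "f \<in> carrier (free_module R S)" and r: "r \<in> carrier R"
  shows "(\<lambda>i. r \<otimes> f i) \<in> carrier (free_module R S)"
proof (rule free_moduleI)
  show "{i. r \<otimes> f i \<noteq> \<zero>} \<subseteq> {i. f i \<noteq> \<zero>}" using r by auto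
qed (use free_module_closed[OF f] free_module_support[OF f] r in auto)

lemma module_free_module: "module R (free_module R S)"
proof (rule moduleI)
  show "abelian_group (free_module R S)"
  proof (rule abelian_groupI)
    fix f assume f: "f \<in> carrier (free_module R S)"
    have "\<ominus> \<one> \<otimes> f i \<oplus> f i = \<zero>" for i using free_module_closed[OF f] by (simp add: l_minus l_neg)
    then show "\<exists>g\<in>carrier (free_module R S). g \<oplus>\<^bsub>free_module R S\<^esub> f = \<zero>\<^bsub>free_module R S\<^esub>"
      using free_module_smult_closed[OF f, of "\<ominus> \<one>"]
      by (intro bexI[of _ "\<lambda>i. \<ominus> \<one> \<otimes> f i"]) (auto simp: free_module_simps(2,3))
  qed (auto simp: free_module_simps(2,3) free_module_add_closed free_module_closed a_ac
      free_module_simps(1)[of "\<lambda>i. \<zero>"])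
qed (auto simp: free_module_simps(3,4) free_module_smult_closed free_module_closed l_distr r_distr m_assoc
    cring_axioms)

lemma free_basis_closed: "i \<in> S \<Longrightarrow> free_basis R i \<in> carrier (free_module R S)"
  by (rule free_moduleI[of _ "{i}"]) (auto simp: free_basis_def)

text \<open>Induction on the support: splitting off the multiple of one basis element removes one
  index.\<close>

lemma free_module_span:
  assumes H: "submodule H R (free_module R S)" and basis: "\<And>i. i \<in> S \<Longrightarrow> free_basis R i \<in> H"
    and f: "f \<in> carrier (free_module R S)"
  shows "f \<in> H"
proof -
  interpret F: module R "free_module R S" by (rule module_free_module)
  have "g \<in> H" if "finite U" "g \<in> carrier (free_module R S)" "{i. g i \<noteq> \<zero>} \<subseteq> U" for U g
    using that
  proof (induction U arbitrary: g rule: finite_induct)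
    case empty
    then have "g = \<zero>\<^bsub>free_module R S\<^esub>" by (auto simp: free_module_simps(2))
    then show ?case using F.submodule_zero[OF H] by simp
  next
    case (insert u U)
    let ?g = "g(u := \<zero>)"
    show ?case
    proof (cases "g u = \<zero>")
      case True
      then have "{i. g i \<noteq> \<zero>} \<subseteq> U" using insert.prems by auto
      then show ?thesis using insert by blast
    next
      case False
      then have u: "u \<in> S" using insert.prems by (auto simp: free_module_simps)
      have g': "?g \<in> carrier (free_module R S)"
      proof (rule free_moduleI)
        show "{i. ?g i \<noteq> \<zero>} \<subseteq> {i. g i \<noteq> \<zero>}" by auto
      qed (use free_module_closed[OF insert.prems(1)] free_module_support[OF insert.prems(1)] in auto)
      have "{i. ?g i \<noteq> \<zero>} \<subseteq> U" using insert.prems(2) by auto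
      then have "?g \<in> H" by (rule insert.IH[OF g'])
      moreover have "g u \<odot>\<^bsub>free_module R S\<^esub> free_basis R u \<in> H"
        using F.submoduleE(4)[OF H free_module_closed[OF insert.prems(1)] basis[OF u]] .
      moreover have "g = ?g \<oplus>\<^bsub>free_module R S\<^esub> g u \<odot>\<^bsub>free_module R S\<^esub> free_basis R u"
        using free_module_closed[OF insert.prems(1)]
        by (auto simp: free_module_simps(3,4) free_basis_def fun_eq_iff)
      ultimately show ?thesis using F.submoduleE(5)[OF H] by metis
    qed
  qed
  then show ?thesis using f by (auto simp: free_module_simps)
qed

end

context module
begin

definition free_lift :: "('i \<Rightarrow> 'c) \<Rightarrow> ('i \<Rightarrow> 'a) \<Rightarrow> 'c" where
  "free_lift \<phi> f = (\<Oplus>\<^bsub>M\<^esub>i\<in>{i. f i \<noteq> \<zero>}. f i \<odot>\<^bsub>M\<^esub> \<phi> i)"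

text \<open>The sums for f, g and their sum can thus be taken over a common index set.\<close>

lemma free_lift_superset:
  assumes f: "f \<in> carrier (free_module R S)" and \<phi>: "\<And>i. i \<in> S \<Longrightarrow> \<phi> i \<in> carrier M"
    and U: "finite U" "{i. f i \<noteq> \<zero>} \<subseteq> U" "U \<subseteq> S"
  shows "free_lift \<phi> f = (\<Oplus>\<^bsub>M\<^esub>i\<in>U. f i \<odot>\<^bsub>M\<^esub> \<phi> i)"
  unfolding free_lift_def
  by (rule M.add.finprod_mono_neutral_cong_left)
    (use U \<phi> R.free_module_closed[OF f] in \<open>auto simp: subset_iff\<close>)

lemma linear_map_free_lift:
  assumes \<phi>: "\<And>i. i \<in> S \<Longrightarrow> \<phi> i \<in> carrier M"
  shows "linear_map R (free_module R S) M (free_lift \<phi>)"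
  unfolding linear_map_def
proof (intro conjI ballI)
  fix f assume f: "f \<in> carrier (free_module R S)"
  note fc = R.free_module_closed[OF f]
  have Uf: "finite {i. f i \<noteq> \<zero>}" "{i. f i \<noteq> \<zero>} \<subseteq> S" using f by (auto simp: R.free_module_simps)
  show "free_lift \<phi> f \<in> carrier M"
    unfolding free_lift_def using fc \<phi> Uf by (intro M.finsum_closed) (auto simp: subset_iff)
  {
    fix g assume g: "g \<in> carrier (free_module R S)"
    note gc = R.free_module_closed[OF g]
    have Ug: "finite {i. g i \<noteq> \<zero>}" "{i. g i \<noteq> \<zero>} \<subseteq> S" using g by (auto simp: R.free_module_simps)
    let ?U = "{i. f i \<noteq> \<zero>} \<union> {i. g i \<noteq> \<zero>}"
    have U: "finite ?U" "?U \<subseteq> S" using Uf Ug by auto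
    have "{i. f i \<oplus> g i \<noteq> \<zero>} \<subseteq> ?U" by auto
    then have "free_lift \<phi> (\<lambda>i. f i \<oplus> g i) = (\<Oplus>\<^bsub>M\<^esub>i\<in>?U. (f i \<oplus> g i) \<odot>\<^bsub>M\<^esub> \<phi> i)"
      using free_lift_superset[OF R.free_module_add_closed[OF f g] \<phi> U(1) _ U(2)] by simp
    also have "\<dots> = (\<Oplus>\<^bsub>M\<^esub>i\<in>?U. f i \<odot>\<^bsub>M\<^esub> \<phi> i \<oplus>\<^bsub>M\<^esub> g i \<odot>\<^bsub>M\<^esub> \<phi> i)"
      using fc gc \<phi> U(2) by (intro M.finsum_cong') (auto simp: smult_l_distr subset_iff)
    also have "\<dots> = (\<Oplus>\<^bsub>M\<^esub>i\<in>?U. f i \<odot>\<^bsub>M\<^esub> \<phi> i) \<oplus>\<^bsub>M\<^esub> (\<Oplus>\<^bsub>M\<^esub>i\<in>?U. g i \<odot>\<^bsub>M\<^esub> \<phi> i)"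
      using fc gc \<phi> U(2) by (intro M.finsum_addf) (auto simp: subset_iff)
    also have "\<dots> = free_lift \<phi> f \<oplus>\<^bsub>M\<^esub> free_lift \<phi> g"
      using free_lift_superset[OF f \<phi> U(1) _ U(2)] free_lift_superset[OF g \<phi> U(1) _ U(2)] by simp
    finally show "free_lift \<phi> (f \<oplus>\<^bsub>free_module R S\<^esub> g) = free_lift \<phi> f \<oplus>\<^bsub>M\<^esub> free_lift \<phi> g"
      by (simp add: R.free_module_simps(3))
  }
next
  fix r f assume r: "r \<in> carrier R" and f: "f \<in> carrier (free_module R S)"
  note fc = R.free_module_closed[OF f]
  let ?U = "{i. f i \<noteq> \<zero>}"
  have U: "finite ?U" "?U \<subseteq> S" using f by (auto simp: R.free_module_simps)
  have "{i. r \<otimes> f i \<noteq> \<zero>} \<subseteq> ?U" using r by auto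
  then have "free_lift \<phi> (\<lambda>i. r \<otimes> f i) = (\<Oplus>\<^bsub>M\<^esub>i\<in>?U. (r \<otimes> f i) \<odot>\<^bsub>M\<^esub> \<phi> i)"
    using free_lift_superset[OF R.free_module_smult_closed[OF f r] \<phi> U(1) _ U(2)] by simp
  also have "\<dots> = (\<Oplus>\<^bsub>M\<^esub>i\<in>?U. r \<odot>\<^bsub>M\<^esub> (f i \<odot>\<^bsub>M\<^esub> \<phi> i))"
    using fc r \<phi> U(2) by (intro M.finsum_cong') (auto simp: smult_assoc1 subset_iff)
  also have "\<dots> = r \<odot>\<^bsub>M\<^esub> free_lift \<phi> f"
    unfolding free_lift_def using fc r \<phi> U by (intro finsum_smult_ldistr[symmetric]) (auto simp: subset_iff)
  finally show "free_lift \<phi> (r \<odot>\<^bsub>free_module R S\<^esub> f) = r \<odot>\<^bsub>M\<^esub> free_lift \<phi> f"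
    by (simp add: R.free_module_simps(4))
qed

lemma free_lift_basis:
  assumes "i \<in> S" "\<And>i. i \<in> S \<Longrightarrow> \<phi> i \<in> carrier M"
  shows "free_lift \<phi> (free_basis R i) = \<phi> i"
proof -
  have "free_lift \<phi> (free_basis R i) = (\<Oplus>\<^bsub>M\<^esub>j\<in>{i}. free_basis R i j \<odot>\<^bsub>M\<^esub> \<phi> j)"
    using assms by (intro free_lift_superset[OF R.free_basis_closed[OF assms(1)]]) (auto simp: free_basis_def)
  also have "\<dots> = \<phi> i" using assms by (simp add: free_basis_def)
  finally show ?thesis .
qed

end

lemma (in linear_map_pair) map_diff:
  "x \<in> carrier L \<Longrightarrow> y \<in> carrier L \<Longrightarrow> f (x \<ominus>\<^bsub>L\<^esub> y) = f x \<ominus>\<^bsub>N\<^esub> f y"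
  by (simp add: a_minus_def map_add map_minus)

text \<open>
  The two maps \<open>M \<rightarrow> F\<close>, \<open>y \<mapsto> 1 \<otimes> y\<close>, and \<open>F \<rightarrow> M\<close>, \<open>a \<otimes> y \<mapsto> r y\<close> for a chosen
  representative \<open>r\<close> of \<open>a\<close>, are mutually inverse modulo the relations and modulo \<open>I M\<close>.
\<close>

lemma (in F_finite_local_ring) module_length_tensor_quotient:
  fixes M :: "('a, 'm, 'd) module_scheme"
  assumes M: "module R M" and I: "ideal I R"
  shows "module_length R (tensor_product R (quot_ring_module R I) M)
    = local_length R M \<mm> (ideal_span R M {\<zero>\<^bsub>M\<^esub>} I) (carrier M)"
proof -
  interpret M: prime_module R M \<mm> using M prime_max by (simp add: prime_module_def)
  interpret I: ideal I R by (rule I)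
  let ?A = "quot_ring_module R I"
  let ?S = "carrier ?A \<times> carrier M"
  let ?F = "free_module R ?S"
  let ?rel = "tensor_relations R ?A M"
  let ?G = "gen_submodule R ?F ?rel"
  let ?IM = "ideal_span R M {\<zero>\<^bsub>M\<^esub>} I"
  let ?\<delta> = "\<lambda>a y. free_basis R (a, y)"
  have carA: "carrier ?A = {I +>\<^bsub>R\<^esub> r | r. r \<in> carrier R}"
    by (auto simp: quot_ring_module_def FactRing_def A_RCOSETS_def')
  have addA: "(I +>\<^bsub>R\<^esub> r) \<oplus>\<^bsub>?A\<^esub> (I +>\<^bsub>R\<^esub> s) = I +>\<^bsub>R\<^esub> (r \<oplus> s)" if "r \<in> carrier R" "s \<in> carrier R" for r s
    using that by (simp add: quot_ring_module_def FactRing_def I.a_rcos_sum)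
  have smultA: "r \<odot>\<^bsub>?A\<^esub> (I +>\<^bsub>R\<^esub> s) = I +>\<^bsub>R\<^esub> (r \<otimes> s)" if "r \<in> carrier R" "s \<in> carrier R" for r s
    using that by (simp add: quot_ring_module_def FactRing_def I.rcoset_mult_add)
  \<comment> \<open>The chosen representatives are not additive; identities for them hold modulo I
    and become congruences modulo I M after acting on M.\<close>
  define rep where "rep a = (SOME r. r \<in> carrier R \<and> a = I +>\<^bsub>R\<^esub> r)" for a
  have rep: "rep a \<in> carrier R" "a = I +>\<^bsub>R\<^esub> rep a" if "a \<in> carrier ?A" for a
    using that someI_ex[of "\<lambda>r. r \<in> carrier R \<and> a = I +>\<^bsub>R\<^esub> r"] unfolding rep_def carA by blast+
  have rep_diff: "rep a \<ominus> r \<in> I" if "a \<in> carrier ?A" "r \<in> carrier R" "a = I +>\<^bsub>R\<^esub> r" for a r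
    using quotient_eq_iff_same_a_r_cos[OF I rep(1)[OF that(1)] that(2)] rep(2)[OF that(1)] that(3) by simp
  have closedA: "I +>\<^bsub>R\<^esub> r \<in> carrier ?A" if "r \<in> carrier R" for r using that unfolding carA by blast
  interpret F: prime_module R ?F \<mm>
    using module_free_module prime_max by (simp add: prime_module_def)
  define \<phi> where "\<phi> = (\<lambda>(a, y). rep a \<odot>\<^bsub>M\<^esub> y)"
  have \<phi>: "\<phi> i \<in> carrier M" if "i \<in> ?S" for i using that rep(1) by (auto simp: \<phi>_def)
  let ?g = "M.free_lift \<phi>"
  have gl: "linear_map R ?F M ?g" by (rule M.linear_map_free_lift) (rule \<phi>)
  interpret g: linear_map_pair R ?F M ?g
    using M.module_axioms F.module_axioms gl by (simp add: linear_map_pair_def linear_map_pair_axioms_def)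
  have \<delta>c: "?\<delta> a y \<in> carrier ?F" if "a \<in> carrier ?A" "y \<in> carrier M" for a y
    using free_basis_closed[of "(a, y)" ?S] that by simp
  have g\<delta>: "?g (?\<delta> a y) = rep a \<odot>\<^bsub>M\<^esub> y" if "a \<in> carrier ?A" "y \<in> carrier M" for a y
    using M.free_lift_basis[of "(a, y)" ?S \<phi>] that \<phi> by (simp add: \<phi>_def)
  have addA_closed: "a \<oplus>\<^bsub>?A\<^esub> b \<in> carrier ?A" if "a \<in> carrier ?A" "b \<in> carrier ?A" for a b
    using addA[of "rep a" "rep b"] rep[OF that(1)] rep[OF that(2)] closedA[of "rep a \<oplus> rep b"] by simp
  have smultA_closed: "r \<odot>\<^bsub>?A\<^esub> a \<in> carrier ?A" if "r \<in> carrier R" "a \<in> carrier ?A" for r a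
    using smultA[of r "rep a"] rep[OF that(2)] closedA[of "r \<otimes> rep a"] that(1) by simp
  have relI:
    "\<And>a b y. a \<in> carrier ?A \<Longrightarrow> b \<in> carrier ?A \<Longrightarrow> y \<in> carrier M \<Longrightarrow>
      ?\<delta> (a \<oplus>\<^bsub>?A\<^esub> b) y \<ominus>\<^bsub>?F\<^esub> (?\<delta> a y \<oplus>\<^bsub>?F\<^esub> ?\<delta> b y) \<in> ?rel"
    "\<And>a y z. a \<in> carrier ?A \<Longrightarrow> y \<in> carrier M \<Longrightarrow> z \<in> carrier M \<Longrightarrow>
      ?\<delta> a (y \<oplus>\<^bsub>M\<^esub> z) \<ominus>\<^bsub>?F\<^esub> (?\<delta> a y \<oplus>\<^bsub>?F\<^esub> ?\<delta> a z) \<in> ?rel"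
    "\<And>r a y. r \<in> carrier R \<Longrightarrow> a \<in> carrier ?A \<Longrightarrow> y \<in> carrier M \<Longrightarrow>
      ?\<delta> (r \<odot>\<^bsub>?A\<^esub> a) y \<ominus>\<^bsub>?F\<^esub> (r \<odot>\<^bsub>?F\<^esub> ?\<delta> a y) \<in> ?rel"
    "\<And>r a y. r \<in> carrier R \<Longrightarrow> a \<in> carrier ?A \<Longrightarrow> y \<in> carrier M \<Longrightarrow>
      ?\<delta> a (r \<odot>\<^bsub>M\<^esub> y) \<ominus>\<^bsub>?F\<^esub> (r \<odot>\<^bsub>?F\<^esub> ?\<delta> a y) \<in> ?rel"
    unfolding tensor_relations_def Let_def by blast+
  have rel_subset: "?rel \<subseteq> H" if H:
    "\<And>a b y. a \<in> carrier ?A \<Longrightarrow> b \<in> carrier ?A \<Longrightarrow> y \<in> carrier M \<Longrightarrow>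
      ?\<delta> (a \<oplus>\<^bsub>?A\<^esub> b) y \<ominus>\<^bsub>?F\<^esub> (?\<delta> a y \<oplus>\<^bsub>?F\<^esub> ?\<delta> b y) \<in> H"
    "\<And>a y z. a \<in> carrier ?A \<Longrightarrow> y \<in> carrier M \<Longrightarrow> z \<in> carrier M \<Longrightarrow>
      ?\<delta> a (y \<oplus>\<^bsub>M\<^esub> z) \<ominus>\<^bsub>?F\<^esub> (?\<delta> a y \<oplus>\<^bsub>?F\<^esub> ?\<delta> a z) \<in> H"
    "\<And>r a y. r \<in> carrier R \<Longrightarrow> a \<in> carrier ?A \<Longrightarrow> y \<in> carrier M \<Longrightarrow>
      ?\<delta> (r \<odot>\<^bsub>?A\<^esub> a) y \<ominus>\<^bsub>?F\<^esub> (r \<odot>\<^bsub>?F\<^esub> ?\<delta> a y) \<in> H"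
    "\<And>r a y. r \<in> carrier R \<Longrightarrow> a \<in> carrier ?A \<Longrightarrow> y \<in> carrier M \<Longrightarrow>
      ?\<delta> a (r \<odot>\<^bsub>M\<^esub> y) \<ominus>\<^bsub>?F\<^esub> (r \<odot>\<^bsub>?F\<^esub> ?\<delta> a y) \<in> H" for H
    unfolding tensor_relations_def Let_def by (intro Un_least subsetI; elim CollectE exE conjE) (simp_all only: H)
  have relc: "?rel \<subseteq> carrier ?F"
    by (rule rel_subset)
      (simp_all add: \<delta>c addA_closed smultA_closed)
  have G: "submodule ?G R ?F" using F.gen_submodule_submodule[OF relc] .
  have Gc: "?G \<subseteq> carrier ?F" using F.submoduleE(1)[OF G] .
  have relG: "?rel \<subseteq> ?G" by (rule F.gen_submodule_superset)
  have Ic: "I \<subseteq> carrier R" using I.Icarr by blast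
  have IM: "submodule ?IM R M" using M.submodule_ideal_span[of "{\<zero>\<^bsub>M\<^esub>}" I] Ic by simp
  have mIM: "i \<odot>\<^bsub>M\<^esub> y \<in> ?IM" if "i \<in> I" "y \<in> carrier M" for i y using M.ideal_span_mem[OF that] .
  have IM_c: "?IM \<subseteq> carrier M" using M.submoduleE(1)[OF IM] .
  have rep_smult: "(rep a \<odot>\<^bsub>M\<^esub> y) \<ominus>\<^bsub>M\<^esub> (r \<odot>\<^bsub>M\<^esub> y) \<in> ?IM"
    if "a \<in> carrier ?A" "r \<in> carrier R" "a = I +>\<^bsub>R\<^esub> r" "y \<in> carrier M" for a r y
  proof -
    have "(rep a \<ominus> r) \<odot>\<^bsub>M\<^esub> y = (rep a \<odot>\<^bsub>M\<^esub> y) \<ominus>\<^bsub>M\<^esub> (r \<odot>\<^bsub>M\<^esub> y)"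
      using that rep(1)[OF that(1)] by (simp add: a_minus_def M.smult_l_distr M.smult_l_minus)
    then show ?thesis using mIM[OF rep_diff[OF that(1-3)] that(4)] by simp
  qed
  let ?K = "{f \<in> carrier ?F. ?g f \<in> ?IM}"
  have K: "submodule ?K R ?F" by (rule g.submodule_vimage[OF F.carrier_is_submodule IM])
  \<comment> \<open>Relations in the second factor are sent to 0, those in the first factor into I
    M. So g induces a map from the tensor product to M/IM.\<close>
  have "?rel \<subseteq> ?K"
  proof (rule rel_subset)
    fix a b y assume ab: "a \<in> carrier ?A" "b \<in> carrier ?A" and y: "y \<in> carrier M"
    note c = \<delta>c[OF addA_closed[OF ab] y] \<delta>c[OF ab(1) y] \<delta>c[OF ab(2) y]
    have "(rep (a \<oplus>\<^bsub>?A\<^esub> b) \<odot>\<^bsub>M\<^esub> y) \<ominus>\<^bsub>M\<^esub> ((rep a \<oplus> rep b) \<odot>\<^bsub>M\<^esub> y) \<in> ?IM"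
      using addA[of "rep a" "rep b"] rep[OF ab(1)] rep[OF ab(2)] y by (intro rep_smult addA_closed ab) auto
    then show "?\<delta> (a \<oplus>\<^bsub>?A\<^esub> b) y \<ominus>\<^bsub>?F\<^esub> (?\<delta> a y \<oplus>\<^bsub>?F\<^esub> ?\<delta> b y) \<in> ?K"
      using c ab y rep(1)[OF ab(1)] rep(1)[OF ab(2)]
      by (simp add: g.map_diff g.map_add g\<delta> addA_closed M.smult_l_distr)
  next
    fix a y z assume a: "a \<in> carrier ?A" and yz: "y \<in> carrier M" "z \<in> carrier M"
    note c = \<delta>c[OF a M.add.m_closed[OF yz]] \<delta>c[OF a yz(1)] \<delta>c[OF a yz(2)]
    show "?\<delta> a (y \<oplus>\<^bsub>M\<^esub> z) \<ominus>\<^bsub>?F\<^esub> (?\<delta> a y \<oplus>\<^bsub>?F\<^esub> ?\<delta> a z) \<in> ?K"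
      using c a yz rep(1)[OF a] M.submodule_zero[OF IM]
      by (simp add: g.map_diff g.map_add g\<delta> M.smult_r_distr a_minus_def[of M] M.M.r_neg)
  next
    fix r a y assume r: "r \<in> carrier R" and a: "a \<in> carrier ?A" and y: "y \<in> carrier M"
    note c = \<delta>c[OF smultA_closed[OF r a] y] \<delta>c[OF a y]
    have "(rep (r \<odot>\<^bsub>?A\<^esub> a) \<odot>\<^bsub>M\<^esub> y) \<ominus>\<^bsub>M\<^esub> ((r \<otimes> rep a) \<odot>\<^bsub>M\<^esub> y) \<in> ?IM"
      using smultA[of r "rep a"] rep[OF a] r y by (intro rep_smult smultA_closed a) auto
    then show "?\<delta> (r \<odot>\<^bsub>?A\<^esub> a) y \<ominus>\<^bsub>?F\<^esub> (r \<odot>\<^bsub>?F\<^esub> ?\<delta> a y) \<in> ?K"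
      using c r a y rep(1)[OF a]
      by (simp add: g.map_diff g.map_smult g\<delta> smultA_closed M.smult_assoc1)
  next
    fix r a y assume r: "r \<in> carrier R" and a: "a \<in> carrier ?A" and y: "y \<in> carrier M"
    note c = \<delta>c[OF a M.smult_closed[OF r y]] \<delta>c[OF a y]
    have "rep a \<odot>\<^bsub>M\<^esub> (r \<odot>\<^bsub>M\<^esub> y) = r \<odot>\<^bsub>M\<^esub> (rep a \<odot>\<^bsub>M\<^esub> y)"
      using r y rep(1)[OF a] by (simp add: m_comm flip: M.smult_assoc1)
    then show "?\<delta> a (r \<odot>\<^bsub>M\<^esub> y) \<ominus>\<^bsub>?F\<^esub> (r \<odot>\<^bsub>?F\<^esub> ?\<delta> a y) \<in> ?K"
      using c r a y rep(1)[OF a] M.submodule_zero[OF IM]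
      by (simp add: g.map_diff g.map_smult g\<delta> a_minus_def[of M] M.M.r_neg)
  qed
  then have GK: "?G \<subseteq> ?K" by (rule F.gen_submodule_minimal[OF K])
  let ?one = "I +>\<^bsub>R\<^esub> \<one>"
  have one: "?one \<in> carrier ?A" using closedA by simp
  have g_one: "?g (?\<delta> ?one y) \<ominus>\<^bsub>M\<^esub> y \<in> ?IM" if y: "y \<in> carrier M" for y
    using rep_smult[OF one one_closed refl y] g\<delta>[OF one y] y by simp
  \<comment> \<open>As a \<otimes> y = 1 \<otimes> r y for a representative r of a, every class has
    the form 1 \<otimes> y.\<close>
  have span: "\<exists>y\<in>carrier M. f \<ominus>\<^bsub>?F\<^esub> ?\<delta> ?one y \<in> ?G" if f: "f \<in> carrier ?F" for f
  proof -
    let ?H = "{f \<in> carrier ?F. \<exists>y\<in>carrier M. f \<ominus>\<^bsub>?F\<^esub> ?\<delta> ?one y \<in> ?G}"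
    have basis: "?\<delta> a y \<in> ?H" if a: "a \<in> carrier ?A" and y: "y \<in> carrier M" for a y
    proof -
      note r = rep[OF a]
      have "?\<delta> (rep a \<odot>\<^bsub>?A\<^esub> ?one) y \<ominus>\<^bsub>?F\<^esub> (rep a \<odot>\<^bsub>?F\<^esub> ?\<delta> ?one y) \<in> ?G"
        using relI(3)[OF r(1) one y] relG by blast
      moreover have "rep a \<odot>\<^bsub>?A\<^esub> ?one = a" using smultA[OF r(1) one_closed] r by simp
      moreover have "(rep a \<odot>\<^bsub>?F\<^esub> ?\<delta> ?one y) \<ominus>\<^bsub>?F\<^esub> ?\<delta> ?one (rep a \<odot>\<^bsub>M\<^esub> y) \<in> ?G"
        using F.diff_mem_sym[OF G \<delta>c[OF one M.smult_closed[OF r(1) y]] F.smult_closed[OF r(1) \<delta>c[OF one y]]]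
          relI(4)[OF r(1) one y] relG by blast
      ultimately have "?\<delta> a y \<ominus>\<^bsub>?F\<^esub> ?\<delta> ?one (rep a \<odot>\<^bsub>M\<^esub> y) \<in> ?G"
        using F.diff_mem_trans[OF G \<delta>c[OF a y] F.smult_closed[OF r(1) \<delta>c[OF one y]]
            \<delta>c[OF one M.smult_closed[OF r(1) y]]] by simp
      then show ?thesis using \<delta>c[OF a y] M.smult_closed[OF r(1) y] by blast
    qed
    have add: "f \<oplus>\<^bsub>?F\<^esub> f' \<in> ?H" if "f \<in> ?H" "f' \<in> ?H" for f f'
    proof -
      obtain y y' where y: "f \<in> carrier ?F" "y \<in> carrier M" "f \<ominus>\<^bsub>?F\<^esub> ?\<delta> ?one y \<in> ?G"
        "f' \<in> carrier ?F" "y' \<in> carrier M" "f' \<ominus>\<^bsub>?F\<^esub> ?\<delta> ?one y' \<in> ?G" using \<open>f \<in> ?H\<close> \<open>f' \<in> ?H\<close> by blast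
      note c = \<delta>c[OF one y(2)] \<delta>c[OF one y(5)] \<delta>c[OF one M.add.m_closed[OF y(2,5)]]
      have "(f \<oplus>\<^bsub>?F\<^esub> f') \<ominus>\<^bsub>?F\<^esub> (?\<delta> ?one y \<oplus>\<^bsub>?F\<^esub> ?\<delta> ?one y') \<in> ?G"
        using F.diff_mem_add[OF G y(1) c(1) y(4) c(2) y(3,6)] .
      moreover have "(?\<delta> ?one y \<oplus>\<^bsub>?F\<^esub> ?\<delta> ?one y') \<ominus>\<^bsub>?F\<^esub> ?\<delta> ?one (y \<oplus>\<^bsub>M\<^esub> y') \<in> ?G"
        using F.diff_mem_sym[OF G c(3) F.add.m_closed[OF c(1,2)]] relI(2)[OF one y(2,5)] relG by blast
      ultimately have "(f \<oplus>\<^bsub>?F\<^esub> f') \<ominus>\<^bsub>?F\<^esub> ?\<delta> ?one (y \<oplus>\<^bsub>M\<^esub> y') \<in> ?G"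
        by (rule F.diff_mem_trans[OF G F.add.m_closed[OF y(1,4)] F.add.m_closed[OF c(1,2)] c(3)])
      then show ?thesis using F.add.m_closed[OF y(1,4)] M.add.m_closed[OF y(2,5)] by blast
    qed
    have smult: "r \<odot>\<^bsub>?F\<^esub> f \<in> ?H" if "r \<in> carrier R" "f \<in> ?H" for r f
    proof -
      obtain y where y: "f \<in> carrier ?F" "y \<in> carrier M" "f \<ominus>\<^bsub>?F\<^esub> ?\<delta> ?one y \<in> ?G" using \<open>f \<in> ?H\<close> by blast
      note r = \<open>r \<in> carrier R\<close>
      note c = \<delta>c[OF one y(2)] \<delta>c[OF one M.smult_closed[OF r y(2)]]
      have "r \<odot>\<^bsub>?F\<^esub> f \<ominus>\<^bsub>?F\<^esub> r \<odot>\<^bsub>?F\<^esub> ?\<delta> ?one y \<in> ?G"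
        using F.diff_mem_smult[OF G y(1) c(1) r y(3)] .
      moreover have "r \<odot>\<^bsub>?F\<^esub> ?\<delta> ?one y \<ominus>\<^bsub>?F\<^esub> ?\<delta> ?one (r \<odot>\<^bsub>M\<^esub> y) \<in> ?G"
        using F.diff_mem_sym[OF G c(2) F.smult_closed[OF r c(1)]] relI(4)[OF r one y(2)] relG by blast
      ultimately have "r \<odot>\<^bsub>?F\<^esub> f \<ominus>\<^bsub>?F\<^esub> ?\<delta> ?one (r \<odot>\<^bsub>M\<^esub> y) \<in> ?G"
        by (rule F.diff_mem_trans[OF G F.smult_closed[OF r y(1)] F.smult_closed[OF r c(1)] c(2)])
      then show ?thesis using F.smult_closed[OF r y(1)] M.smult_closed[OF r y(2)] by blast
    qed
    have "submodule ?H R ?F"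
    proof (rule F.submoduleI)
      show "?H \<subseteq> carrier ?F" by blast
      have "\<zero> \<odot>\<^bsub>?F\<^esub> ?\<delta> ?one \<zero>\<^bsub>M\<^esub> \<in> ?H" by (rule smult[OF zero_closed basis[OF one M.M.zero_closed]])
      then show "\<zero>\<^bsub>?F\<^esub> \<in> ?H" using F.smult_l_null[OF \<delta>c[OF one M.M.zero_closed]] by simp
      show "\<ominus>\<^bsub>?F\<^esub> f \<in> ?H" if "f \<in> ?H" for f
      proof -
        have "f \<in> carrier ?F" using that by blast
        then have "\<ominus> \<one> \<odot>\<^bsub>?F\<^esub> f = \<ominus>\<^bsub>?F\<^esub> f" using F.smult_l_minus[OF one_closed] F.smult_one by simp
        then show ?thesis using smult[OF a_inv_closed[OF one_closed] that] by simp
      qed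
    qed (use add smult in blast)+
    then have "f \<in> ?H"
    proof (rule free_module_span[OF _ _ f])
      fix i assume i: "i \<in> ?S"
      obtain a y where "i = (a, y)" by (cases i)
      then show "free_basis R i \<in> ?H" using basis[of a y] i by blast
    qed
    then show ?thesis by blast
  qed
  \<comment> \<open>The chain 1 \<otimes> i y = i (1 \<otimes> y) = (i 1) \<otimes> y, and i 1 is
    zero in R/I.\<close>
  have IM_G: "?IM \<subseteq> {y \<in> carrier M. ?\<delta> ?one y \<in> ?G}"
  proof (rule M.ideal_span_least)
    have zero: "?\<delta> a y \<in> ?G" if "a \<in> carrier ?A" "y \<in> carrier M" "a = I +>\<^bsub>R\<^esub> \<zero>" for a y
    proof -
      have "\<zero> \<odot>\<^bsub>?A\<^esub> a = a" using smultA[of \<zero> "rep a"] rep[OF that(1)] that(3) by simp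
      then have "?\<delta> a y \<ominus>\<^bsub>?F\<^esub> (\<zero> \<odot>\<^bsub>?F\<^esub> ?\<delta> a y) \<in> ?G" using relI(3)[OF zero_closed that(1,2)] relG by auto
      then show ?thesis
        using F.diff_mem_cancel[OF G \<delta>c[OF that(1,2)] F.smult_closed[OF zero_closed \<delta>c[OF that(1,2)]]]
          F.smult_l_null[OF \<delta>c[OF that(1,2)]] F.submodule_zero[OF G] by simp
    qed
    have smult: "?\<delta> ?one (r \<odot>\<^bsub>M\<^esub> y) \<in> ?G" if "r \<in> carrier R" "y \<in> carrier M" "r \<odot>\<^bsub>?F\<^esub> ?\<delta> ?one y \<in> ?G" for r y
      using F.diff_mem_cancel[OF G \<delta>c[OF one M.smult_closed[OF that(1,2)]] F.smult_closed[OF that(1) \<delta>c[OF one that(2)]]]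
        relI(4)[OF that(1) one that(2)] relG that(3) by blast
    have z: "?\<delta> ?one \<zero>\<^bsub>M\<^esub> \<in> ?G"
      using smult[OF zero_closed M.M.zero_closed] F.smult_l_null[OF \<delta>c[OF one M.M.zero_closed]]
        F.submodule_zero[OF G] by simp
    show "submodule {y \<in> carrier M. ?\<delta> ?one y \<in> ?G} R M"
    proof (rule M.submoduleI)
      show "y \<oplus>\<^bsub>M\<^esub> w \<in> {y \<in> carrier M. ?\<delta> ?one y \<in> ?G}"
        if "y \<in> {y \<in> carrier M. ?\<delta> ?one y \<in> ?G}" "w \<in> {y \<in> carrier M. ?\<delta> ?one y \<in> ?G}" for y w
      proof -
        have c: "y \<in> carrier M" "w \<in> carrier M" "?\<delta> ?one y \<in> ?G" "?\<delta> ?one w \<in> ?G" using that by auto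
        then show ?thesis
          using F.diff_mem_cancel[OF G \<delta>c[OF one M.add.m_closed[OF c(1,2)]] F.add.m_closed[OF \<delta>c[OF one c(1)] \<delta>c[OF one c(2)]]]
            relI(2)[OF one c(1,2)] relG F.submoduleE(5)[OF G c(3,4)] by auto
      qed
      show sm: "r \<odot>\<^bsub>M\<^esub> y \<in> {y \<in> carrier M. ?\<delta> ?one y \<in> ?G}"
        if "r \<in> carrier R" "y \<in> {y \<in> carrier M. ?\<delta> ?one y \<in> ?G}" for r y
        using that smult[OF that(1)] F.submoduleE(4)[OF G that(1)] by simp
      show "\<ominus>\<^bsub>M\<^esub> y \<in> {y \<in> carrier M. ?\<delta> ?one y \<in> ?G}" if y: "y \<in> {y \<in> carrier M. ?\<delta> ?one y \<in> ?G}" for y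
      proof -
        have yc: "y \<in> carrier M" using y by blast
        then have "\<ominus> \<one> \<odot>\<^bsub>M\<^esub> y = \<ominus>\<^bsub>M\<^esub> y" by (simp add: M.smult_l_minus)
        then show ?thesis using sm[OF a_inv_closed[OF one_closed] y] by simp
      qed
    qed (use z in auto)
    show "{\<zero>\<^bsub>M\<^esub>} \<subseteq> {y \<in> carrier M. ?\<delta> ?one y \<in> ?G}" using z by simp
    fix i y assume i: "i \<in> I" and y: "y \<in> carrier M"
    have ic: "i \<in> carrier R" using i Ic by blast
    have io: "i \<odot>\<^bsub>?A\<^esub> ?one = I +>\<^bsub>R\<^esub> \<zero>"
      using smultA[OF ic one_closed] quotient_eq_iff_same_a_r_cos[OF I ic zero_closed] i ic
      by (simp add: a_minus_def)
    have ac: "i \<odot>\<^bsub>?A\<^esub> ?one \<in> carrier ?A" using smultA_closed[OF ic one] .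
    have "(i \<odot>\<^bsub>?F\<^esub> ?\<delta> ?one y) \<ominus>\<^bsub>?F\<^esub> ?\<delta> (i \<odot>\<^bsub>?A\<^esub> ?one) y \<in> ?G"
      using F.diff_mem_sym[OF G \<delta>c[OF ac y] F.smult_closed[OF ic \<delta>c[OF one y]]] relI(3)[OF ic one y] relG by blast
    then have "i \<odot>\<^bsub>?F\<^esub> ?\<delta> ?one y \<in> ?G"
      using F.diff_mem_cancel[OF G F.smult_closed[OF ic \<delta>c[OF one y]] \<delta>c[OF ac y]] zero[OF ac y io] by blast
    then show "i \<odot>\<^bsub>M\<^esub> y \<in> {y \<in> carrier M. ?\<delta> ?one y \<in> ?G}" using smult[OF ic y] ic y by simp
  qed
  \<comment> \<open>Surjectivity: g sends 1 \<otimes> y to y modulo I M.\<close>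
  have "local_length R M \<mm> ?IM (carrier M) \<le> local_length R ?F \<mm> ?G (carrier ?F)"
  proof (rule g.local_length_le_of_surj[OF prime_max F.carrier_is_submodule IM M.carrier_is_submodule Gc IM_c])
    show "?g ` ?G \<subseteq> ?IM" using GK by blast
    have im: "submodule (?g ` carrier ?F <+>\<^bsub>M\<^esub> ?IM) R M"
      using M.submodule_set_add[OF g.submodule_image[OF F.carrier_is_submodule] IM] .
    have "carrier M \<subseteq> ?g ` carrier ?F <+>\<^bsub>M\<^esub> ?IM"
    proof
      fix y assume y: "y \<in> carrier M"
      have gc: "?g (?\<delta> ?one y) \<in> carrier M" using g.map_closed[OF \<delta>c[OF one y]] .
      have d: "y \<ominus>\<^bsub>M\<^esub> ?g (?\<delta> ?one y) \<in> ?IM" using M.diff_mem_sym[OF IM gc y g_one[OF y]] .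
      have "?g (?\<delta> ?one y) \<oplus>\<^bsub>M\<^esub> (y \<ominus>\<^bsub>M\<^esub> ?g (?\<delta> ?one y)) = y"
        using y gc by (simp add: a_minus_def M.M.a_lcomm M.M.r_neg)
      then show "y \<in> ?g ` carrier ?F <+>\<^bsub>M\<^esub> ?IM"
        using M.set_addI[OF imageI[OF \<delta>c[OF one y], of ?g] d] by simp
    qed
    then show "local_le R M \<mm> (carrier M) (?g ` carrier ?F <+>\<^bsub>M\<^esub> ?IM)"
      by (rule M.local_le_subset[OF _ M.submoduleE(1)[OF im]])
  qed
  moreover have "local_length R ?F \<mm> ?G (carrier ?F) \<le> local_length R M \<mm> ?IM (carrier M)"
  proof (rule g.local_length_le_of_inj[OF prime_max F.carrier_is_submodule IM M.carrier_is_submodule Gc IM_c])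
    show "?g ` carrier ?F \<subseteq> carrier M" using g.map_closed by blast
    \<comment> \<open>Injectivity: f is congruent to some 1 \<otimes> y; if g sends f into I M, then
      y lies in I M, so 1 \<otimes> y vanishes in the tensor product.\<close>
    have "?K \<subseteq> ?G"
    proof
      fix f assume "f \<in> ?K"
      then have f: "f \<in> carrier ?F" "?g f \<in> ?IM" by auto
      obtain y where y: "y \<in> carrier M" "f \<ominus>\<^bsub>?F\<^esub> ?\<delta> ?one y \<in> ?G" using span[OF f(1)] by blast
      note c = \<delta>c[OF one y(1)]
      note gc = g.map_closed[OF f(1)] g.map_closed[OF c]
      have "?g f \<ominus>\<^bsub>M\<^esub> ?g (?\<delta> ?one y) \<in> ?IM" using GK y(2) g.map_diff[OF f(1) c] by auto
      then have "?g (?\<delta> ?one y) \<in> ?IM"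
        using M.diff_mem_cancel[OF IM gc(2,1) M.diff_mem_sym[OF IM gc]] f(2) by blast
      then have "y \<in> ?IM"
        using M.diff_mem_cancel[OF IM y(1) gc(2) M.diff_mem_sym[OF IM gc(2) y(1) g_one[OF y(1)]]] by blast
      then have "?\<delta> ?one y \<in> ?G" using IM_G by blast
      then show "f \<in> ?G" using F.diff_mem_cancel[OF G f(1) c y(2)] by blast
    qed
    then show "local_le R ?F \<mm> {x \<in> carrier ?F. ?g x \<in> ?IM} ?G" by (rule F.local_le_subset[OF _ Gc])
  qed
  moreover have "module_length R (tensor_product R ?A M) = local_length R ?F \<mm> ?G (carrier ?F)"
    unfolding tensor_product_def Let_def
    by (rule module_length_quot_module[OF module_free_module G])
  ultimately show ?thesis by simp
qed

theorem proposition3p4: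
  fixes R :: "('a, 'b) ring_scheme" and \<mm> :: "'a set"
    and M :: "('a, 'm, 'c) module_scheme" and d p :: nat
  assumes "local_ring R \<mm>" and "noetherian_ring R" and "reduced R"
    and "krull_dim R = enat d"
    and "Factorial_Ring.prime p" and "ring_char R = p" and "F_finite R"
    and "module R M" and "fin_gen_module R M"
  shows "\<exists>C::real. C > 0 \<and>
    (\<forall>e e'::nat. \<forall>I. e \<ge> 1 \<longrightarrow> e' \<ge> 1 \<longrightarrow> ideal I R \<longrightarrow> frob_power R (p ^ e) \<mm> \<subseteq> I \<longrightarrow>
      \<bar>ereal_of_enat (module_length R (tensor_product R (quot_ring_module R I) M))
        - ereal (1 / real p ^ (e' * d)) *
          ereal_of_enat (module_length R
            (tensor_product R (quot_ring_module R (frob_power R (p ^ e') I)) M))\<bar>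
      \<le> ereal (C * real p powi (int e * (int d - 1))))"
proof -
  interpret cring R using assms(1) by (simp add: local_ring_def)
  interpret prime_char_ring R p
    using char_add_pow[OF assms(6,5)] assms(5) by unfold_locales
  obtain gs where gs: "generates R frobenius_module gs"
    using module.fin_gen_generates[OF module_frobenius] assms(6,7) unfolding F_finite_def by blast
  obtain hs where hs: "generates R M hs" using module.fin_gen_generates[OF assms(8,9)] by blast
  have dim: "dim_less R {\<zero>\<^bsub>R\<^esub>} (Suc d)"
    unfolding dim_less_def
  proof (intro allI impI)
    fix n P assume "prime_chain R {\<zero>\<^bsub>R\<^esub>} n P"
    then have "enat n \<le> krull_dim R" unfolding krull_dim_def prime_chain_def
      by (intro Sup_upper) blast
    then show "n < Suc d" using assms(4) by simp
  qed
  interpret F_finite_local_ring R p \<mm> gs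
    using prime_char_ring_axioms assms(1,2) gs
    by (intro F_finite_local_ring.intro F_finite_local_ring_axioms.intro)
  interpret F_finite_local_module R p \<mm> gs M hs d
    using F_finite_local_ring_axioms assms(8) hs dim
    by (intro F_finite_local_module.intro F_finite_local_module_axioms.intro)
  obtain C where C: "C > 0" "\<And>e n I. ideal I R \<Longrightarrow> mpow e \<subseteq> I \<Longrightarrow>
      \<bar>ml I - ml (frob_power R (p ^ n) I) / real p ^ (n * d)\<bar> \<le> C * (real p ^ (e * d) / real p ^ e)"
    using frobenius_stability[OF assms(3)] by blast
  \<comment> \<open>The ideal contains some \<mm>^[p^e], so the length is finite and the extended
    reals reduce to reals.\<close>
  have len: "ereal_of_enat (module_length R (tensor_product R (quot_ring_module R I) M)) = ereal (ml I)"
    if I: "ideal I R" "mpow e \<subseteq> I" for e I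
  proof -
    have "module_length R (tensor_product R (quot_ring_module R I) M) = mlen I"
      unfolding mlen_def by (rule module_length_tensor_quotient[OF assms(8) I(1)])
    moreover obtain k where "mlen I = enat k" using mlen_finite[OF I] by blast
    ultimately show ?thesis by (simp add: ml_def real_of_enat_def)
  qed
  have p0: "real p \<noteq> 0" using p_gt_1 by simp
  have "\<bar>ereal_of_enat (module_length R (tensor_product R (quot_ring_module R I) M))
        - ereal (1 / real p ^ (n * d)) *
          ereal_of_enat (module_length R (tensor_product R (quot_ring_module R (frob_power R (p ^ n) I)) M))\<bar>
      \<le> ereal (C * real p powi (int e * (int d - 1)))"
    if I: "ideal I R" "mpow e \<subseteq> I" for e n I
  proof -
    have Ic: "I \<subseteq> carrier R" using ideal.Icarr[OF I(1)] by blast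
    have "mpow (e + n) \<subseteq> frob_power R (p ^ n) I"
      using frob_power_frob_power[OF max_carrier, of n e] frob_power_mono[OF Ic I(2), of "p ^ n"] by simp
    note l = len[OF I] len[OF ideal_frob[OF I(1)] this]
    \<comment> \<open>The exponent is an integer, as it can be negative for d = 0; it is matched
      with the quotient of p^(e d) by p^e used so far.\<close>
    have "int e * (int d - 1) = int (e * d) - int e" by (simp add: algebra_simps)
    then have "real p powi (int e * (int d - 1)) = real p ^ (e * d) / real p ^ e"
      using p0 by (simp add: power_int_diff del: of_nat_mult)
    then show ?thesis using C(2)[OF I, of n] unfolding l by simp
  qed
  then show ?thesis using C(1) by blast
qed

end
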